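(* Let $B>0$ and $L>0$. Suppose that the trading cost functions $T_i^j, L_i^j, B_i^j$ are continuous, that $\mathcal{P}\subset\mathcal{M}_1(\Omega)$ is a non-empty finite set of Borel probability measures, that $\beta:\mathbb{R}\to[0,\infty)$ is continuous with $\beta(x)=0$ for $x\le 0$ and $\beta(x)>0$ for $x>0$, and that the activation function $\psi$ is either the ReLU function or a continuously differentiable non-polynomial function. Let $\Phi:\Omega\to\mathbb{R}$ be Borel measurable with $\|\Phi\|_{\infty,\Omega}\le B$. Let $(\mathcal{F}_i)_{i\in\mathbb{N}}$ be the $\sigma$-algebras associated with the nested finite partitions $(H_i)_{i\in\mathbb{N}}$ of the terminal state space, and assume that $$\sigma(S_{t_n})=\sigma\Big(\bigcup_{i=1}^\infty\mathcal{F}_i\Big).$$ Then $$\lim_{k\to\infty}\lim_{i\to\infty}\mathcal{X}^{\mathrm{Ridge}}_{B,L,k}(\Phi,\mathcal{F}_i)=\lim_{k\to\infty}\lim_{i\to\infty}\mathcal{X}_{B,L,k}(\Phi,\mathcal{F}_i)=\lim_{k\to\infty}\mathcal{X}_{B,L,k}(\Phi,\sigma(S_{t_n}))=\mathcal{X}_{B,L}(\Phi,\sigma(S_{t_n})).$$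
   Context: Market. Let $a,n\in\mathbb{N}$ (number of assets and of future times $t_1<\dots<t_n$), and for $j=1,\dots,a$ let $\underline{U}^j<\overline{U}^j$ be real numbers. For $i=1,\dots,n$ put $\Omega_i=[\underline{U}^1,\overline{U}^1]^i\times\dots\times[\underline{U}^a,\overline{U}^a]^i\subset\mathbb{R}^{ia}$, and $\Omega=\Omega_n$. The price process is the canonical process: $S^j_{t_i}(x_1^1,\dots,x_n^1;\dots;x_1^a,\dots,x_n^a)=x_i^j$ on $\Omega$, $S_{t_i}=(S^1_{t_i},\dots,S^a_{t_i})$, $S=(S_{t_1},\dots,S_{t_n})$; the initial prices $S_{t_0}=(S^j_{t_0})_{j}\in\prod_{j=1}^a[\underline{U}^j,\overline{U}^j]$ are fixed constants. $\mathcal{M}_1(\Omega)$ is the set of Borel probability measures on $\Omega$. $\|f\|_{\infty,D}=\sup_{x\in D}\|f(x)\|$ and $\|\cdot\|$ is the Euclidean norm. Strategies and costs. A trading strategy is $\Delta=(\Delta_i^j)_{i=0,\dots,n-1;\,j=1,\dots,a}$ with $\Delta_0^j\in\mathbb{R}$ and Borel functions $\Delta_i^j:\mathbb{R}^{ia}\to\mathbb{R}$ for $i\ge1$. Its gross profit is $(\Delta\cdot S)_n=\sum_{j=1}^a\sum_{i=0}^{n-1}\Delta_i^j(S_{t_1},\dots,S_{t_i})(S^j_{t_{i+1}}-S^j_{t_i})$. For $i=0,\dots,n$, $j=1,\dots,a$ there are given transaction, liquidity and borrowing cost functions $T_i^j,L_i^j,B_i^j:\mathbb{R}\times\mathbb{R}\to[0,\infty)$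 (measurable), and the total cost is $E_n(\Delta)=\sum_{j=1}^a\sum_{i=0}^n\big[T_i^j(S^j_{t_i},\Delta_i^j-\Delta_{i-1}^j)+L_i^j(S^j_{t_i},\Delta_i^j-\Delta_{i-1}^j)+B_i^j(S^j_{t_i},\Delta_i^j)\big]$, where $\Delta_i^j$ is evaluated at $(S_{t_1},\dots,S_{t_i})$ and $\Delta_{-1}^j=\Delta_n^j=0$. For $c\in\mathbb{R}$ put $w_{c,\Delta}(S)=c+(\Delta\cdot S)_n-E_n(\Delta)$, a function on $\Omega$. For $B,L>0$, $W_{B,L}$ is the set of all $w_{c,\Delta}$ with $|c|\le B$, $|\Delta_0^j|\le B$, and, for $i=1,\dots,n-1$ and all $j$, $\Delta_i^j:\mathbb{R}^{ia}\to\mathbb{R}$ $L$-Lipschitz with $\sup_{x\in\Omega_i}|\Delta_i^j(x)|\le B$. (Infima over $W_{B,L}$ or its subsets are over the admissible pairs $(c,\Delta)$.) Ridgelet networks. Fix an activation function $\psi:\mathbb{R}\to\mathbb{R}$. For $m\in\mathbb{N}$, $\mathrm{Ridge}_m$ is the set of all $f:\mathbb{R}^m\to\mathbb{R}^a$ of the form $f(x)=\sum_{l=1}^N\alpha_l\,\psi(u_l\cdot x-b_l)$ with $N\in\mathbb{N}$, $\alpha_l\in\mathbb{R}^a$, $u_l\in\mathbb{R}^m$, $b_l\in\mathbb{R}$. With $\pi_j:\mathbb{R}^a\to\mathbb{R}$ the $j$-th coordinate projection, $\mathrm{Ridge}_{i,B,L}$ is the set of $f\in\mathrm{Ridge}_{ia}$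 such that for all $j=1,\dots,a$, $\pi_j\circ f|_{\Omega_i}$ is $L$-Lipschitz and $\|\pi_j\circ f\|_{\infty,\Omega_i}\le B$. Put $W^{\mathrm{Ridge}}_{B,L}=\{w_{c,\Delta}\in W_{B,L}:(\Delta_i^1,\dots,\Delta_i^a)\in\mathrm{Ridge}_{i,B,L}\text{ for all }i=1,\dots,n-1\}$. Functionals. For a $\sigma$-algebra $\mathcal{G}\subseteq\sigma(S)$ and $k\in\mathbb{N}$: $\mathcal{X}_{B,L}(\Phi,\mathcal{G})=\inf_{w_{c,\Delta}\in W_{B,L}}\{c:\ \mathbb{E}_P[w_{c,\Delta}(S)\mid\mathcal{G}]\ge\mathbb{E}_P[\Phi(S)\mid\mathcal{G}]\ P\text{-a.s. for all }P\in\mathcal{P}\}$ (with $\inf\emptyset=+\infty$); $\mathcal{X}_{B,L,k}(\Phi,\mathcal{G})=\inf_{w_{c,\Delta}\in W_{B,L}}\Big\{c+k\sum_{P\in\mathcal{P}}\int_\Omega\beta\big(\mathbb{E}_P[\Phi(S)-w_{c,\Delta}(S)\mid\mathcal{G}]\big)\,dP\Big\}$; $\mathcal{X}^{\mathrm{Ridge}}_{B,L,k}(\Phi,\mathcal{G})$ is the same expression with the infimum over $W^{\mathrm{Ridge}}_{B,L}$. Partitions. $(H_i)_{i\in\mathbb{N}}$ is a sequence of finite partitions of the terminal state space $[\underline{U}^1,\overline{U}^1]\times\dots\times[\underline{U}^a,\overline{U}^a]$ into Borel sets, with $H_{i+1}$ refining $H_i$, and $\mathcal{F}_i=\{S_{t_n}^{-1}(A):A\in\sigma(H_i)\}$.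 *)

theory Defs
  imports "HOL-Probability.Probability"
begin

text \<open>
  Assets are indexed by a finite type \<open>'a\<close>, trading times by natural numbers.  A vector in
  \<open>R\<^sup>i\<^sup>a\<close> is a path \<open>x\<close> whose entries \<open>x 1, ..., x i\<close> are the asset price vectors at times
  \<open>1, ..., i\<close>, extensional outside \<open>{1..i}\<close>.  In particular \<open>R\<^sup>0\<close> has exactly one element, so that a
  strategy is automatically constant at time \<open>0\<close>.
\<close>

type_synonym 'a path = "nat \<Rightarrow> real ^ 'a"

text \<open>The finite product of Borel \<open>\<sigma>\<close>-algebras is the Borel \<open>\<sigma>\<close>-algebra of \<open>R\<^sup>i\<^sup>a\<close> by second countability.\<close>

definition path_borel :: "nat \<Rightarrow> ('a::finite) path measure" where
  "path_borel i = PiM {1..i} (\<lambda>_. borel)"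

definition path_dist :: "nat \<Rightarrow> ('a::finite) path \<Rightarrow> 'a path \<Rightarrow> real" where
  "path_dist i x y = L2_set (\<lambda>s. dist (x s) (y s)) {1..i}"

definition path_inner :: "nat \<Rightarrow> ('a::finite) path \<Rightarrow> 'a path \<Rightarrow> real" where
  "path_inner i u x = (\<Sum>s\<in>{1..i}. u s \<bullet> x s)"

definition path_lipschitz :: "nat \<Rightarrow> real \<Rightarrow> ('a::finite) path set \<Rightarrow> ('a path \<Rightarrow> real) \<Rightarrow> bool" where
  "path_lipschitz i L D f \<longleftrightarrow> (\<forall>x\<in>D. \<forall>y\<in>D. \<bar>f x - f y\<bar> \<le> L * path_dist i x y)"


text \<open>The cost functions take the time, the asset, the asset price and the traded (or held) amount.\<close>

record ('a::finite) market =
  horizon :: nat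
  lower :: "real ^ 'a"
  upper :: "real ^ 'a"
  init_price :: "real ^ 'a"
  trans_cost :: "nat \<Rightarrow> 'a \<Rightarrow> real \<Rightarrow> real \<Rightarrow> real"
  liq_cost :: "nat \<Rightarrow> 'a \<Rightarrow> real \<Rightarrow> real \<Rightarrow> real"
  borrow_cost :: "nat \<Rightarrow> 'a \<Rightarrow> real \<Rightarrow> real \<Rightarrow> real"

definition state_space :: "('a::finite) market \<Rightarrow> (real ^ 'a) set" where
  "state_space M = cbox (lower M) (upper M)"

definition valid_cost :: "('a::finite) market \<Rightarrow> (nat \<Rightarrow> 'a \<Rightarrow> real \<Rightarrow> real \<Rightarrow> real) \<Rightarrow> bool" where
  "valid_cost M K \<longleftrightarrow> (\<forall>i\<le>horizon M. \<forall>j.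
     (\<forall>s d. 0 \<le> K i j s d) \<and> (\<lambda>(s, d). K i j s d) \<in> borel_measurable borel)"

definition continuous_cost :: "('a::finite) market \<Rightarrow> (nat \<Rightarrow> 'a \<Rightarrow> real \<Rightarrow> real \<Rightarrow> real) \<Rightarrow> bool" where
  "continuous_cost M K \<longleftrightarrow> (\<forall>i\<le>horizon M. \<forall>j. continuous_on UNIV (\<lambda>(s, d). K i j s d))"

definition valid_market :: "('a::finite) market \<Rightarrow> bool" where
  "valid_market M \<longleftrightarrow>
     1 \<le> horizon M \<and> (\<forall>j. lower M $ j < upper M $ j) \<and> init_price M \<in> state_space M \<and>
     valid_cost M (trans_cost M) \<and> valid_cost M (liq_cost M) \<and> valid_cost M (borrow_cost M)"

definition path_space :: "('a::finite) market \<Rightarrow> nat \<Rightarrow> 'a path set" where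
  "path_space M i = PiE {1..i} (\<lambda>_. state_space M)"

abbreviation Omega :: "('a::finite) market \<Rightarrow> 'a path set" where
  "Omega M \<equiv> path_space M (horizon M)"

definition Omega_borel :: "('a::finite) market \<Rightarrow> 'a path measure" where
  "Omega_borel M = restrict_space (path_borel (horizon M)) (Omega M)"

definition prob_measures :: "('a::finite) market \<Rightarrow> 'a path measure set" where
  "prob_measures M = {P. prob_space P \<and> sets P = sets (Omega_borel M)}"

definition price :: "('a::finite) market \<Rightarrow> nat \<Rightarrow> 'a path \<Rightarrow> real ^ 'a" where
  "price M i x = (if i = 0 then init_price M else x i)"

definition terminal_algebra :: "('a::finite) market \<Rightarrow> 'a path measure" where
  "terminal_algebra M = vimage_algebra (Omega M) (price M (horizon M)) borel"

definition partition_algebra :: "('a::finite) market \<Rightarrow> (real ^ 'a) set set \<Rightarrow> 'a path measure" where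
  "partition_algebra M H =
     vimage_algebra (Omega M) (price M (horizon M)) (sigma (state_space M) H)"

type_synonym 'a strategy = "nat \<Rightarrow> 'a path \<Rightarrow> real ^ 'a"

definition trading_strategy :: "('a::finite) market \<Rightarrow> 'a strategy \<Rightarrow> bool" where
  "trading_strategy M \<Delta> \<longleftrightarrow>
     (\<forall>i\<in>{1..<horizon M}. \<forall>j. (\<lambda>x. \<Delta> i x $ j) \<in> borel_measurable (path_borel i))"

definition holding :: "('a::finite) market \<Rightarrow> 'a strategy \<Rightarrow> nat \<Rightarrow> 'a path \<Rightarrow> real ^ 'a" where
  "holding M \<Delta> i x = (if i < horizon M then \<Delta> i (restrict x {1..i}) else 0)"

definition trade :: "('a::finite) market \<Rightarrow> 'a strategy \<Rightarrow> nat \<Rightarrow> 'a path \<Rightarrow> real ^ 'a" where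
  "trade M \<Delta> i x = holding M \<Delta> i x - (if i = 0 then 0 else holding M \<Delta> (i - 1) x)"

definition gross_profit :: "('a::finite) market \<Rightarrow> 'a strategy \<Rightarrow> 'a path \<Rightarrow> real" where
  "gross_profit M \<Delta> x =
     (\<Sum>j\<in>UNIV. \<Sum>i<horizon M. holding M \<Delta> i x $ j * (price M (Suc i) x $ j - price M i x $ j))"

definition total_cost :: "('a::finite) market \<Rightarrow> 'a strategy \<Rightarrow> 'a path \<Rightarrow> real" where
  "total_cost M \<Delta> x =
     (\<Sum>j\<in>UNIV. \<Sum>i\<le>horizon M.
        trans_cost M i j (price M i x $ j) (trade M \<Delta> i x $ j) +
        liq_cost M i j (price M i x $ j) (trade M \<Delta> i x $ j) +
        borrow_cost M i j (price M i x $ j) (holding M \<Delta> i x $ j))"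

definition wealth :: "('a::finite) market \<Rightarrow> real \<Rightarrow> 'a strategy \<Rightarrow> 'a path \<Rightarrow> real" where
  "wealth M c \<Delta> x = c + gross_profit M \<Delta> x - total_cost M \<Delta> x"

definition admissible :: "('a::finite) market \<Rightarrow> real \<Rightarrow> real \<Rightarrow> (real \<times> 'a strategy) set" where
  "admissible M B L = {(c, \<Delta>).
     \<bar>c\<bar> \<le> B \<and> trading_strategy M \<Delta> \<and>
     (\<forall>j. \<forall>x\<in>path_space M 0. \<bar>\<Delta> 0 x $ j\<bar> \<le> B) \<and>
     (\<forall>i\<in>{1..<horizon M}. \<forall>j.
        path_lipschitz i L (space (path_borel i)) (\<lambda>x. \<Delta> i x $ j) \<and>
        (\<forall>x\<in>path_space M i. \<bar>\<Delta> i x $ j\<bar> \<le> B))}"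

definition ridge :: "(real \<Rightarrow> real) \<Rightarrow> nat \<Rightarrow> (('a::finite) path \<Rightarrow> real ^ 'a) set" where
  "ridge \<psi> i =
     {f. \<exists>(N::nat) (\<alpha> :: nat \<Rightarrow> real ^ 'a) (u :: nat \<Rightarrow> 'a path) (b :: nat \<Rightarrow> real).
        f = (\<lambda>x. \<Sum>l<N. \<psi> (path_inner i (u l) x - b l) *\<^sub>R \<alpha> l)}"

definition bounded_ridge ::
    "('a::finite) market \<Rightarrow> (real \<Rightarrow> real) \<Rightarrow> real \<Rightarrow> real \<Rightarrow> nat \<Rightarrow> ('a path \<Rightarrow> real ^ 'a) set" where
  "bounded_ridge M \<psi> B L i = {f \<in> ridge \<psi> i. \<forall>j.
     path_lipschitz i L (path_space M i) (\<lambda>x. f x $ j) \<and>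
     (\<forall>x\<in>path_space M i. \<bar>f x $ j\<bar> \<le> B)}"

text \<open>
  A payoff is a function on \<open>\<Omega>\<close> and sees the time-\<open>i\<close> component of a strategy only on \<open>\<Omega>\<^sub>i\<close>, which
  is also where \<^const>\<open>bounded_ridge\<close> imposes its constraints.  Hence the component is required to
  be a network on \<open>\<Omega>\<^sub>i\<close>, while the Lipschitz extension to all of \<open>R\<^sup>i\<^sup>a\<close> demanded by
  \<^const>\<open>admissible\<close> is arbitrary.  (For \<open>\<psi> = exp\<close>, only constant networks are Lipschitz on all of
  \<open>R\<^sup>i\<^sup>a\<close>.)
\<close>

definition ridge_admissible ::
    "('a::finite) market \<Rightarrow> (real \<Rightarrow> real) \<Rightarrow> real \<Rightarrow> real \<Rightarrow> (real \<times> 'a strategy) set" where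
  "ridge_admissible M \<psi> B L = {(c, \<Delta>) \<in> admissible M B L.
     \<forall>i\<in>{1..<horizon M}. \<exists>f\<in>bounded_ridge M \<psi> B L i. \<forall>x\<in>path_space M i. \<Delta> i x = f x}"

definition superhedging_price ::
    "('a::finite) market \<Rightarrow> 'a path measure set \<Rightarrow> real \<Rightarrow> real \<Rightarrow> ('a path \<Rightarrow> real) \<Rightarrow>
      'a path measure \<Rightarrow> ereal" where
  "superhedging_price M \<P> B L \<Phi> G =
     (INF (c, \<Delta>) \<in> {(c, \<Delta>) \<in> admissible M B L.
         \<forall>P\<in>\<P>. AE x in P. real_cond_exp P G (wealth M c \<Delta>) x \<ge> real_cond_exp P G \<Phi> x}.
       ereal c)"

definition penalised_value ::
    "('a::finite) market \<Rightarrow> 'a path measure set \<Rightarrow> (real \<Rightarrow> real) \<Rightarrow> (real \<times> 'a strategy) set \<Rightarrow>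
      nat \<Rightarrow> ('a path \<Rightarrow> real) \<Rightarrow> 'a path measure \<Rightarrow> ereal" where
  "penalised_value M \<P> \<beta> W k \<Phi> G =
     (INF (c, \<Delta>) \<in> W.
       ereal (c + real k *
         (\<Sum>P\<in>\<P>. \<integral>x. \<beta> (real_cond_exp P G (\<lambda>y. \<Phi> y - wealth M c \<Delta> y) x) \<partial>P)))"

definition penalised_price ::
    "('a::finite) market \<Rightarrow> 'a path measure set \<Rightarrow> (real \<Rightarrow> real) \<Rightarrow> real \<Rightarrow> real \<Rightarrow>
      nat \<Rightarrow> ('a path \<Rightarrow> real) \<Rightarrow> 'a path measure \<Rightarrow> ereal" where
  "penalised_price M \<P> \<beta> B L = penalised_value M \<P> \<beta> (admissible M B L)"

definition ridge_penalised_price ::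
    "('a::finite) market \<Rightarrow> 'a path measure set \<Rightarrow> (real \<Rightarrow> real) \<Rightarrow> (real \<Rightarrow> real) \<Rightarrow> real \<Rightarrow> real \<Rightarrow>
      nat \<Rightarrow> ('a path \<Rightarrow> real) \<Rightarrow> 'a path measure \<Rightarrow> ereal" where
  "ridge_penalised_price M \<P> \<beta> \<psi> B L = penalised_value M \<P> \<beta> (ridge_admissible M \<psi> B L)"

definition relu :: "real \<Rightarrow> real" where
  "relu t = max t 0"

definition nested_partitions :: "('a::finite) market \<Rightarrow> (nat \<Rightarrow> (real ^ 'a) set set) \<Rightarrow> bool" where
  "nested_partitions M H \<longleftrightarrow>
     (\<forall>i. finite (H i) \<and> partition_on (state_space M) (H i) \<and> H i \<subseteq> sets borel \<and>
          refines (state_space M) (H (Suc i)) (H i))"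

end

(*
The penalised problem is handled by compactness: strategies in the admissible class are uniformly
Lipschitz and bounded, so every sequence of them has a pointwise convergent subsequence whose limit
is again admissible, and along such sequences wealth converges boundedly.  Together with the
L1-convergence of conditional expectations along the refining partitions (Levy's upward theorem)
this makes the penalised objective sequentially continuous, jointly in the strategy and the
algebra, which gives convergence of the infima in the partition index and in the penalty.

For a fixed algebra the ridgelet infimum equals the unrestricted one.  The point is to approximate
an L-Lipschitz function by networks that are L-Lipschitz with the same L.  Composing with
sin (s x) / s makes the function periodic without increasing its Lipschitz constant; averaging its
translates coordinatewise against the kernel (1 + cos z)^N keeps the constant and produces a finite
sum of cosines of affine forms; and cos is approximated by the activation together with its
Lipschitz seminorm.  For ReLU the latter is piecewise linear interpolation.  For C1 activations it
amounts to uniform density of the dilates and translates of the derivative, which is a continuous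
non-polynomial function; by Frechet's theorem some m-th difference of it does not vanish, and a
Taylor expansion of its m-fold moving average then yields the monomial of degree m.
*)

theory Submission
  imports Defs "HOL-Complex_Analysis.Great_Picard" "HOL-Computational_Algebra.Polynomial"
begin

section \<open>Locally uniform density of translates and dilates\<close>

text \<open>The difficulty is that a network has to respect the very constants \<open>L\<close> and
  \<open>B\<close> of the strategy it replaces, while uniform density says nothing about slopes.
  Errors are therefore measured in the supremum and in the Lipschitz seminorm at once, and the
  target is first multiplied by 1 - \<delta>; the slack gained in slope and in size absorbs whatever
  the network adds. Averaging over translates costs nothing here because its kernel is nonnegative
  of mass one. For smooth activations, monomials arise by differentiating in the weight, but the
  derivative of \<psi> is merely continuous. Integrating over [x, x + h] repairs this: the
  derivative of such an average is the difference f (x + h) - f x, so \<open>m\<close> averages give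
  \<open>m\<close> derivatives, the last of which is a plain difference of the original function.
  Finally, strategies must be Lipschitz on the whole space, whereas networks are constrained on the
  price box only; composition with the projection onto the box, which does not increase distances,
  reconciles the two.\<close>

inductive_set fspan :: "('b \<Rightarrow> real) set \<Rightarrow> ('b \<Rightarrow> real) set" for S where
  fspan_zero: "(\<lambda>_. 0) \<in> fspan S"
| fspan_step: "f \<in> fspan S \<Longrightarrow> s \<in> S \<Longrightarrow> (\<lambda>x. f x + c * s x) \<in> fspan S"

lemma fspan_scaled_base: "s \<in> S \<Longrightarrow> (\<lambda>x. c * s x) \<in> fspan S"
  using fspan_step[OF fspan_zero, of s S c] by simp

lemma fspan_base: "s \<in> S \<Longrightarrow> s \<in> fspan S"
  using fspan_scaled_base[of s S 1] by simp

lemma fspan_add: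
  assumes f: "f \<in> fspan S" and g: "g \<in> fspan S"
  shows "(\<lambda>x. f x + g x) \<in> fspan S"
  using g
proof induction
  case fspan_zero
  then show ?case using f by simp
next
  case (fspan_step g s c)
  then show ?case using fspan.fspan_step[of "\<lambda>x. f x + g x" S s c] by (simp add: add.assoc)
qed

lemma fspan_scale:
  assumes "f \<in> fspan S" shows "(\<lambda>x. c * f x) \<in> fspan S"
  using assms
proof induction
  case fspan_zero
  then show ?case using fspan.fspan_zero by simp
next
  case (fspan_step f s d)
  then show ?case using fspan.fspan_step[of "\<lambda>x. c * f x" S s "c * d"] by (simp add: algebra_simps)
qed

lemma fspan_sum:
  assumes "\<And>i. i \<in> A \<Longrightarrow> f i \<in> fspan S"
  shows "(\<lambda>x. \<Sum>i\<in>A. f i x) \<in> fspan S"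
  using assms
proof (induction A rule: infinite_finite_induct)
  case (insert i A)
  then show ?case using fspan_add[of "f i" S "\<lambda>x. \<Sum>i\<in>A. f i x"] by simp
qed (use fspan_zero in auto)

text \<open>The extra factor \<open>h\<close> lets one induction serve both substitution into the
  argument (\<open>h\<close> constantly 1) and multiplication by a fixed function.\<close>

lemma fspan_substitute:
  assumes "f \<in> fspan S" and "\<And>s. s \<in> S \<Longrightarrow> (\<lambda>x. s (\<phi> x) * h x) \<in> fspan S'"
  shows "(\<lambda>x. f (\<phi> x) * h x) \<in> fspan S'"
  using assms(1)
proof induction
  case fspan_zero
  then show ?case using fspan.fspan_zero by simp
next
  case (fspan_step f s c)
  from fspan_add[OF fspan_step.IH fspan_scale[OF assms(2)[OF fspan_step.hyps(2)], of c]]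
  show ?case by (simp add: algebra_simps)
qed

lemmas fspan_comp = fspan_substitute[where h = "\<lambda>_. 1", simplified]

lemma fspan_subset: "f \<in> fspan S \<Longrightarrow> S \<subseteq> fspan S' \<Longrightarrow> f \<in> fspan S'"
  using fspan_comp[of f S "\<lambda>x. x" S'] by auto

section \<open>Closure of a span under locally uniform convergence\<close>

definition local_uniform_closure :: "(real \<Rightarrow> real) set \<Rightarrow> (real \<Rightarrow> real) set" where
  "local_uniform_closure S = {f. \<forall>R>0. \<forall>e>0. \<exists>g\<in>fspan S. \<forall>t. \<bar>t\<bar> \<le> R \<longrightarrow> \<bar>f t - g t\<bar> \<le> e}"

lemma lucE:
  assumes "f \<in> local_uniform_closure S" "R > 0" "e > 0"
  obtains g where "g \<in> fspan S" "\<And>t. \<bar>t\<bar> \<le> R \<Longrightarrow> \<bar>f t - g t\<bar> \<le> e"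
  using assms unfolding local_uniform_closure_def by blast

lemma luc_base: "f \<in> S \<Longrightarrow> f \<in> local_uniform_closure S"
  unfolding local_uniform_closure_def using fspan_base[of f S] by (auto intro!: bexI[of _ f])

lemma luc_limit:
  assumes "\<And>R e. R > 0 \<Longrightarrow> e > 0 \<Longrightarrow> \<exists>g\<in>local_uniform_closure S. \<forall>t. \<bar>t\<bar> \<le> R \<longrightarrow> \<bar>f t - g t\<bar> \<le> (e::real)"
  shows "f \<in> local_uniform_closure S"
  unfolding local_uniform_closure_def
proof (intro CollectI allI impI)
  fix R e :: real assume "R > 0" "e > 0"
  obtain g where g: "g \<in> local_uniform_closure S" "\<forall>t. \<bar>t\<bar> \<le> R \<longrightarrow> \<bar>f t - g t\<bar> \<le> e/2"
    using assms[of R "e/2"] \<open>R > 0\<close> \<open>e > 0\<close> by auto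
  obtain h where h: "h \<in> fspan S" "\<And>t. \<bar>t\<bar> \<le> R \<Longrightarrow> \<bar>g t - h t\<bar> \<le> e/2"
    using lucE[OF g(1) \<open>R > 0\<close>, of "e/2"] \<open>e > 0\<close> by auto
  have "\<bar>f t - h t\<bar> \<le> e" if "\<bar>t\<bar> \<le> R" for t
    using g(2)[rule_format, OF that] h(2)[OF that] by linarith
  then show "\<exists>g\<in>fspan S. \<forall>t. \<bar>t\<bar> \<le> R \<longrightarrow> \<bar>f t - g t\<bar> \<le> e" using h by blast
qed

lemma luc_zero: "(\<lambda>_. 0) \<in> local_uniform_closure S"
  unfolding local_uniform_closure_def using fspan_zero[of S] by (auto intro!: bexI[of _ "\<lambda>_. 0"])

lemma luc_add:
  assumes "f \<in> local_uniform_closure S" "g \<in> local_uniform_closure S"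
  shows "(\<lambda>t. f t + g t) \<in> local_uniform_closure S"
  unfolding local_uniform_closure_def
proof (intro CollectI allI impI)
  fix R e :: real assume "R > 0" "e > 0"
  then have "e/2 > 0" by simp
  obtain f' where f': "f' \<in> fspan S" "\<And>t. \<bar>t\<bar> \<le> R \<Longrightarrow> \<bar>f t - f' t\<bar> \<le> e/2"
    using lucE[OF assms(1) \<open>R > 0\<close> \<open>e/2 > 0\<close>] by blast
  obtain g' where g': "g' \<in> fspan S" "\<And>t. \<bar>t\<bar> \<le> R \<Longrightarrow> \<bar>g t - g' t\<bar> \<le> e/2"
    using lucE[OF assms(2) \<open>R > 0\<close> \<open>e/2 > 0\<close>] by blast
  have "\<bar>f t + g t - (f' t + g' t)\<bar> \<le> e" if "\<bar>t\<bar> \<le> R" for t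
    using f'(2)[OF that] g'(2)[OF that] by linarith
  then show "\<exists>h\<in>fspan S. \<forall>t. \<bar>t\<bar> \<le> R \<longrightarrow> \<bar>f t + g t - h t\<bar> \<le> e"
    using fspan_add[OF f'(1) g'(1)] by (intro bexI[of _ "\<lambda>t. f' t + g' t"]) auto
qed

lemma luc_scale:
  assumes "f \<in> local_uniform_closure S"
  shows "(\<lambda>t. c * f t) \<in> local_uniform_closure S"
  unfolding local_uniform_closure_def
proof (intro CollectI allI impI)
  fix R e :: real assume "R > 0" "e > 0"
  then have "e / (\<bar>c\<bar> + 1) > 0" by (simp add: add_nonneg_pos)
  then obtain g where g: "g \<in> fspan S" "\<forall>t. \<bar>t\<bar> \<le> R \<longrightarrow> \<bar>f t - g t\<bar> \<le> e / (\<bar>c\<bar> + 1)"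
    using assms \<open>R > 0\<close> unfolding local_uniform_closure_def by blast
  have "\<bar>c * f t - c * g t\<bar> \<le> e" if "\<bar>t\<bar> \<le> R" for t
  proof -
    have "\<bar>c * f t - c * g t\<bar> = \<bar>c\<bar> * \<bar>f t - g t\<bar>" by (simp add: abs_mult flip: right_diff_distrib)
    also have "\<dots> \<le> (\<bar>c\<bar> + 1) * (e / (\<bar>c\<bar> + 1))"
      using g(2) that by (intro mult_mono) auto
    also have "\<dots> = e" by (simp add: add_nonneg_eq_0_iff)
    finally show ?thesis .
  qed
  then show "\<exists>g\<in>fspan S. \<forall>t. \<bar>t\<bar> \<le> R \<longrightarrow> \<bar>c * f t - g t\<bar> \<le> e"
    using fspan_scale[OF g(1)] by (intro bexI[of _ "\<lambda>t. c * g t"]) auto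
qed

lemma luc_sum:
  assumes "\<And>i. i \<in> A \<Longrightarrow> f i \<in> local_uniform_closure S"
  shows "(\<lambda>t. \<Sum>i\<in>A. f i t) \<in> local_uniform_closure S"
  using assms
proof (induction A rule: infinite_finite_induct)
  case (insert i A)
  then show ?case using luc_add[of "f i" S "\<lambda>x. \<Sum>i\<in>A. f i x"] by simp
qed (use luc_zero in auto)

text \<open>Weight zero is excluded because integrating \<rho> (w * t + b) in \<open>t\<close>
  divides by \<open>w\<close>.\<close>

definition neurons :: "(real \<Rightarrow> real) \<Rightarrow> (real \<Rightarrow> real) set" where
  "neurons \<rho> = {\<lambda>t. \<rho> (w * t + b) | w b. w \<noteq> 0}"

lemma luc_affine:
  assumes f: "f \<in> local_uniform_closure (neurons \<rho>)" and "w \<noteq> 0"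
  shows "(\<lambda>t. f (w * t + b)) \<in> local_uniform_closure (neurons \<rho>)"
  unfolding local_uniform_closure_def
proof (intro CollectI allI impI)
  fix R e :: real assume "R > 0" "e > 0"
  have R': "\<bar>w * t + b\<bar> \<le> \<bar>w\<bar> * R + \<bar>b\<bar> + 1" if "\<bar>t\<bar> \<le> R" for t
  proof -
    have "\<bar>w * t + b\<bar> \<le> \<bar>w\<bar> * \<bar>t\<bar> + \<bar>b\<bar>" by (metis abs_mult abs_triangle_ineq)
    then show ?thesis using mult_left_mono[OF that, of "\<bar>w\<bar>"] by simp
  qed
  have "\<bar>w\<bar> * R + \<bar>b\<bar> + 1 > 0" using \<open>R > 0\<close> by (simp add: add_nonneg_pos)
  then obtain g where g: "g \<in> fspan (neurons \<rho>)"
    "\<forall>t. \<bar>t\<bar> \<le> \<bar>w\<bar> * R + \<bar>b\<bar> + 1 \<longrightarrow> \<bar>f t - g t\<bar> \<le> e"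
    using f \<open>e > 0\<close> unfolding local_uniform_closure_def by blast
  have "(\<lambda>t. g (w * t + b)) \<in> fspan (neurons \<rho>)"
  proof (rule fspan_comp[OF g(1)])
    fix s assume "s \<in> neurons \<rho>"
    then obtain u c where "s = (\<lambda>t. \<rho> (u * t + c))" "u \<noteq> 0" by (auto simp: neurons_def)
    then have "(\<lambda>x. s (w * x + b)) = (\<lambda>t. \<rho> ((u * w) * t + (u * b + c)))" "u * w \<noteq> 0"
      using \<open>w \<noteq> 0\<close> by (auto simp: algebra_simps)
    then have "(\<lambda>x. s (w * x + b)) \<in> neurons \<rho>" unfolding neurons_def by blast
    then show "(\<lambda>x. s (w * x + b)) \<in> fspan (neurons \<rho>)" by (rule fspan_base)
  qed
  then show "\<exists>g\<in>fspan (neurons \<rho>). \<forall>t. \<bar>t\<bar> \<le> R \<longrightarrow> \<bar>f (w * t + b) - g t\<bar> \<le> e"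
    using g(2) R' by (intro bexI[of _ "\<lambda>t. g (w * t + b)"]) auto
qed

section \<open>Finite differences and moving averages\<close>

definition fdiff :: "real \<Rightarrow> (real \<Rightarrow> real) \<Rightarrow> real \<Rightarrow> real" where
  "fdiff h f x = f (x + h) - f x"

text \<open>Convolution with the indicator of [-h, 0], not divided by \<open>h\<close>. It gains one
  derivative, and that derivative, \<open>fdiff h f\<close>, is again built from values of
  \<open>f\<close>.\<close>

definition window :: "real \<Rightarrow> (real \<Rightarrow> real) \<Rightarrow> real \<Rightarrow> real" where
  "window h f x = integral {x..x + h} f"

lemma window_antiderivative:
  assumes "continuous_on UNIV f"
  obtains F where "\<And>x. (F has_real_derivative f x) (at x)"
    "\<And>h x. h \<ge> 0 \<Longrightarrow> window h f x = F (x + h) - F x"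
proof -
  have "\<exists>F. \<forall>x::real. -\<infinity> < ereal x \<longrightarrow> ereal x < \<infinity> \<longrightarrow> (F has_vector_derivative f x) (at x)"
    using assms by (intro einterval_antiderivative) (auto simp: continuous_on_eq_continuous_at)
  then obtain F where F: "\<And>x. (F has_vector_derivative f x) (at x)" by auto
  show ?thesis
  proof (rule that)
    show "(F has_real_derivative f x) (at x)" for x
      using F by (simp add: has_real_derivative_iff_has_vector_derivative)
    show "window h f x = F (x + h) - F x" if "h \<ge> 0" for h x
      unfolding window_def using that F
      by (intro integral_unique fundamental_theorem_of_calculus)
         (auto intro: has_vector_derivative_at_within)
  qed
qed

lemma window_has_derivative:
  assumes "continuous_on UNIV f" "h \<ge> 0"
  shows "(window h f has_real_derivative fdiff h f x) (at x)"
proof -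
  obtain F where F: "\<And>x. (F has_real_derivative f x) (at x)"
    "\<And>x. window h f x = F (x + h) - F x"
    using window_antiderivative[OF assms(1)] assms(2) by metis
  have "((\<lambda>x. F (x + h) - F x) has_real_derivative f (x + h) * (1 + 0) - f x) (at x)"
    by (rule DERIV_diff DERIV_chain2[where g = "\<lambda>x. x + h"] F derivative_intros)+
  then show ?thesis by (simp add: F(2)[abs_def] fdiff_def)
qed

lemma continuous_window:
  "continuous_on UNIV f \<Longrightarrow> h \<ge> 0 \<Longrightarrow> continuous_on UNIV (window h f)"
  by (rule DERIV_continuous_on[where D = "fdiff h f"]) (rule has_field_derivative_at_within, rule window_has_derivative)

lemma continuous_fdiff:
  "continuous_on UNIV f \<Longrightarrow> continuous_on UNIV (fdiff h f)"
  unfolding fdiff_def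
  by (rule continuous_on_diff, rule continuous_on_compose2[of UNIV f UNIV "\<lambda>x. x + h"])
     (auto intro!: continuous_on_add)

lemma continuous_window_iter:
  "continuous_on UNIV f \<Longrightarrow> h \<ge> 0 \<Longrightarrow> continuous_on UNIV ((window h ^^ m) f)"
  by (induction m) (auto intro: continuous_window)

lemma continuous_fdiff_iter:
  "continuous_on UNIV f \<Longrightarrow> continuous_on UNIV ((fdiff h ^^ m) f)"
  by (induction m) (auto intro: continuous_fdiff)

text \<open>For an antiderivative \<open>F\<close> of \<open>f\<close>, both sides are the second
  difference F (x + 2h) - 2 F (x + h) + F x.\<close>

lemma window_fdiff:
  assumes "continuous_on UNIV f" "h \<ge> 0"
  shows "window h (fdiff h f) = fdiff h (window h f)"
proof
  fix x
  obtain F where F: "\<And>x. (F has_real_derivative f x) (at x)"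
    "\<And>x. window h f x = F (x + h) - F x"
    using window_antiderivative[OF assms(1)] assms(2) by metis
  have "(fdiff h f has_integral ((F (x + h + h) - F (x + h)) - (F (x + h) - F x))) {x..x+h}"
  proof (rule fundamental_theorem_of_calculus)
    fix y
    have "((\<lambda>x. F (x + h) - F x) has_real_derivative f (y + h) * (1 + 0) - f y) (at y)"
      by (rule DERIV_diff DERIV_chain2[where g = "\<lambda>x. x + h"] F derivative_intros)+
    then show "((\<lambda>x. F (x + h) - F x) has_vector_derivative fdiff h f y) (at y within {x..x+h})"
      by (auto simp: fdiff_def has_real_derivative_iff_has_vector_derivative
            intro: has_vector_derivative_at_within)
  qed (use assms in auto)
  then show "window h (fdiff h f) x = fdiff h (window h f) x"
    by (simp add: window_def[of h "fdiff h f"] integral_unique fdiff_def[of h "window h f"] F(2))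
qed

lemma window_fdiff_iter:
  assumes "continuous_on UNIV f" "h \<ge> 0"
  shows "fdiff h ((window h ^^ m) f) = (window h ^^ m) (fdiff h f)"
proof (induction m)
  case (Suc m)
  then show ?case
    using window_fdiff[OF continuous_window_iter[OF assms, of m] assms(2)] by simp
qed simp

text \<open>Each differentiation trades one average for one difference, so derivatives up to order
  \<open>m\<close> exist although \<open>f\<close> is merely continuous.\<close>

lemma window_iter_derivs:
  assumes f: "continuous_on UNIV f" and h: "h \<ge> 0" and "k < m"
  shows "((window h ^^ (m - k)) ((fdiff h ^^ k) f) has_real_derivative
            (window h ^^ (m - Suc k)) ((fdiff h ^^ Suc k) f) x) (at x)"
proof -
  let ?g = "(fdiff h ^^ k) f"
  have g: "continuous_on UNIV ?g" by (rule continuous_fdiff_iter[OF f])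
  have "(window h ^^ (m - k)) ?g = window h ((window h ^^ (m - Suc k)) ?g)"
    using \<open>k < m\<close> by (metis Suc_diff_Suc comp_apply funpow.simps(2))
  with window_has_derivative[OF continuous_window_iter[OF g h, of "m - Suc k"] h, of x]
  show ?thesis by (simp add: window_fdiff_iter[OF g h])
qed

text \<open>Taylor's formula with Lagrange remainder. In the top derivative no average is left: it
  is the bare m-th difference, whose vanishing or continuity can be exploited directly.\<close>

lemma window_iter_taylor:
  assumes f: "continuous_on UNIV f" and h: "h \<ge> 0"
  shows "\<exists>\<xi>. \<bar>\<xi> - b\<bar> \<le> \<bar>x - b\<bar> \<and> (window h ^^ m) f x =
     (\<Sum>k<m. (window h ^^ (m - k)) ((fdiff h ^^ k) f) b / fact k * (x - b) ^ k)
       + (fdiff h ^^ m) f \<xi> / fact m * (x - b) ^ m"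
\<comment> \<open>Taylor's theorem asks for positive order and for a point other than the
  centre.\<close>
proof (cases "m = 0 \<or> x = b")
  case True
  then show ?thesis
  proof
    assume "x = b"
    show ?thesis
    proof (cases m)
      case (Suc n)
      then show ?thesis using \<open>x = b\<close> by (intro exI[of _ b]) (simp add: sum.lessThan_Suc_shift del: sum.lessThan_Suc)
    qed (auto intro: exI[of _ x])
  qed (auto intro: exI[of _ x])
next
  case False
  let ?diff = "\<lambda>k. (window h ^^ (m - k)) ((fdiff h ^^ k) f)"
  obtain t where "if x < b then x < t \<and> t < b else b < t \<and> t < x"
    "(window h ^^ m) f x = (\<Sum>k<m. ?diff k b / fact k * (x - b) ^ k) + ?diff m t / fact m * (x - b) ^ m"
    using window_iter_derivs[OF f h] Taylor[where a = "min x b" and b = "max x b" and diff = "\<lambda>k. (window h ^^ (m - k)) ((fdiff h ^^ k) f)"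
        and n = m and c = b and x = x and f = "(window h ^^ m) f"] False
    by (auto split: if_splits)
  then show ?thesis by (intro exI[of _ t]) (auto split: if_splits)
qed

section \<open>Frechet's characterisation of polynomials\<close>

lemma pointwise_limit_of_bounded_degree_polys:
  fixes p :: "nat \<Rightarrow> real poly"
  assumes "\<And>n. degree (p n) \<le> m" and "\<And>x. x \<in> X \<Longrightarrow> (\<lambda>n. poly (p n) x) \<longlonglongrightarrow> f x"
  shows "\<exists>q. \<forall>x\<in>X. f x = poly q x"
  using assms
proof (induction m arbitrary: p X f)
  case 0
  show ?case
  proof (cases "X = {}")
    case False
    then obtain a where a: "a \<in> X" by blast
    have "f x = poly [:f a:] x" if "x \<in> X" for x
    proof -
      have "poly (p n) x = poly (p n) a" for n
        using 0(1)[of n] by (auto elim!: degree_eq_zeroE)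
      with 0(2)[OF that] 0(2)[OF a] show ?thesis by (simp add: LIMSEQ_unique)
    qed
    then show ?thesis by blast
  qed auto
next
  case (Suc m)
  show ?case
  proof (cases "X = {}")
    case False
    then obtain a where a: "a \<in> X" by blast
    \<comment> \<open>Dividing out \<open>x - a\<close> lowers the degree bound by one, and the
      quotients still converge at every point of \<open>X\<close> other than \<open>a\<close>; this
      is why \<open>X\<close> is arbitrary in the induction.\<close>
    define q where "q n = synthetic_div (p n) a" for n
    have split: "poly (p n) x = (x - a) * poly (q n) x + poly (p n) a" for n x
      using arg_cong[OF synthetic_div_correct'[of a "p n"], of "\<lambda>r. poly r x"]
      unfolding q_def by (simp add: algebra_simps)
    have "\<exists>r. \<forall>x\<in>X - {a}. (f x - f a) / (x - a) = poly r x"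
    proof (rule Suc.IH)
      show "degree (q n) \<le> m" for n
        using Suc.prems(1)[of n] by (simp add: q_def degree_synthetic_div)
      fix x assume x: "x \<in> X - {a}"
      then have "(\<lambda>n. (poly (p n) x - poly (p n) a) / (x - a)) \<longlonglongrightarrow> (f x - f a) / (x - a)"
        using a by (intro tendsto_intros Suc.prems) auto
      moreover have "(poly (p n) x - poly (p n) a) / (x - a) = poly (q n) x" for n
        using x by (subst split) auto
      ultimately show "(\<lambda>n. poly (q n) x) \<longlonglongrightarrow> (f x - f a) / (x - a)" by simp
    qed
    then obtain r where r: "\<And>x. x \<in> X \<Longrightarrow> x \<noteq> a \<Longrightarrow> (f x - f a) / (x - a) = poly r x" by auto
    have "f x = poly ([:-a, 1:] * r + [:f a:]) x" if "x \<in> X" for x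
      using r[OF that] by (cases "x = a") (auto simp: field_simps)
    then show ?thesis by blast
  qed auto
qed

text \<open>By the mean value theorem each average is \<open>h\<close> times a value of the previous
  one at a nearby point, so the relative error never grows; \<open>m\<close> averages look ahead by
  \<open>m * h\<close>.\<close>

lemma window_iter_near:
  assumes f: "continuous_on UNIV f" and h: "h \<ge> 0"
    and near: "\<And>y. x \<le> y \<Longrightarrow> y \<le> x + real m * h \<Longrightarrow> \<bar>f y - c\<bar> \<le> e"
  shows "\<bar>(window h ^^ m) f x - c * h ^ m\<bar> \<le> e * h ^ m"
  using near
proof (induction m arbitrary: x)
  case 0
  then show ?case by simp
next
  case (Suc m)
  let ?g = "(window h ^^ m) f"
  obtain F where F: "\<And>x. (F has_real_derivative ?g x) (at x)"
    "\<And>x. window h ?g x = F (x + h) - F x"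
    using window_antiderivative[OF continuous_window_iter[OF f h]] h by metis
  show ?case
  proof (cases "h = 0")
    case False
    then have "x < x + h" using h by simp
    then obtain z where z: "x < z" "z < x + h" "F (x + h) - F x = (x + h - x) * ?g z"
      using MVT2[of x "x + h" F ?g] F by blast
    have "\<bar>?g z - c * h ^ m\<bar> \<le> e * h ^ m"
      using z by (intro Suc.IH Suc.prems) (auto simp: algebra_simps)
    then have "h * \<bar>?g z - c * h ^ m\<bar> \<le> h * (e * h ^ m)" using h by (rule mult_left_mono)
    moreover have "\<bar>(window h ^^ Suc m) f x - c * h ^ Suc m\<bar> = \<bar>h * (?g z - c * h ^ m)\<bar>"
      using z F(2)[of x] by (simp add: algebra_simps)
    ultimately show ?thesis using h by (simp only: abs_mult power_Suc) (simp add: mult_ac)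
  qed (use F(2)[of x] in simp)
qed

text \<open>With the m-th differences gone the Taylor remainder vanishes, so the normalised m-fold
  averages are polynomials of degree at most \<open>m\<close>; as the width shrinks they converge
  pointwise to \<open>f\<close>.\<close>

lemma frechet_polynomial:
  fixes f :: "real \<Rightarrow> real"
  assumes f: "continuous_on UNIV f"
    and zero: "\<And>h x. h > 0 \<Longrightarrow> (fdiff h ^^ m) f x = 0"
  shows "\<exists>p. f = poly p"
proof -
  define h where "h n = 1 / real (Suc n)" for n
  have h: "h n > 0" for n by (simp add: h_def)
  define p where "p n = (\<Sum>k<m. monom ((window (h n) ^^ (m - k)) ((fdiff (h n) ^^ k) f) 0
      / fact k / h n ^ m) k)" for n
  have p: "poly (p n) x = (window (h n) ^^ m) f x / h n ^ m" for n x
  proof -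
    obtain \<xi> where "(window (h n) ^^ m) f x =
     (\<Sum>k<m. (window (h n) ^^ (m - k)) ((fdiff (h n) ^^ k) f) 0 / fact k * x ^ k)
       + (fdiff (h n) ^^ m) f \<xi> / fact m * x ^ m"
      using window_iter_taylor[OF f less_imp_le[OF h[of n]], where b = 0 and x = x and m = m] by auto
    then show ?thesis
      using zero[OF h[of n]] by (simp add: p_def poly_sum poly_monom sum_divide_distrib)
  qed
  have "\<exists>q. \<forall>x\<in>UNIV. f x = poly q x"
  proof (rule pointwise_limit_of_bounded_degree_polys)
    show "degree (p n) \<le> m" for n
      unfolding p_def by (rule degree_sum_le) (auto intro: order_trans[OF degree_monom_le])
    fix x :: real
    show "(\<lambda>n. poly (p n) x) \<longlonglongrightarrow> f x"
    proof (rule LIMSEQ_I)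
      fix r :: real assume "r > 0"
      have "isCont f x" using f by (simp add: continuous_on_eq_continuous_at)
      then obtain d where d: "d > 0" "\<And>y. \<bar>y - x\<bar> < d \<Longrightarrow> \<bar>f y - f x\<bar> < r/2"
        unfolding continuous_at_real_range using half_gt_zero[OF \<open>r > 0\<close>] by (metis real_norm_def)
      obtain n0 where n0: "real m / d < real n0" using reals_Archimedean2 by blast
      have "norm (poly (p n) x - f x) < r" if "n \<ge> n0" for n
      proof -
        \<comment> \<open>The m-fold average at \<open>x\<close> looks ahead by
          \<open>m * h n\<close>, which has to fit into the continuity radius
          \<open>d\<close>.\<close>
        have "real m / d < real (Suc n)" using n0 that by linarith
        then have small: "real m * h n < d" using d by (simp add: h_def field_simps)
        have "\<bar>(window (h n) ^^ m) f x - f x * h n ^ m\<bar> \<le> r/2 * h n ^ m"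
          using small by (intro window_iter_near f less_imp_le[OF h] less_imp_le[OF d(2)]) auto
        then have "\<bar>(window (h n) ^^ m) f x / h n ^ m - f x\<bar> \<le> r/2"
          using h[of n] by (simp add: abs_le_iff field_simps)
        then show ?thesis using \<open>r > 0\<close> by (simp add: p)
      qed
      then show "\<exists>no. \<forall>n\<ge>no. norm (poly (p n) x - f x) < r" by blast
    qed
  qed
  then show ?thesis by auto
qed

section \<open>Density of the dilates and translates of a non-polynomial function\<close>

lemma uniform_modulus:
  fixes f :: "real \<Rightarrow> real"
  assumes "continuous_on UNIV f" "e > 0"
  obtains d where "d > 0" "\<And>x y. \<bar>x\<bar> \<le> R \<Longrightarrow> \<bar>y\<bar> \<le> R \<Longrightarrow> \<bar>x - y\<bar> < d \<Longrightarrow> \<bar>f x - f y\<bar> < e"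
proof -
  have "uniformly_continuous_on {-R..R} f"
    using assms by (intro compact_uniformly_continuous) (auto intro: continuous_on_subset)
  then obtain d where "d > 0" "\<forall>x\<in>{-R..R}. \<forall>y\<in>{-R..R}. dist y x < d \<longrightarrow> dist (f y) (f x) < e"
    using \<open>e > 0\<close> unfolding uniformly_continuous_on_def by blast
  then show ?thesis by (intro that[of d]) (auto simp: dist_real_def abs_le_iff abs_minus_commute)
qed

text \<open>Riemann sums are combinations of translates; they are compared with the integral cell by
  cell through an antiderivative and the mean value theorem.\<close>

lemma window_in_luc:
  assumes f: "continuous_on UNIV f" and h: "h > 0"
    and translates: "\<And>c. (\<lambda>t. f (t + c)) \<in> local_uniform_closure S"
  shows "window h f \<in> local_uniform_closure S"
proof (rule luc_limit)
  fix R e :: real assume "R > 0" "e > 0"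
  obtain F where F: "\<And>x. (F has_real_derivative f x) (at x)"
    "\<And>x. window h f x = F (x + h) - F x"
    using window_antiderivative[OF f] h by (metis less_imp_le)
  obtain d where d: "d > 0" "\<And>x y. \<bar>x\<bar> \<le> R + h \<Longrightarrow> \<bar>y\<bar> \<le> R + h \<Longrightarrow> \<bar>x - y\<bar> < d \<Longrightarrow> \<bar>f x - f y\<bar> < e / h"
    using uniform_modulus[OF f, of "e / h" "R + h"] \<open>e > 0\<close> h by auto
  \<comment> \<open>The mesh \<open>h / n\<close> is then finer than the modulus \<open>d\<close>
    for the error \<open>e / h\<close>, and \<open>n\<close> cells of error \<delta> * (e / h) add
    up to \<open>e\<close>.\<close>
  obtain n where n: "h / d < real n" using reals_Archimedean2 by blast
  then have "n > 0" using h d(1) by (metis divide_pos_pos less_trans of_nat_0_less_iff)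
  define \<delta> where "\<delta> = h / real n"
  have \<delta>: "\<delta> > 0" "\<delta> < d" "real n * \<delta> = h"
    using n \<open>n > 0\<close> h d(1) by (auto simp: \<delta>_def field_simps)
  let ?g = "\<lambda>t. \<Sum>k<n. \<delta> * f (t + real k * \<delta>)"
  have "?g \<in> local_uniform_closure S" by (intro luc_sum luc_scale translates)
  moreover have "\<bar>window h f t - ?g t\<bar> \<le> e" if t: "\<bar>t\<bar> \<le> R" for t
  proof -
    have step: "\<bar>F (t + real (Suc k) * \<delta>) - F (t + real k * \<delta>) - \<delta> * f (t + real k * \<delta>)\<bar> \<le> \<delta> * (e / h)"
      if k: "k < n" for k
    proof -
      let ?a = "t + real k * \<delta>" and ?b = "t + real (Suc k) * \<delta>"
      have "?a < ?b" using \<delta> by (simp add: algebra_simps)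
      then obtain z where z: "?a < z" "z < ?b" "F ?b - F ?a = (?b - ?a) * f z"
        using MVT2[of ?a ?b F f] F by blast
      have "real (Suc k) * \<delta> \<le> h" using k \<delta> by (metis Suc_leI less_imp_le mult_right_mono of_nat_le_iff)
      moreover have "0 \<le> real k * \<delta>" using \<delta> by simp
      ultimately have "\<bar>f z - f ?a\<bar> < e / h"
        using z t \<delta>(1,2) h \<open>0 \<le> real k * \<delta>\<close>
        by (intro d(2); simp only: of_nat_Suc distrib_right mult_1; linarith)
      moreover have "F ?b - F ?a - \<delta> * f ?a = \<delta> * (f z - f ?a)"
        using z(3) by (simp add: algebra_simps)
      ultimately show ?thesis
        using \<delta>(1) mult_left_mono[OF less_imp_le, of "\<bar>f z - f ?a\<bar>" "e / h" \<delta>]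
        by (simp only: abs_mult) simp
    qed
    have "window h f t - ?g t =
        (\<Sum>k<n. F (t + real (Suc k) * \<delta>) - F (t + real k * \<delta>)) - ?g t"
      using sum_lessThan_telescope[of "\<lambda>k. F (t + real k * \<delta>)" n] F(2)[of t] \<delta> by simp
    also have "\<dots> = (\<Sum>k<n. F (t + real (Suc k) * \<delta>) - F (t + real k * \<delta>) - \<delta> * f (t + real k * \<delta>))"
      by (simp add: sum_subtractf)
    finally have "\<bar>window h f t - ?g t\<bar> \<le> (\<Sum>k<n. \<delta> * (e / h))"
      using step by (simp only:) (intro order_trans[OF sum_abs] sum_mono, auto)
    also have "\<dots> = (real n * \<delta>) * (e / h)" by simp
    also have "\<dots> = e" unfolding \<delta>(3) using h by simp
    finally show ?thesis .
  qed
  ultimately show "\<exists>g\<in>local_uniform_closure S. \<forall>t. \<bar>t\<bar> \<le> R \<longrightarrow> \<bar>window h f t - g t\<bar> \<le> e"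
    by (intro bexI[of _ ?g] allI impI)
qed

lemma window_iter_in_luc:
  assumes "continuous_on UNIV \<rho>" "h > 0"
  shows "(window h ^^ m) \<rho> \<in> local_uniform_closure (neurons \<rho>)"
proof (induction m)
  case 0
  have "\<rho> \<in> neurons \<rho>"
    unfolding neurons_def by (rule CollectI, rule exI[of _ 1], rule exI[of _ 0]) simp
  then show ?case using luc_base by simp
next
  case (Suc m)
  have "window h ((window h ^^ m) \<rho>) \<in> local_uniform_closure (neurons \<rho>)"
    using luc_affine[OF Suc, of 1] assms
    by (intro window_in_luc continuous_window_iter) auto
  then show ?case by simp
qed

text \<open>
  With \<open>F\<close> the \<open>m\<close>-fold moving average, the Taylor expansion of \<open>F (w t + b)\<close> in \<open>w\<close> around \<open>0\<close> has
  \<open>m\<close>-th coefficient a multiple of \<open>t\<^sup>m\<close>, and the lower monomials are available by induction.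
\<close>

lemma monomial_in_luc:
  assumes \<rho>: "continuous_on UNIV \<rho>" and nonpoly: "\<nexists>p. \<rho> = poly p"
  shows "(\<lambda>t. t ^ m) \<in> local_uniform_closure (neurons \<rho>)"
proof (induction m rule: less_induct)
  case (less m)
  \<comment> \<open>If all m-th differences vanished, \<rho> would be a polynomial. The width
    \<open>h\<close> and the centre \<open>b\<close> found here stay fixed; only the weight
    \<open>w\<close> tends to zero.\<close>
  obtain h b where h: "h > 0" and nz: "(fdiff h ^^ m) \<rho> b \<noteq> 0"
    using frechet_polynomial[OF \<rho>] nonpoly by blast
  let ?F = "(window h ^^ m) \<rho>" and ?D = "(fdiff h ^^ m) \<rho>"
  let ?c = "\<lambda>k. (window h ^^ (m - k)) ((fdiff h ^^ k) \<rho>) b / fact k"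
  let ?G = "\<lambda>w t. (?F (w * t + b) - (\<Sum>k<m. ?c k * (w * t) ^ k)) * (fact m / (?D b * w ^ m))"
  have G: "?G w \<in> local_uniform_closure (neurons \<rho>)" if "w \<noteq> 0" for w
  proof -
    have "(\<lambda>t. ?F (w * t + b) + (\<Sum>k<m. (- ?c k * w ^ k) * t ^ k)) \<in> local_uniform_closure (neurons \<rho>)"
      by (intro luc_add luc_sum luc_scale less luc_affine that window_iter_in_luc \<rho> h) auto
    from luc_scale[OF this, of "fact m / (?D b * w ^ m)"]
    show ?thesis by (simp add: power_mult_distrib sum_negf mult_ac)
  qed
  show ?case
  proof (rule luc_limit)
    fix R e :: real assume "R > 0" "e > 0"
    define e' where "e' = e * \<bar>?D b\<bar> / (R ^ m)"
    have "e' > 0" using \<open>R > 0\<close> \<open>e > 0\<close> nz by (simp add: e'_def)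
    have "isCont ?D b"
      using continuous_fdiff_iter[OF \<rho>, where m = m] by (simp add: continuous_on_eq_continuous_at)
    then obtain d where d: "d > 0" "\<And>y. \<bar>y - b\<bar> < d \<Longrightarrow> \<bar>?D y - ?D b\<bar> < e'"
      unfolding continuous_at_real_range using \<open>e' > 0\<close> by (metis real_norm_def)
    \<comment> \<open>So small a weight keeps the intermediate point \<xi> within the continuity
      radius \<open>d\<close> of \<open>b\<close> for all \<open>t\<close> up to \<open>R\<close>,
      where the remainder coefficient is close to \<open>?D b\<close>.\<close>
    define w where "w = d / (2 * R)"
    have w: "w > 0" "w * R < d" using d \<open>R > 0\<close> by (auto simp: w_def)
    have "\<bar>t ^ m - ?G w t\<bar> \<le> e" if t: "\<bar>t\<bar> \<le> R" for t
    proof -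
      obtain \<xi> where \<xi>: "\<bar>\<xi> - b\<bar> \<le> \<bar>w * t\<bar>"
        "?F (w * t + b) = (\<Sum>k<m. ?c k * (w * t) ^ k) + ?D \<xi> / fact m * (w * t) ^ m"
        using window_iter_taylor[OF \<rho> less_imp_le[OF h], where b = b and x = "w * t + b" and m = m] by auto
      have "\<bar>w * t\<bar> \<le> w * R" using t w by (simp add: abs_mult)
      then have "\<bar>?D \<xi> - ?D b\<bar> < e'" using \<xi>(1) w by (intro d(2)) linarith
      have "?G w t = ?D \<xi> / ?D b * t ^ m" using \<xi>(2) w by (simp add: power_mult_distrib)
      then have "t ^ m - ?G w t = (?D b - ?D \<xi>) / ?D b * t ^ m" using nz by (simp add: field_simps)
      then have "\<bar>t ^ m - ?G w t\<bar> = \<bar>?D \<xi> - ?D b\<bar> / \<bar>?D b\<bar> * \<bar>t\<bar> ^ m"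
        by (simp add: abs_mult power_abs abs_minus_commute)
      also have "\<dots> \<le> e' / \<bar>?D b\<bar> * R ^ m"
        using \<open>\<bar>?D \<xi> - ?D b\<bar> < e'\<close> t \<open>e' > 0\<close>
        by (intro mult_mono divide_right_mono power_mono) auto
      also have "\<dots> = e" using nz \<open>R > 0\<close> by (simp add: e'_def)
      finally show ?thesis .
    qed
    then show "\<exists>g\<in>local_uniform_closure (neurons \<rho>). \<forall>t. \<bar>t\<bar> \<le> R \<longrightarrow> \<bar>t ^ m - g t\<bar> \<le> e"
      using G[of w] w by (intro bexI[of _ "?G w"]) auto
  qed
qed

lemma continuous_in_luc:
  assumes \<rho>: "continuous_on UNIV \<rho>" and nonpoly: "\<nexists>p. \<rho> = poly p"
    and f: "continuous_on UNIV f"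
  shows "f \<in> local_uniform_closure (neurons \<rho>)"
proof (rule luc_limit)
  fix R e :: real assume "R > 0" "e > 0"
  obtain g where g: "real_polynomial_function g" "\<And>x. x \<in> {-R..R} \<Longrightarrow> \<bar>f x - g x\<bar> < e"
    using Stone_Weierstrass_real_polynomial_function[OF compact_Icc continuous_on_subset[OF f] \<open>e > 0\<close>]
    by (metis subset_UNIV)
  then obtain a n where "g = (\<lambda>x. \<Sum>i\<le>n. a i * x ^ i)"
    by (auto simp: real_polynomial_function_iff_sum)
  then have "g \<in> local_uniform_closure (neurons \<rho>)" by (auto intro!: luc_sum luc_scale monomial_in_luc \<rho> nonpoly)
  then show "\<exists>g\<in>local_uniform_closure (neurons \<rho>). \<forall>t. \<bar>t\<bar> \<le> R \<longrightarrow> \<bar>f t - g t\<bar> \<le> e"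
    using less_imp_le[OF g(2)] by (intro bexI[of _ g]) (auto simp: abs_le_iff)
qed

section \<open>Approximation of the cosine in the Lipschitz seminorm\<close>

text \<open>Unlike \<open>neurons\<close>, this admits weight zero, which supplies the
  constants.\<close>

definition ridge_units :: "(real \<Rightarrow> real) \<Rightarrow> (real \<Rightarrow> real) set" where
  "ridge_units \<psi> = {\<lambda>t. \<psi> (w * t - b) | w b. True}"

lemma abs_sin_diff: "\<bar>sin x - sin y\<bar> \<le> \<bar>x - y\<bar>" for x y :: real
  using field_differentiable_bound[of UNIV sin cos 1 x y] by (auto intro: DERIV_sin)

text \<open>Both constructions of a network below control the slope of the error and leave an
  additive constant free, so increments are the natural measure.\<close>

definition increment_bounded :: "real \<Rightarrow> real set \<Rightarrow> (real \<Rightarrow> real) \<Rightarrow> bool" where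
  "increment_bounded e D f \<longleftrightarrow> (\<forall>t\<in>D. \<forall>t'\<in>D. \<bar>f t - f t'\<bar> \<le> e * \<bar>t - t'\<bar>)"

lemma increment_boundedD:
  "increment_bounded e D f \<Longrightarrow> t \<in> D \<Longrightarrow> t' \<in> D \<Longrightarrow> \<bar>f t - f t'\<bar> \<le> e * \<bar>t - t'\<bar>"
  by (auto simp: increment_bounded_def)

lemma increment_bounded_deriv:
  assumes "\<And>t. t \<in> {a..b} \<Longrightarrow> (f has_real_derivative f' t) (at t)"
    and "\<And>t. t \<in> {a..b} \<Longrightarrow> \<bar>f' t\<bar> \<le> e"
  shows "increment_bounded e {a..b} f"
  unfolding increment_bounded_def
proof (intro ballI)
  fix t t' assume t: "t \<in> {a..b}" and t': "t' \<in> {a..b}"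
  show "\<bar>f t - f t'\<bar> \<le> e * \<bar>t - t'\<bar>"
    using field_differentiable_bound[OF _ has_field_derivative_at_within[OF assms(1)], of "{a..b}" e t t']
      assms(2) t t' by auto
qed

lemma increment_bounded_join:
  assumes "increment_bounded e {a..c} f" "increment_bounded e {c..b} f"
  shows "increment_bounded e {a..b} f"
proof -
  have less: "\<bar>f t - f t'\<bar> \<le> e * \<bar>t - t'\<bar>" if "t \<in> {a..b}" "t' \<in> {a..b}" "t \<le> t'" for t t'
  proof -
    consider "t' \<le> c" | "c \<le> t" | "t \<le> c" "c \<le> t'" by linarith
    then show ?thesis
    proof cases
      case 3
      with that have "\<bar>f t - f c\<bar> \<le> e * \<bar>t - c\<bar>" "\<bar>f c - f t'\<bar> \<le> e * \<bar>c - t'\<bar>"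
        using increment_boundedD[OF assms(1), of t c] increment_boundedD[OF assms(2), of c t'] by auto
      moreover have "e * \<bar>t - t'\<bar> = e * \<bar>t - c\<bar> + e * \<bar>c - t'\<bar>"
        using 3 by (simp add: algebra_simps)
      ultimately show ?thesis by linarith
    next
      case 1
      then show ?thesis using that increment_boundedD[OF assms(1), of t t'] by auto
    next
      case 2
      then show ?thesis using that increment_boundedD[OF assms(2), of t t'] by auto
    qed
  qed
  show ?thesis
    unfolding increment_bounded_def
  proof (intro ballI)
    fix t t' assume "t \<in> {a..b}" "t' \<in> {a..b}"
    then show "\<bar>f t - f t'\<bar> \<le> e * \<bar>t - t'\<bar>"
      using less[of t t'] less[of t' t] by (cases "t \<le> t'") (auto simp: abs_minus_commute)
  qed
qed

text \<open>Matching slopes suffices: on the cell starting at \<open>T\<close> the network has the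
  slope - sin T of the cosine at \<open>T\<close>, and the sine varies over a cell by at most its
  length, which is at most \<open>e\<close>.\<close>

lemma cos_relu_slope:
  assumes "R > 0" "e > 0"
  shows "\<exists>g\<in>fspan (ridge_units relu). increment_bounded e {-R..R} (\<lambda>t. cos t - g t)"
proof -
  obtain n where n: "2 * R / e < real n" using reals_Archimedean2 by blast
  then have "n > 0" using assms by (metis divide_pos_pos less_trans mult_pos_pos of_nat_0_less_iff zero_less_numeral)
  define h where "h = 2 * R / real n"
  have h: "h > 0" "h \<le> e" "- R + real n * h = R"
    using n \<open>n > 0\<close> assms by (auto simp: h_def field_simps)
  \<comment> \<open>The invariant says that the network built so far is affine beyond its last node,
    so one further unit can correct the slope there.\<close>
  have "\<exists>g\<in>fspan (ridge_units relu). \<exists>a s. (\<forall>t\<ge>-R + real l * h. g t = a + s * t) \<and>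
      increment_bounded e {-R..-R + real l * h} (\<lambda>t. cos t - g t)" for l
  proof (induction l)
    case 0
    show ?case
      using fspan_zero by (intro bexI[of _ "\<lambda>_. 0"] exI[of _ 0]) (auto simp: increment_bounded_def)
  next
    case (Suc l)
    define T where "T = -R + real l * h"
    obtain g a s where g: "g \<in> fspan (ridge_units relu)" "\<And>t. t \<ge> T \<Longrightarrow> g t = a + s * t"
      "increment_bounded e {-R..T} (\<lambda>t. cos t - g t)"
      using Suc unfolding T_def by blast
    \<comment> \<open>The new kink at \<open>T\<close> turns the slope \<open>s\<close> into - sin T
      and changes nothing to the left of \<open>T\<close>.\<close>
    let ?g = "\<lambda>t. g t + (- sin T - s) * relu (1 * t - T)"
    have "?g \<in> fspan (ridge_units relu)"
      by (rule fspan_step[OF g(1)]) (unfold ridge_units_def, blast)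
    moreover have lin: "?g t = (a + (sin T + s) * T) + (- sin T) * t" if "t \<ge> T" for t
      using that g(2)[OF that] by (simp add: relu_def algebra_simps)
    moreover have "increment_bounded e {-R..T + h} (\<lambda>t. cos t - ?g t)"
    proof (rule increment_bounded_join)
      show "increment_bounded e {-R..T} (\<lambda>t. cos t - ?g t)"
        using g(3) unfolding increment_bounded_def by (simp add: relu_def)
      have "increment_bounded e {T..T + h} (\<lambda>t. cos t - ((a + (sin T + s) * T) + (- sin T) * t))"
      proof (rule increment_bounded_deriv)
        show "((\<lambda>t. cos t - ((a + (sin T + s) * T) + (- sin T) * t)) has_real_derivative sin T - sin t) (at t)" for t
          by (auto intro!: derivative_eq_intros)
        show "\<bar>sin T - sin t\<bar> \<le> e" if "t \<in> {T..T + h}" for t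
          using abs_sin_diff[of T t] that h by auto
      qed
      then show "increment_bounded e {T..T + h} (\<lambda>t. cos t - ?g t)"
        unfolding increment_bounded_def using lin by simp
    qed
    moreover have "-R + real (Suc l) * h = T + h" by (simp add: T_def algebra_simps)
    ultimately show ?case
      using h(1) by (intro bexI[of _ ?g] exI[of _ "a + (sin T + s) * T"] exI[of _ "- sin T"]) auto
  qed
  from this[of n] show ?thesis using h(3) by auto
qed

section \<open>Continuously differentiable activations\<close>

lemma poly_antiderivative:
  fixes p :: "real poly"
  obtains q where "pderiv q = p"
proof
  have "pderiv (\<Sum>i\<le>degree p. monom (coeff p i / real (Suc i)) (Suc i)) = (\<Sum>i\<le>degree p. monom (coeff p i) i)"
    by (simp add: higher_pderiv_sum[of 1, simplified] pderiv_monom del: of_nat_Suc)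
  then show "pderiv (\<Sum>i\<le>degree p. monom (coeff p i / real (Suc i)) (Suc i)) = p"
    by (simp add: poly_as_sum_of_monoms)
qed

lemma nonpolynomial_deriv:
  assumes deriv: "\<And>t. (\<psi> has_real_derivative \<rho> t) (at t)" and nonpoly: "\<nexists>p. \<psi> = poly p"
  shows "\<nexists>p. \<rho> = poly p"
proof
  assume "\<exists>p. \<rho> = poly p"
  then obtain q where q: "\<rho> = poly (pderiv q)" using poly_antiderivative by metis
  have "\<exists>c. \<forall>t\<in>UNIV. \<psi> t - poly q t = c"
  proof (rule has_field_derivative_zero_constant)
    show "((\<lambda>t. \<psi> t - poly q t) has_field_derivative 0) (at t within UNIV)" for t
      using DERIV_diff[OF deriv[of t] poly_DERIV[of q t]] q by simp
  qed simp
  then obtain c where "\<And>t. \<psi> t = poly (q + [:c:]) t" by (auto simp: algebra_simps)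
  then show False using nonpoly by blast
qed

lemma fspan_antiderivative:
  assumes deriv: "\<And>t. (\<psi> has_real_derivative \<rho> t) (at t)" and "g \<in> fspan (neurons \<rho>)"
  shows "\<exists>G\<in>fspan (ridge_units \<psi>). \<forall>t. (G has_real_derivative g t) (at t)"
  using assms(2)
proof induction
  case fspan_zero
  then show ?case using fspan.fspan_zero by (intro bexI[of _ "\<lambda>_. 0"]) auto
next
  case (fspan_step g s c)
  then obtain G where G: "G \<in> fspan (ridge_units \<psi>)" "\<And>t. (G has_real_derivative g t) (at t)" by blast
  obtain w b where s: "s = (\<lambda>t. \<rho> (w * t + b))" "w \<noteq> 0"
    using fspan_step.hyps by (auto simp: neurons_def)
  have "(\<lambda>t. G t + c / w * \<psi> (w * t - (- b))) \<in> fspan (ridge_units \<psi>)"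
    by (rule fspan.fspan_step[OF G(1)]) (unfold ridge_units_def, blast)
  moreover have "((\<lambda>t. G t + c / w * \<psi> (w * t - (- b))) has_real_derivative g t + c * s t) (at t)" for t
  proof -
    have "((\<lambda>t. w * t - (- b)) has_real_derivative w) (at t)"
      by (auto intro!: derivative_eq_intros)
    from DERIV_add[OF G(2) DERIV_cmult[OF DERIV_chain2[OF deriv this], of "c / w"]]
    show ?thesis using s by (simp add: mult_ac)
  qed
  ultimately show ?case by (intro bexI[of _ "\<lambda>t. G t + c / w * \<psi> (w * t - (- b))"]) auto
qed

definition admissible_activation :: "(real \<Rightarrow> real) \<Rightarrow> bool" where
  "admissible_activation \<psi> \<longleftrightarrow>
     \<psi> = relu \<or> (\<psi> C1_differentiable_on UNIV \<and> (\<nexists>p :: real poly. \<psi> = poly p))"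

text \<open>For a C1 activation the dilates and translates of its derivative approximate - sin
  uniformly; taking antiderivatives turns this uniform error into a bound on increments.\<close>

lemma cos_slope:
  assumes \<psi>: "admissible_activation \<psi>" and "R > 0" "e > 0"
  shows "\<exists>g\<in>fspan (ridge_units \<psi>). increment_bounded e {-R..R} (\<lambda>t. cos t - g t)"
proof (cases "\<psi> = relu")
  case True
  then show ?thesis using cos_relu_slope assms by simp
next
  case False
  then have "\<psi> C1_differentiable_on UNIV" and nonpoly: "\<nexists>p :: real poly. \<psi> = poly p"
    using \<psi> by (auto simp: admissible_activation_def)
  then obtain \<rho> where deriv: "\<And>t. (\<psi> has_real_derivative \<rho> t) (at t)" and \<rho>: "continuous_on UNIV \<rho>"
    by (auto simp: C1_differentiable_on_def has_real_derivative_iff_has_vector_derivative)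
  have "(\<lambda>t. - sin t) \<in> local_uniform_closure (neurons \<rho>)"
    by (intro continuous_in_luc \<rho> nonpolynomial_deriv[OF deriv nonpoly] continuous_intros)
  then obtain g where g: "g \<in> fspan (neurons \<rho>)" "\<And>t. \<bar>t\<bar> \<le> R \<Longrightarrow> \<bar>- sin t - g t\<bar> \<le> e"
    using lucE[OF _ \<open>R > 0\<close> \<open>e > 0\<close>] by metis
  obtain G where G: "G \<in> fspan (ridge_units \<psi>)" "\<And>t. (G has_real_derivative g t) (at t)"
    using fspan_antiderivative[OF deriv g(1)] by blast
  have "increment_bounded e {-R..R} (\<lambda>t. cos t - G t)"
    using g(2) by (intro increment_bounded_deriv[where f' = "\<lambda>t. - sin t - g t"])
      (auto intro!: derivative_eq_intros G simp: abs_le_iff)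
  then show ?thesis using G by blast
qed

lemma cos_ridge_approx:
  assumes \<psi>: "admissible_activation \<psi>" and "R > 0" "e > 0"
  shows "\<exists>g\<in>fspan (ridge_units \<psi>). increment_bounded e {-R..R} (\<lambda>t. cos t - g t) \<and>
           (\<forall>t\<in>{-R..R}. \<bar>cos t - g t\<bar> \<le> e)"
proof -
  \<comment> \<open>The slope error is integrated from 0 over a distance of up to \<open>R\<close>;
    the factor 1 + R pays for it.\<close>
  define d where "d = e / (1 + R)"
  have d: "d > 0" "d \<le> e" "d * R \<le> e" using assms by (auto simp: d_def field_simps)
  obtain G where G: "G \<in> fspan (ridge_units \<psi>)" "increment_bounded d {-R..R} (\<lambda>t. cos t - G t)"
    using cos_slope[OF \<psi> \<open>R > 0\<close> d(1)] by blast
  \<comment> \<open>A unit of weight zero is the constant \<psi> b. Scaled suitably, it makes the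
    error vanish at 0.\<close>
  obtain b where b: "\<psi> b \<noteq> 0"
  proof (cases "\<psi> = relu")
    case True
    then show ?thesis using that[of 1] by (simp add: relu_def)
  next
    case False
    then have "\<psi> \<noteq> poly 0" using \<psi> unfolding admissible_activation_def by blast
    then show ?thesis using that by (metis poly_0 ext)
  qed
  let ?c = "(cos 0 - G 0) / \<psi> b"
  let ?g = "\<lambda>t. G t + ?c * \<psi> (0 * t - (- b))"
  have g: "?g \<in> fspan (ridge_units \<psi>)"
    by (rule fspan_step[OF G(1)]) (unfold ridge_units_def, blast)
  have eq: "?g t = G t + (cos 0 - G 0)" for t using b by simp
  have inc: "\<bar>(cos t - ?g t) - (cos t' - ?g t')\<bar> \<le> d * \<bar>t - t'\<bar>" if "t \<in> {-R..R}" "t' \<in> {-R..R}" for t t'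
    using G(2) that unfolding eq increment_bounded_def by (auto simp: algebra_simps)
  show ?thesis
  proof (intro bexI[OF _ g] conjI ballI)
    show "increment_bounded e {-R..R} (\<lambda>t. cos t - ?g t)"
      unfolding increment_bounded_def
      using order_trans[OF inc mult_right_mono[OF d(2) abs_ge_zero]] by blast
    fix t assume t: "t \<in> {-R..R}"
    have "\<bar>cos t - ?g t\<bar> \<le> d * \<bar>t\<bar>" using inc[OF t, of 0] \<open>R > 0\<close> by (simp add: b)
    also have "\<dots> \<le> d * R" using t d by (intro mult_left_mono) auto
    finally show "\<bar>cos t - ?g t\<bar> \<le> e" using d by linarith
  qed
qed

section \<open>Trigonometric approximation preserving the Lipschitz constant\<close>

text \<open>The distance sees only the coordinates in \<open>I\<close>, so such a function ignores
  all the others.\<close>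

definition lipschitz_in :: "'i set \<Rightarrow> real \<Rightarrow> (('i \<Rightarrow> real) \<Rightarrow> real) \<Rightarrow> bool" where
  "lipschitz_in I C f \<longleftrightarrow> (\<forall>x y. \<bar>f x - f y\<bar> \<le> C * L2_set (\<lambda>i. x i - y i) I)"

definition periodic_in :: "'i \<Rightarrow> (('i \<Rightarrow> real) \<Rightarrow> real) \<Rightarrow> bool" where
  "periodic_in i f \<longleftrightarrow> (\<forall>x t. f (x(i := t + 2 * pi)) = f (x(i := t)))"

definition indep_of :: "'i \<Rightarrow> (('i \<Rightarrow> real) \<Rightarrow> real) \<Rightarrow> bool" where
  "indep_of i f \<longleftrightarrow> (\<forall>x t. f (x(i := t)) = f x)"

section \<open>The de la Vallee Poussin kernel and averages against it\<close>

definition cos_mass :: "nat \<Rightarrow> real" where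
  "cos_mass N = integral {-pi..pi} (\<lambda>z. (1 + cos z) ^ N)"

text \<open>Since 1 + cos z is twice the square of cos (z / 2), this is the de la Vallee Poussin
  kernel: a nonnegative trigonometric polynomial of unit mass.\<close>

definition cos_kernel :: "nat \<Rightarrow> real \<Rightarrow> real" where
  "cos_kernel N z = (1 + cos z) ^ N / cos_mass N"

definition mollify :: "'i \<Rightarrow> nat \<Rightarrow> (('i \<Rightarrow> real) \<Rightarrow> real) \<Rightarrow> ('i \<Rightarrow> real) \<Rightarrow> real" where
  "mollify j N f x = integral {-pi..pi} (\<lambda>z. f (x(j := x j - z)) * cos_kernel N z)"

text \<open>The function sin z * (1 + cos z)^N vanishes at both endpoints, and its derivative is (1
  + cos z)^N * ((N + 1) cos z - N).\<close>

lemma cos_power_moment: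
  "((\<lambda>z. cos z * (1 + cos z) ^ N) has_integral (real N / real (Suc N)) * cos_mass N) {-pi..pi}"
proof -
  have int: "((\<lambda>z. (1 + cos z) ^ N) has_integral cos_mass N) {-pi..pi}"
    unfolding cos_mass_def by (intro integrable_integral integrable_continuous_interval continuous_intros)
  have "((\<lambda>z. (1 + cos z) ^ N * (real (Suc N) * cos z - real N)) has_integral
      (sin pi * (1 + cos pi) ^ N - sin (-pi) * (1 + cos (-pi)) ^ N)) {-pi..pi}"
  proof (rule fundamental_theorem_of_calculus)
    fix z :: real
    have "((\<lambda>z. sin z * (1 + cos z) ^ N) has_real_derivative
        cos z * (1 + cos z) ^ N + (real N * (1 + cos z) ^ (N - 1) * - sin z) * sin z) (at z)"
      by (auto intro!: derivative_eq_intros)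
    moreover have "cos z * (1 + cos z) ^ N + (real N * (1 + cos z) ^ (N - 1) * - sin z) * sin z
        = (1 + cos z) ^ N * (real (Suc N) * cos z - real N)"
    proof (cases N)
      case (Suc n)
      have "sin z * sin z = (1 - cos z) * (1 + cos z)"
        using sin_cos_squared_add[of z] by (simp add: power2_eq_square algebra_simps)
      then have "real N * (1 + cos z) ^ (N - 1) * - sin z * sin z = - real N * (1 - cos z) * (1 + cos z) ^ N"
        by (simp only: Suc diff_Suc_1 power_Suc mult_minus_right mult_minus_left mult.assoc) (simp add: mult_ac)
      then show ?thesis by (simp add: algebra_simps)
    qed simp
    ultimately show "((\<lambda>z. sin z * (1 + cos z) ^ N) has_vector_derivative
        (1 + cos z) ^ N * (real (Suc N) * cos z - real N)) (at z within {-pi..pi})"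
      by (metis has_real_derivative_iff_has_vector_derivative has_vector_derivative_at_within)
  qed simp
  then have "((\<lambda>z. (1 + cos z) ^ N * (real (Suc N) * cos z - real N)) has_integral 0) {-pi..pi}"
    by simp
  from has_integral_add[OF this has_integral_mult_right[OF int, of "real N"]]
  have "((\<lambda>z. real (Suc N) * (cos z * (1 + cos z) ^ N)) has_integral real N * cos_mass N) {-pi..pi}"
    by (simp add: algebra_simps)
  from has_integral_mult_right[OF this, of "1 / real (Suc N)"]
  show ?thesis by (simp del: of_nat_Suc)
qed

lemma cos_mass_has_integral: "((\<lambda>z. (1 + cos z) ^ N) has_integral cos_mass N) {-pi..pi}"
  unfolding cos_mass_def by (intro integrable_integral integrable_continuous_interval continuous_intros)

text \<open>The moment identity yields the recursion mass (N + 1) = (1 + N / (N + 1)) * mass N,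
  starting from 2 pi.\<close>

lemma cos_mass_pos: "cos_mass N > 0"
proof (induction N)
  case 0
  then show ?case by (simp add: cos_mass_def)
next
  case (Suc N)
  have "((\<lambda>z. (1 + cos z) ^ Suc N) has_integral
      cos_mass N + (real N / real (Suc N)) * cos_mass N) {-pi..pi}"
    using has_integral_add[OF cos_mass_has_integral cos_power_moment, of N] by (simp add: algebra_simps)
  with cos_mass_has_integral[of "Suc N"]
  have "cos_mass (Suc N) = cos_mass N + (real N / real (Suc N)) * cos_mass N"
    by (rule has_integral_unique)
  then show ?case using Suc by (simp add: add_pos_nonneg del: of_nat_Suc)
qed

lemma cos_kernel_nonneg: "cos_kernel N z \<ge> 0"
  unfolding cos_kernel_def
  by (intro divide_nonneg_pos zero_le_power cos_mass_pos) (use cos_ge_minus_one[of z] in linarith)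

lemma continuous_cos_kernel: "continuous_on S (cos_kernel N)"
  unfolding cos_kernel_def using cos_mass_pos[of N] by (intro continuous_intros) auto

lemma cos_kernel_periodic: "cos_kernel N (z + 2 * pi) = cos_kernel N z"
  by (simp add: cos_kernel_def)

lemma cos_kernel_has_integral: "(cos_kernel N has_integral 1) {-pi..pi}"
  using has_integral_divide[OF cos_mass_has_integral[of N], of "cos_mass N"] cos_mass_pos[of N]
  by (simp add: cos_kernel_def[abs_def])

text \<open>The mass of the kernel away from the origin is controlled by its mean of \<open>1 - cos z\<close>.\<close>

lemma cos_kernel_moment:
  "((\<lambda>z. (1 - cos z) * cos_kernel N z) has_integral 1 / real (Suc N)) {-pi..pi}"
proof -
  have "cos_mass N - real N / real (Suc N) * cos_mass N = cos_mass N / real (Suc N)"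
    by (simp add: field_simps)
  then show ?thesis
    using has_integral_divide[OF has_integral_diff[OF cos_mass_has_integral[of N] cos_power_moment[of N]], of "cos_mass N"]
      cos_mass_pos[of N]
    by (simp add: cos_kernel_def left_diff_distrib diff_divide_distrib)
qed

text \<open>The product formula keeps cos (u z) * (1 + cos z) in the span of cosines without
  phase.\<close>

lemma cos_kernel_expansion:
  "\<exists>(n::nat) c u. \<forall>z. cos_kernel N z = (\<Sum>l<n. c l * cos (u l * z))"
proof -
  let ?S = "{\<lambda>z::real. cos (u * z) | u. True}"
  have "(\<lambda>z. (1 + cos z) ^ N) \<in> fspan ?S"
  proof (induction N)
    case 0
    have "(\<lambda>z::real. cos (0 * z)) \<in> ?S" by blast
    then show ?case using fspan_base[of "\<lambda>z::real. cos (0 * z)" ?S] by simp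
  next
    case (Suc N)
    have "(\<lambda>z. (1 + cos z) ^ N * (1 + cos z)) \<in> fspan ?S"
    proof (rule fspan_substitute[OF Suc])
      fix s assume "s \<in> ?S"
      then obtain u where u: "s = (\<lambda>z. cos (u * z))" by blast
      have "(\<lambda>z. cos (u * z) + (1/2 * cos ((u + 1) * z) + 1/2 * cos ((u - 1) * z))) \<in> fspan ?S"
        by (intro fspan_add fspan_scale fspan_base) blast+
      moreover have "cos (u * z) + (1/2 * cos ((u + 1) * z) + 1/2 * cos ((u - 1) * z)) = s z * (1 + cos z)" for z
        by (simp add: u algebra_simps cos_add cos_diff)
      ultimately show "(\<lambda>z. s z * (1 + cos z)) \<in> fspan ?S" by simp
    qed
    then show ?case by (simp add: mult.commute)
  qed
  then have "cos_kernel N \<in> fspan ?S"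
    using fspan_scale[of _ ?S "1 / cos_mass N"] unfolding cos_kernel_def[abs_def] by simp
  then show ?thesis
  proof induction
    case fspan_zero
    show ?case by (intro exI[of _ 0]) simp
  next
    case (fspan_step f s d)
    then obtain n c u v where "\<forall>z. f z = (\<Sum>l<(n::nat). c l * cos (u l * z))" "s = (\<lambda>z. cos (v * z))"
      by blast
    then show ?case
      by (intro exI[of _ "Suc n"] exI[of _ "c(n := d)"] exI[of _ "u(n := v)"]) simp
  qed
qed

lemma has_integral_abs_le:
  fixes f g :: "real \<Rightarrow> real"
  assumes "(f has_integral i) S" "(g has_integral k) S" "\<And>x. \<bar>f x\<bar> \<le> g x"
  shows "\<bar>i\<bar> \<le> k"
proof -
  have "f x \<le> g x" "- f x \<le> g x" for x using assms(3)[of x] by linarith+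
  then have "i \<le> k" "- i \<le> k"
    using has_integral_le[OF assms(1,2)] has_integral_le[OF has_integral_neg[OF assms(1)] assms(2)]
    by blast+
  then show ?thesis by linarith
qed

text \<open>The integral over a moving period has derivative q (x + 2 pi) - q x = 0; reflection and
  translation do the rest.\<close>

lemma periodic_integral:
  fixes q :: "real \<Rightarrow> real"
  assumes q: "continuous_on UNIV q" and period: "\<And>y. q (y + 2 * pi) = q y"
  shows "integral {-pi..pi} (\<lambda>z. q (a - z)) = integral {-pi..pi} q"
proof -
  have "\<exists>c. \<forall>x\<in>UNIV. window (2 * pi) q x = c"
  proof (rule has_field_derivative_zero_constant)
    show "(window (2 * pi) q has_field_derivative 0) (at x within UNIV)" for x
      using window_has_derivative[OF q, of "2 * pi" x] period by (simp add: fdiff_def)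
  qed simp
  then have "window (2 * pi) q (a - pi) = window (2 * pi) q (- pi)" by auto
  moreover have "a - pi + 2 * pi = a + pi" "- pi + 2 * pi = pi" by simp_all
  ultimately have shift: "integral {a - pi..a + pi} q = integral {-pi..pi} q"
    by (simp only: window_def)
  have "integral {-pi..pi} (\<lambda>z. q (a - z)) = integral {-pi..pi} (\<lambda>z. q (a + z))"
    using Henstock_Kurzweil_Integration.integral_reflect_real[of pi "-pi" "\<lambda>z. q (a + z)"] by simp
  also have "\<dots> = integral {a - pi..a + pi} q"
  proof -
    have "a - pi - a = - pi" "a + pi - a = pi" by simp_all
    then show ?thesis
      using Henstock_Kurzweil_Integration.integral_shift_real_ivl[where f = q and c = a and a = "a - pi" and b = "a + pi"] by (simp only: add.commute[of _ a])
  qed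
  finally show ?thesis using shift by simp
qed

lemma lipschitz_inD: "lipschitz_in I C f \<Longrightarrow> \<bar>f x - f y\<bar> \<le> C * L2_set (\<lambda>i. x i - y i) I"
  by (simp add: lipschitz_in_def)

lemma lipschitz_in_section:
  assumes "finite I" "lipschitz_in I C f" "0 \<le> C"
  shows "\<bar>f (x(j := s)) - f (x(j := t))\<bar> \<le> C * \<bar>s - t\<bar>"
proof -
  have "L2_set (\<lambda>i. (x(j := s)) i - (x(j := t)) i) I \<le> (\<Sum>i\<in>I. \<bar>(x(j := s)) i - (x(j := t)) i\<bar>)"
    by (rule L2_set_le_sum_abs)
  also have "\<dots> \<le> (\<Sum>i\<in>I. if i = j then \<bar>s - t\<bar> else 0)" by (intro sum_mono) auto
  also have "\<dots> \<le> \<bar>s - t\<bar>" using assms(1) by simp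
  finally show ?thesis
    using lipschitz_inD[OF assms(2), of "x(j := s)" "x(j := t)"] assms(3) by (meson mult_left_mono order_trans)
qed

lemma continuous_section:
  assumes "finite I" "lipschitz_in I C f" "0 \<le> C"
  shows "continuous_on S (\<lambda>t. f (x(j := t)))"
proof -
  have "C-lipschitz_on UNIV (\<lambda>t. f (x(j := t)))"
    using lipschitz_in_section[OF assms] assms(3) by (intro lipschitz_onI) (auto simp: dist_real_def)
  then show ?thesis using continuous_on_subset lipschitz_on_continuous_on by blast
qed

lemma continuous_translate_section:
  fixes f :: "('i \<Rightarrow> real) \<Rightarrow> real"
  assumes "\<And>x. continuous_on UNIV (\<lambda>t. f (x(j := t)))"
  shows "continuous_on S (\<lambda>z. f (x(j := x j - z)))"
  by (rule continuous_on_compose2[OF assms, of S "\<lambda>z. x j - z"]) (auto intro!: continuous_intros)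

lemma mollify_has_integral:
  assumes "\<And>x. continuous_on UNIV (\<lambda>t. f (x(j := t)))"
  shows "((\<lambda>z. f (x(j := x j - z)) * cos_kernel N z) has_integral mollify j N f x) {-pi..pi}"
  unfolding mollify_def using continuous_translate_section[OF assms]
  by (intro integrable_integral integrable_continuous_interval continuous_on_mult continuous_cos_kernel)

context
  fixes I :: "'i set" and C :: real and f :: "('i \<Rightarrow> real) \<Rightarrow> real"
  assumes I: "finite I" and f: "lipschitz_in I C f" and C: "0 \<le> C"
begin

text \<open>Both arguments are shifted by the same \<open>z\<close>, which leaves their distance
  unchanged, and averaging against a nonnegative kernel of mass one does not enlarge the
  bound.\<close>

lemma mollify_lipschitz: "lipschitz_in I C (mollify j N f)"
  unfolding lipschitz_in_def
proof (intro allI)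
  fix x y :: "'i \<Rightarrow> real"
  let ?d = "L2_set (\<lambda>i. x i - y i) I"
  have "\<bar>f (x(j := x j - z)) - f (y(j := y j - z))\<bar> \<le> C * ?d" for z
  proof -
    have "L2_set (\<lambda>i. (x(j := x j - z)) i - (y(j := y j - z)) i) I = ?d"
      by (intro L2_set_cong) auto
    then show ?thesis using lipschitz_inD[OF f, of "x(j := x j - z)" "y(j := y j - z)"] by simp
  qed
  then have "\<bar>f (x(j := x j - z)) * cos_kernel N z - f (y(j := y j - z)) * cos_kernel N z\<bar>
      \<le> (C * ?d) * cos_kernel N z" for z
    using cos_kernel_nonneg[of N z] by (simp add: abs_mult mult_right_mono flip: left_diff_distrib)
  with has_integral_diff[OF mollify_has_integral mollify_has_integral, OF continuous_section continuous_section, OF I f C I f C]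
      has_integral_mult_right[OF cos_kernel_has_integral, of "C * ?d" N]
  have "\<bar>mollify j N f x - mollify j N f y\<bar> \<le> C * ?d * 1"
    by (rule has_integral_abs_le)
  then show "\<bar>mollify j N f x - mollify j N f y\<bar> \<le> C * ?d" by simp
qed


lemma mollify_bounded:
  assumes "\<And>x. \<bar>f x\<bar> \<le> K"
  shows "\<bar>mollify j N f x\<bar> \<le> K"
proof -
  have "\<bar>f (x(j := x j - z)) * cos_kernel N z\<bar> \<le> K * cos_kernel N z" for z
    using assms cos_kernel_nonneg[of N z] by (simp add: abs_mult mult_right_mono)
  from has_integral_abs_le[OF mollify_has_integral[OF continuous_section[OF I f C]]
      has_integral_mult_right[OF cos_kernel_has_integral] this]
  show ?thesis by simp
qed

text \<open>Shifts up to \<delta> are controlled by the Lipschitz constant. The others cost at most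
  2 K, hence at most 2 K (1 - cos z) / (1 - cos \<delta>), and the kernel mean of 1 - cos z is 1 /
  (N + 1).\<close>

lemma mollify_close:
  assumes K: "\<And>x. \<bar>f x\<bar> \<le> K" and \<delta>: "0 < \<delta>" "\<delta> \<le> pi"
  shows "\<bar>mollify j N f x - f x\<bar> \<le> C * \<delta> + 2 * K / (1 - cos \<delta>) * (1 / real (Suc N))"
proof -
  have cos: "cos \<delta> < 1" using \<delta> cos_monotone_0_pi[of 0 \<delta>] by simp
  have "K \<ge> 0" using K[of undefined] by linarith
  have pointwise: "\<bar>f (x(j := x j - z)) - f x\<bar> \<le> C * \<delta> + 2 * K / (1 - cos \<delta>) * (1 - cos z)"
    if z: "z \<in> {-pi..pi}" for z
  proof (cases "\<bar>z\<bar> \<le> \<delta>")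
    case True
    have "\<bar>f (x(j := x j - z)) - f (x(j := x j))\<bar> \<le> C * \<bar>x j - z - x j\<bar>"
      by (rule lipschitz_in_section[OF I f C])
    also have "\<dots> \<le> C * \<delta>" using True C by (simp add: mult_left_mono)
    finally show ?thesis using cos \<open>K \<ge> 0\<close> cos_le_one[of z]
      by (simp add: add_increasing2)
  next
    case False
    then have "cos z \<le> cos \<delta>" using \<delta> z cos_monotone_0_pi_le[of \<delta> "\<bar>z\<bar>"] by auto
    then have "2 * K * (1 - cos \<delta>) \<le> 2 * K * (1 - cos z)" using \<open>K \<ge> 0\<close> by (intro mult_left_mono) auto
    then have "2 * K \<le> 2 * K / (1 - cos \<delta>) * (1 - cos z)" using cos by (simp add: field_simps)
    moreover have "\<bar>f (x(j := x j - z)) - f x\<bar> \<le> 2 * K" using K[of x] K[of "x(j := x j - z)"] by linarith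
    moreover have "0 \<le> C * \<delta>" using C \<delta> by simp
    ultimately show ?thesis by linarith
  qed
  \<comment> \<open>Both integrands are cut off outside the period because
    \<open>has_integral_abs_le\<close> asks for the inequality at every real number.\<close>
  let ?F = "\<lambda>z. if z \<in> {-pi..pi} then f (x(j := x j - z)) * cos_kernel N z - f x * cos_kernel N z else 0"
  let ?G = "\<lambda>z. if z \<in> {-pi..pi} then C * \<delta> * cos_kernel N z + 2 * K / (1 - cos \<delta>) * ((1 - cos z) * cos_kernel N z) else 0"
  have "(?F has_integral mollify j N f x - f x * 1) {-pi..pi}"
    using has_integral_diff[OF mollify_has_integral[where f = f and x = x and j = j, OF continuous_section[OF I f C]]
        has_integral_mult_right[OF cos_kernel_has_integral, of "f x" N]]
    by (subst has_integral_restrict) simp_all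
  moreover have "(?G has_integral C * \<delta> * 1 + 2 * K / (1 - cos \<delta>) * (1 / real (Suc N))) {-pi..pi}"
    using has_integral_add[OF has_integral_mult_right[OF cos_kernel_has_integral, of "C * \<delta>" N]
        has_integral_mult_right[OF cos_kernel_moment, of "2 * K / (1 - cos \<delta>)" N]]
    by (subst has_integral_restrict) auto
  moreover have "\<bar>?F z\<bar> \<le> ?G z" for z
  proof (cases "z \<in> {-pi..pi}")
    case True
    have "\<bar>(f (x(j := x j - z)) - f x) * cos_kernel N z\<bar>
        \<le> (C * \<delta> + 2 * K / (1 - cos \<delta>) * (1 - cos z)) * cos_kernel N z"
      unfolding abs_mult abs_of_nonneg[OF cos_kernel_nonneg]
      by (rule mult_right_mono[OF pointwise[OF True] cos_kernel_nonneg])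
    then show ?thesis using True by (simp only: if_True left_diff_distrib distrib_right mult.assoc)
  qed auto
  ultimately show ?thesis using has_integral_abs_le by fastforce
qed

end

lemma mollify_periodic:
  assumes "periodic_in i f"
  shows "periodic_in i (mollify j N f)"
proof (cases "i = j")
  case True
  have "f (x(j := t + 2 * pi - z)) = f (x(j := t - z))" for x t z
    using assms[unfolded periodic_in_def, rule_format, of x "t - z"] True
    by (simp add: algebra_simps)
  then show ?thesis using True by (simp add: periodic_in_def mollify_def)
next
  case False
  have "f (x(i := t + 2 * pi, j := s)) = f (x(i := t, j := s))" for x t s
    using assms[unfolded periodic_in_def, rule_format, of "x(j := s)" t] False
    by (simp add: fun_upd_twist)
  then show ?thesis using False by (simp add: periodic_in_def mollify_def)
qed

section \<open>Trigonometric polynomials in a subset of the coordinates\<close>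

definition cosines :: "'i set \<Rightarrow> 'i set \<Rightarrow> (('i \<Rightarrow> real) \<Rightarrow> real) set" where
  "cosines I J = {\<lambda>x. cos ((\<Sum>i\<in>I. u i * x i) - b) | u b. \<forall>i\<in>I - J. u i = 0}"

text \<open>The Lipschitz constant is left unspecified because it may grow whenever new coefficients
  are formed; the sharp constant is tracked on the averaged function instead.\<close>

definition coefficients :: "'i set \<Rightarrow> 'i set \<Rightarrow> (('i \<Rightarrow> real) \<Rightarrow> real) set" where
  "coefficients I J = {a. (\<exists>C\<ge>0. lipschitz_in I C a) \<and> (\<forall>j\<in>J. indep_of j a) \<and> (\<forall>i\<in>I. periodic_in i a)}"

text \<open>Interpolates between arbitrary periodic Lipschitz functions (\<open>J\<close> empty) and
  genuine trigonometric polynomials (\<open>J = I\<close>); averaging in coordinate \<open>j\<close>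
  adds \<open>j\<close> to \<open>J\<close>.\<close>

definition partial_trig :: "'i set \<Rightarrow> 'i set \<Rightarrow> (('i \<Rightarrow> real) \<Rightarrow> real) set" where
  "partial_trig I J = fspan {\<lambda>x. t x * a x | t a. t \<in> cosines I J \<and> a \<in> coefficients I J}"

lemma cosines_modulate:
  assumes "finite I" "j \<in> I" "t \<in> cosines I J"
    and a: "a \<in> coefficients I (insert j J)"
  shows "(\<lambda>x. t x * cos (u * x j - b) * a x) \<in> partial_trig I (insert j J)"
proof -
  obtain v c where t: "t = (\<lambda>x. cos ((\<Sum>i\<in>I. v i * x i) - c))" "\<forall>i\<in>I - J. v i = 0"
    using assms(3) by (auto simp: cosines_def)
  have shift: "(\<Sum>i\<in>I. (v i + (if i = j then w else 0)) * x i) = (\<Sum>i\<in>I. v i * x i) + w * x j" for x w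
  proof -
    have "(\<Sum>i\<in>I. (v i + (if i = j then w else 0)) * x i)
        = (\<Sum>i\<in>I. v i * x i) + (\<Sum>i\<in>I. (if i = j then w * x j else 0))"
      unfolding sum.distrib[symmetric] by (intro sum.cong) (auto simp: algebra_simps)
    then show ?thesis using assms(1,2) by simp
  qed
  have cosine: "(\<lambda>x. cos ((\<Sum>i\<in>I. v i * x i) + w * x j - d)) \<in> cosines I (insert j J)" for w d
    unfolding cosines_def using t(2)
    by (intro CollectI exI[of _ "\<lambda>i. v i + (if i = j then w else 0)"] exI[of _ d])
       (auto simp: shift)
  have "(\<lambda>x. 1/2 * (cos ((\<Sum>i\<in>I. v i * x i) + u * x j - (c + b)) * a x)
      + 1/2 * (cos ((\<Sum>i\<in>I. v i * x i) + (-u) * x j - (c - b)) * a x)) \<in> partial_trig I (insert j J)"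
    unfolding partial_trig_def
    by (intro fspan_add fspan_scale fspan_base CollectI exI conjI, rule refl, rule cosine, rule a,
        rule refl, rule cosine, rule a)
  moreover have "1/2 * (cos (A + u * y - (c + b)) * d) + 1/2 * (cos (A + (-u) * y - (c - b)) * d)
      = cos (A - c) * cos (u * y - b) * d" for A y d :: real
  proof -
    have "A + u * y - (c + b) = (A - c) + (u * y - b)" "A + (-u) * y - (c - b) = (A - c) - (u * y - b)"
      by simp_all
    then show ?thesis by (simp only: cos_add cos_diff) (simp add: algebra_simps)
  qed
  ultimately show ?thesis by (simp add: t)
qed

lemma cosines_indep: "t \<in> cosines I J \<Longrightarrow> j \<in> I - J \<Longrightarrow> indep_of j t"
  unfolding cosines_def indep_of_def
  by (auto intro!: arg_cong[where f = cos] sum.cong)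

lemma continuous_section_cosine:
  assumes "t \<in> cosines I J"
  shows "continuous_on UNIV (\<lambda>s. t (x(j := s)))"
proof -
  obtain u b where t: "t = (\<lambda>x. cos ((\<Sum>i\<in>I. u i * x i) - b))"
    using assms by (auto simp: cosines_def)
  have "continuous_on UNIV (\<lambda>s. (x(j := s)) i)" for i
    by (cases "i = j") auto
  then show ?thesis unfolding t by (intro continuous_intros)
qed

text \<open>After the substitution y = x j - z the addition formula splits the kernel into products
  of a cosine in \<open>x j\<close> and a cosine in \<open>y\<close>; integrating over
  \<open>y\<close> gives coefficients free of \<open>x j\<close>.\<close>

lemma mollify_coefficient:
  assumes I: "finite I" "j \<in> I" and a: "a \<in> coefficients I J" and t: "t \<in> cosines I J"
  shows "(\<lambda>x. t x * mollify j N a x) \<in> partial_trig I (insert j J)"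
proof -
  obtain C where C: "C \<ge> 0" "lipschitz_in I C a" using a by (auto simp: coefficients_def)
  obtain n :: nat and c u where kernel: "\<And>z. cos_kernel N z = (\<Sum>l<n. c l * cos (u l * z))"
    using cos_kernel_expansion by metis
  note sect = continuous_section[OF I(1) C(2,1)]
  \<comment> \<open>The phase \<open>b\<close> is 0 or \<open>pi/2\<close>: the addition formula
    also produces sines, which are cosines shifted by \<open>pi/2\<close>.\<close>
  define A where "A b v x = integral {-pi..pi} (\<lambda>y. a (x(j := y)) * cos (v * y - b))" for b v :: real and x
  have A_integral: "((\<lambda>y. a (x(j := y)) * cos (v * y - b)) has_integral A b v x) {-pi..pi}" for b v x
    unfolding A_def
    by (intro integrable_integral integrable_continuous_interval continuous_on_mult sect continuous_intros)
  have A: "A b v \<in> coefficients I (insert j J)" for b v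
  proof -
    have "lipschitz_in I (C * (2 * pi)) (A b v)"
      unfolding lipschitz_in_def
    proof (intro allI)
      fix x x' :: "'a \<Rightarrow> real"
      let ?d = "L2_set (\<lambda>i. x i - x' i) I"
      have "\<bar>a (x(j := y)) * cos (v * y - b) - a (x'(j := y)) * cos (v * y - b)\<bar> \<le> C * ?d" for y
      proof -
        have "\<bar>a (x(j := y)) * cos (v * y - b) - a (x'(j := y)) * cos (v * y - b)\<bar>
          \<le> \<bar>a (x(j := y)) - a (x'(j := y))\<bar> * 1"
          unfolding left_diff_distrib[symmetric] abs_mult by (intro mult_left_mono) auto
        also have "\<dots> \<le> C * L2_set (\<lambda>i. (x(j := y)) i - (x'(j := y)) i) I"
          using lipschitz_inD[OF C(2), of "x(j := y)" "x'(j := y)"] by simp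
        \<comment> \<open>Both points carry the value \<open>y\<close> in coordinate
          \<open>j\<close>, so that coordinate drops out of the distance.\<close>
        also have "\<dots> \<le> C * ?d"
          using C(1) I(1) unfolding L2_set_def
          by (intro mult_left_mono real_sqrt_le_mono sum_mono) auto
        finally show ?thesis .
      qed
      from has_integral_abs_le[OF has_integral_diff[OF A_integral A_integral]
          has_integral_const_real this]
      show "\<bar>A b v x - A b v x'\<bar> \<le> C * (2 * pi) * ?d" by (simp add: mult_ac)
    qed
    moreover have "indep_of i (A b v)" if "i \<in> insert j J" for i
    proof (cases "i = j")
      case False
      then have "a (x(j := y, i := s)) = a (x(j := y))" for x s y
        using that a by (auto simp: coefficients_def indep_of_def)
      then have "a (x(i := s, j := y)) = a (x(j := y))" for x s y
        by (subst fun_upd_twist[OF False])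
      then show ?thesis by (simp add: A_def indep_of_def)
    qed (simp add: A_def indep_of_def)
    moreover have "periodic_in i (A b v)" if "i \<in> I" for i
    proof (cases "i = j")
      case False
      then have "a (x(i := s + 2 * pi, j := y)) = a (x(i := s, j := y))" for x s y
        using that a by (auto simp: coefficients_def periodic_in_def fun_upd_twist)
      then show ?thesis by (simp add: A_def periodic_in_def)
    qed (simp add: A_def periodic_in_def)
    moreover have "0 \<le> C * (2 * pi)" using C by simp
    ultimately show ?thesis unfolding coefficients_def by blast
  qed
  have expand: "mollify j N a x = (\<Sum>l<n. c l * (cos (u l * x j - 0) * A 0 (u l) x
      + cos (u l * x j - pi/2) * A (pi/2) (u l) x))" for x
  proof -
    let ?q = "\<lambda>y. a (x(j := y)) * cos_kernel N (x j - y)"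
    \<comment> \<open>Periodicity keeps the range of integration at \<open>{-pi..pi}\<close> after
      the substitution, whatever \<open>x j\<close> is.\<close>
    have "integral {-pi..pi} (\<lambda>z. ?q (x j - z)) = integral {-pi..pi} ?q"
    proof (rule periodic_integral)
      show "continuous_on UNIV ?q"
        by (intro continuous_on_mult sect continuous_on_compose2[OF continuous_cos_kernel[of UNIV N]]
            continuous_intros) auto
      have "a (x(j := y + 2 * pi)) = a (x(j := y))" for y
        using a I(2) by (auto simp: coefficients_def periodic_in_def)
      moreover have "cos_kernel N (x j - (y + 2 * pi)) = cos_kernel N (x j - y)" for y
        using cos_kernel_periodic[of N "x j - (y + 2 * pi)"] by (simp add: algebra_simps)
      ultimately show "?q (y + 2 * pi) = ?q y" for y by simp
    qed
    then have "mollify j N a x = integral {-pi..pi} ?q" by (simp add: mollify_def)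
    moreover have "(?q has_integral (\<Sum>l<n. c l * (cos (u l * x j - 0) * A 0 (u l) x
      + cos (u l * x j - pi/2) * A (pi/2) (u l) x))) {-pi..pi}"
    proof -
      have "((\<lambda>y. \<Sum>l<n. c l * (cos (u l * x j - 0) * (a (x(j := y)) * cos (u l * y - 0))
      + cos (u l * x j - pi/2) * (a (x(j := y)) * cos (u l * y - pi/2)))) has_integral
       (\<Sum>l<n. c l * (cos (u l * x j - 0) * A 0 (u l) x
      + cos (u l * x j - pi/2) * A (pi/2) (u l) x))) {-pi..pi}"
        by (intro has_integral_sum has_integral_mult_right has_integral_add A_integral) auto
      moreover have "(\<Sum>l<n. c l * (cos (u l * x j - 0) * (a (x(j := y)) * cos (u l * y - 0))
      + cos (u l * x j - pi/2) * (a (x(j := y)) * cos (u l * y - pi/2)))) = ?q y" for y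
        unfolding kernel sum_distrib_left
        by (intro sum.cong) (auto simp: cos_diff right_diff_distrib algebra_simps)
      ultimately show ?thesis by simp
    qed
    ultimately show ?thesis by (simp only: integral_unique)
  qed
  have "(\<lambda>x. \<Sum>l<n. c l * (t x * cos (u l * x j - 0) * A 0 (u l) x
      + t x * cos (u l * x j - pi/2) * A (pi/2) (u l) x)) \<in> partial_trig I (insert j J)"
    using cosines_modulate[OF I t A] unfolding partial_trig_def
    by (intro fspan_sum fspan_scale fspan_add)
  moreover have "(\<Sum>l<n. c l * (t x * cos (u l * x j - 0) * A 0 (u l) x
      + t x * cos (u l * x j - pi/2) * A (pi/2) (u l) x)) = t x * mollify j N a x" for x
    unfolding expand sum_distrib_left by (intro sum.cong) (simp_all only: distrib_left mult_ac)
  ultimately show ?thesis by simp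
qed

text \<open>The cosines have frequencies in \<open>J\<close> only and are constant in coordinate
  \<open>j\<close>, so averaging acts on the coefficients alone. Continuity of the sections is
  carried through the induction to make the integrals additive.\<close>

lemma mollify_partial_trig:
  assumes I: "finite I" "j \<in> I - J" and f: "f \<in> partial_trig I J"
  shows "mollify j N f \<in> partial_trig I (insert j J)"
proof -
  have "(\<forall>x. continuous_on UNIV (\<lambda>s. f (x(j := s)))) \<and> mollify j N f \<in> partial_trig I (insert j J)"
    using f unfolding partial_trig_def[of I J]
  proof induction
    case fspan_zero
    then show ?case using fspan.fspan_zero by (simp add: mollify_def[abs_def] partial_trig_def)
  next
    case (fspan_step f s c)
    then obtain t a where s: "s = (\<lambda>x. t x * a x)" and t: "t \<in> cosines I J" and a: "a \<in> coefficients I J"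
      by blast
    have cont_a: "continuous_on UNIV (\<lambda>r. a (x(j := r)))" for x
      using a continuous_section[OF I(1)] by (auto simp: coefficients_def)
    have cont_s: "continuous_on UNIV (\<lambda>r. s (x(j := r)))" for x
      unfolding s by (intro continuous_on_mult continuous_section_cosine[OF t] cont_a)
    have cont_f: "continuous_on UNIV (\<lambda>r. f (x(j := r)))" for x using fspan_step.IH by blast
    have "mollify j N s x = t x * mollify j N a x" for x
    proof -
      have "((\<lambda>z. t x * (a (x(j := x j - z)) * cos_kernel N z)) has_integral t x * mollify j N a x) {-pi..pi}"
        by (intro has_integral_mult_right mollify_has_integral cont_a)
      moreover have "t (x(j := y)) = t x" for y using cosines_indep[OF t I(2)] by (simp add: indep_of_def)
      then have "mollify j N s x = integral {-pi..pi} (\<lambda>z. t x * (a (x(j := x j - z)) * cos_kernel N z))"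
        by (simp only: s mollify_def mult.assoc)
      ultimately show ?thesis by (simp only: integral_unique)
    qed
    then have "mollify j N s = (\<lambda>x. t x * mollify j N a x)" by (rule ext)
    then have ms: "mollify j N s \<in> partial_trig I (insert j J)"
      using mollify_coefficient[OF I(1) _ a t] I(2) by simp
    have "mollify j N (\<lambda>x. f x + c * s x) x = mollify j N f x + c * mollify j N s x" for x
    proof -
      have "((\<lambda>z. f (x(j := x j - z)) * cos_kernel N z + c * (s (x(j := x j - z)) * cos_kernel N z))
          has_integral mollify j N f x + c * mollify j N s x) {-pi..pi}"
        by (intro has_integral_add has_integral_mult_right mollify_has_integral cont_f cont_s)
      then show ?thesis
        unfolding mollify_def[of j N "\<lambda>x. f x + c * s x"] by (simp add: algebra_simps integral_unique)
    qed
    then have "mollify j N (\<lambda>x. f x + c * s x) = (\<lambda>x. mollify j N f x + c * mollify j N s x)"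
      by (rule ext)
    moreover have "(\<lambda>x. mollify j N f x + c * mollify j N s x) \<in> partial_trig I (insert j J)"
      using fspan_step.IH ms unfolding partial_trig_def by (intro fspan_add fspan_scale) auto
    moreover have "continuous_on UNIV (\<lambda>r. f (x(j := r)) + c * s (x(j := r)))" for x
      by (intro continuous_intros cont_f cont_s)
    ultimately show ?case by (intro conjI allI; simp only:)
  qed
  then show ?thesis by blast
qed

text \<open>A coefficient independent of every coordinate in \<open>I\<close> is constant: the
  coordinates of \<open>x\<close> are exchanged for those of \<open>y\<close> one at a time, and
  what remains differs outside \<open>I\<close> only, where the Lipschitz bound is zero.\<close>

lemma partial_trig_full:
  assumes I: "finite I" and f: "f \<in> partial_trig I I"
  shows "f \<in> fspan (cosines I I)"
  using f unfolding partial_trig_def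
proof (rule fspan_subset, safe)
  fix t a assume t: "t \<in> cosines I I" and a: "a \<in> coefficients I I"
  obtain C where C: "C \<ge> 0" "lipschitz_in I C a" using a by (auto simp: coefficients_def)
  have "a x = a y" for x y
  proof -
    have "a (override_on x y J) = a x" if "finite J" "J \<subseteq> I" for J
      using that
    proof (induction J)
      case (insert j J)
      then have "a ((override_on x y J)(j := y j)) = a (override_on x y J)"
        using a by (auto simp: coefficients_def indep_of_def)
      moreover have "override_on x y (insert j J) = (override_on x y J)(j := y j)"
        by (auto simp: override_on_def)
      ultimately show ?case using insert by (simp only:) simp
    qed simp
    then have "a (override_on x y I) = a x" using I by blast
    moreover have "\<bar>a (override_on x y I) - a y\<bar> \<le> C * 0"
    proof -
      have "L2_set (\<lambda>i. override_on x y I i - y i) I = 0" by (intro L2_set_0') simp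
      then show ?thesis using lipschitz_inD[OF C(2), of "override_on x y I" y] by simp
    qed
    ultimately show ?thesis by simp
  qed
  then have "(\<lambda>x. t x * a x) = (\<lambda>x. a (\<lambda>_. 0) * t x)" by (metis mult.commute)
  then show "(\<lambda>x. t x * a x) \<in> fspan (cosines I I)" using fspan_scaled_base[OF t] by simp
qed

text \<open>The coordinates are averaged one after another, each time spending half of the error.
  The exponent \<open>N\<close> depends on \<open>C\<close>, \<open>K\<close> and the error alone,
  so it can be chosen for any intermediate average, which inherits both bounds.\<close>

lemma periodic_lipschitz_trig_approx:
  assumes I: "finite I" and h: "lipschitz_in I C h" "0 \<le> C" "\<And>x. \<bar>h x\<bar> \<le> K" "\<And>i. i \<in> I \<Longrightarrow> periodic_in i h"
    and "e > 0"
  shows "\<exists>p\<in>fspan (cosines I I). lipschitz_in I C p \<and> (\<forall>x. \<bar>p x\<bar> \<le> K) \<and> (\<forall>x. \<bar>p x - h x\<bar> \<le> e)"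
proof -
  have "K \<ge> 0" using h(3)[of undefined] by linarith
  have approx: "\<exists>N. \<forall>j f x. lipschitz_in I C f \<longrightarrow> (\<forall>x. \<bar>f x\<bar> \<le> K) \<longrightarrow> \<bar>mollify j N f x - f x\<bar> \<le> d"
    if "d > 0" for d
  proof -
    \<comment> \<open>\<open>C + 1\<close> in place of \<open>C\<close> keeps the quotient defined
      when \<open>C\<close> is zero.\<close>
    define \<delta> where "\<delta> = min pi (d / (2 * (C + 1)))"
    have \<delta>: "0 < \<delta>" "\<delta> \<le> pi" using that h(2) by (auto simp: \<delta>_def)
    have "(C + 1) * \<delta> \<le> (C + 1) * (d / (2 * (C + 1)))"
      using h(2) by (intro mult_left_mono) (auto simp: \<delta>_def)
    moreover have "(C + 1) * (d / (2 * (C + 1))) = d / 2" using h(2) by (simp add: field_simps)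
    ultimately have "(C + 1) * \<delta> \<le> d / 2" by (simp only:)
    then have *: "C * \<delta> \<le> d / 2" using \<delta> by (simp add: algebra_simps)
    have cos: "cos \<delta> < 1" using \<delta> cos_monotone_0_pi[of 0 \<delta>] by simp
    define M where "M = 2 * K / (1 - cos \<delta>)"
    obtain N where "M / (d / 2) < real N" using reals_Archimedean2 by blast
    then have "M / (d / 2) < real (Suc N)" by simp
    then have M: "M * (1 / real (Suc N)) \<le> d / 2" using that by (simp add: field_simps del: of_nat_Suc)
    have "\<bar>mollify j N f x - f x\<bar> \<le> d" if f: "lipschitz_in I C f" "\<forall>x. \<bar>f x\<bar> \<le> K" for j f x
      using mollify_close[OF I f(1) h(2) f(2)[rule_format] \<delta>, of j N x] * M
      unfolding M_def by linarith
    then show ?thesis by blast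
  qed
  have "\<exists>p\<in>partial_trig I J. lipschitz_in I C p \<and> (\<forall>x. \<bar>p x\<bar> \<le> K) \<and> (\<forall>i\<in>I. periodic_in i p)
      \<and> (\<forall>x. \<bar>p x - h x\<bar> \<le> e)" if "finite J" "J \<subseteq> I" "e > 0" for J e
    using that
  proof (induction J arbitrary: e)
    case empty
    have "(\<lambda>x. cos ((\<Sum>i\<in>I. 0 * x i) - 0) * h x) \<in> partial_trig I {}"
      unfolding partial_trig_def
    proof (intro fspan_base CollectI exI conjI, rule refl)
      show "(\<lambda>x. cos ((\<Sum>i\<in>I. 0 * x i) - 0)) \<in> cosines I {}"
        unfolding cosines_def by (intro CollectI exI[of _ "\<lambda>_. 0"] exI[of _ 0]) simp
      show "h \<in> coefficients I {}" using h by (auto simp: coefficients_def)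
    qed
    then show ?case using h empty by (intro bexI[of _ h]) auto
  next
    case (insert j J)
    obtain p where p: "p \<in> partial_trig I J" "lipschitz_in I C p" "\<And>x. \<bar>p x\<bar> \<le> K"
      "\<And>i. i \<in> I \<Longrightarrow> periodic_in i p" "\<And>x. \<bar>p x - h x\<bar> \<le> e/2"
      using insert.IH[of "e/2"] insert.prems by auto
    obtain N where N: "\<And>x. \<bar>mollify j N p x - p x\<bar> \<le> e/2"
      using approx[of "e/2"] p(2,3) insert.prems by (meson half_gt_zero)
    have "\<bar>mollify j N p x - h x\<bar> \<le> e" for x using N[of x] p(5)[of x] by linarith
    moreover have "mollify j N p \<in> partial_trig I (insert j J)"
      using insert p(1) by (intro mollify_partial_trig I) auto
    ultimately show ?case
      using mollify_lipschitz[OF I p(2) h(2)] mollify_bounded[OF I p(2) h(2) p(3)] mollify_periodic[OF p(4)]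
      by (intro bexI[of _ "mollify j N p"] conjI allI ballI)
  qed
  from this[OF I order_refl \<open>e > 0\<close>] show ?thesis using partial_trig_full[OF I] by blast
qed

section \<open>From periodic functions to functions on a box\<close>

lemma sin_linear_error: "\<bar>sin t - t\<bar> \<le> t ^ 2" for t :: real
proof -
  have cos: "\<bar>cos s - 1\<bar> \<le> \<bar>s\<bar>" for s :: real
    using field_differentiable_bound[of UNIV cos "\<lambda>x. - sin x" 1 s 0] by (auto intro: DERIV_cos)
  have "norm ((\<lambda>s. sin s - s) t - (\<lambda>s. sin s - s) 0) \<le> \<bar>t\<bar> * norm (t - 0)"
  proof (rule field_differentiable_bound[of "{-\<bar>t\<bar>..\<bar>t\<bar>}" _ "\<lambda>s. cos s - 1"])
    show "norm (cos z - 1) \<le> \<bar>t\<bar>" if "z \<in> {-\<bar>t\<bar>..\<bar>t\<bar>}" for z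
      using cos[of z] that by (simp only: real_norm_def atLeastAtMost_iff) linarith
  qed (auto intro!: derivative_eq_intros)
  then show ?thesis by (simp add: power2_eq_square)
qed

text \<open>The periodic function f (sin \<theta> / s) has constant \<open>L / s\<close>; evaluating
  its approximation at \<theta> = s * x multiplies this by \<open>s\<close> and so returns exactly
  \<open>L\<close>. On the box, sin (s * x) / s is within s * R^2 of \<open>x\<close>.\<close>

theorem lipschitz_trig_approx:
  assumes I: "finite I" and f: "lipschitz_in I L f" "0 \<le> L" "\<And>x. \<bar>f x\<bar> \<le> K" and "e > 0"
  shows "\<exists>p\<in>fspan (cosines I I). lipschitz_in I L p \<and> (\<forall>x. \<bar>p x\<bar> \<le> K) \<and>
    (\<forall>x. (\<forall>i\<in>I. \<bar>x i\<bar> \<le> R) \<longrightarrow> \<bar>p x - f x\<bar> \<le> e)"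
proof -
  \<comment> \<open>Makes the displacement error L * card I * s * R^2 at most e / 2; the summand 1
    guards against a vanishing product.\<close>
  define s where "s = e / (2 * (L * real (card I) * R\<^sup>2 + 1))"
  have "L * real (card I) * R\<^sup>2 \<ge> 0" using f(2) by simp
  then have s: "s > 0" "L * real (card I) * R\<^sup>2 * s \<le> e / 2"
    using \<open>e > 0\<close> unfolding s_def by (auto simp: field_simps)
  define h where "h \<theta> = f (\<lambda>i. sin (\<theta> i) / s)" for \<theta> :: "'a \<Rightarrow> real"
  have "lipschitz_in I (L / s) h"
    unfolding lipschitz_in_def h_def
  proof (intro allI)
    fix x y :: "'a \<Rightarrow> real"
    have "L2_set (\<lambda>i. sin (x i) / s - sin (y i) / s) I \<le> L2_set (\<lambda>i. (x i - y i) / s) I"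
      unfolding L2_set_def
      using abs_sin_diff s(1) by (intro real_sqrt_le_mono sum_mono)
        (simp add: power_divide divide_right_mono abs_le_square_iff flip: diff_divide_distrib)
    also have "\<dots> = L2_set (\<lambda>i. x i - y i) I / s"
      using L2_set_left_distrib[of "1 / s" "\<lambda>i. x i - y i" I] s(1) by simp
    finally show "\<bar>f (\<lambda>i. sin (x i) / s) - f (\<lambda>i. sin (y i) / s)\<bar> \<le> L / s * L2_set (\<lambda>i. x i - y i) I"
      using lipschitz_inD[OF f(1), of "\<lambda>i. sin (x i) / s" "\<lambda>i. sin (y i) / s"] f(2)
        mult_left_mono[of _ "L2_set (\<lambda>i. x i - y i) I / s" L] by fastforce
  qed
  moreover have "periodic_in i h" for i
  proof -
    have "(\<lambda>k. sin ((x(i := t + 2 * pi)) k) / s) = (\<lambda>k. sin ((x(i := t)) k) / s)" for x t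
      by auto
    then show ?thesis unfolding periodic_in_def h_def by simp
  qed
  moreover have "\<bar>h x\<bar> \<le> K" for x using f(3) by (simp add: h_def)
  moreover have "0 \<le> L / s" using f(2) s(1) by simp
  ultimately obtain p where p: "p \<in> fspan (cosines I I)" "lipschitz_in I (L / s) p"
    "\<And>x. \<bar>p x\<bar> \<le> K" "\<And>x. \<bar>p x - h x\<bar> \<le> e/2"
    using periodic_lipschitz_trig_approx[OF I, of "L / s" h K "e/2"] \<open>e > 0\<close> by auto
  let ?p = "\<lambda>x. p (\<lambda>i. s * x i)"
  have "?p \<in> fspan (cosines I I)"
  proof (rule fspan_comp[OF p(1)])
    fix t assume "t \<in> cosines I I"
    then obtain u b where t: "t = (\<lambda>x. cos ((\<Sum>i\<in>I. u i * x i) - b))" by (auto simp: cosines_def)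
    have "(\<lambda>x. t (\<lambda>i. s * x i)) = (\<lambda>x. cos ((\<Sum>i\<in>I. (u i * s) * x i) - b))"
      by (simp add: t mult.assoc)
    then have "(\<lambda>x. t (\<lambda>i. s * x i)) \<in> cosines I I"
      unfolding cosines_def by (intro CollectI exI[of _ "\<lambda>i. u i * s"] exI[of _ b]) auto
    then show "(\<lambda>x. t (\<lambda>i. s * x i)) \<in> fspan (cosines I I)" by (rule fspan_base)
  qed
  moreover have "lipschitz_in I L ?p"
    unfolding lipschitz_in_def
  proof (intro allI)
    fix x y :: "'a \<Rightarrow> real"
    have "L2_set (\<lambda>i. s * x i - s * y i) I = s * L2_set (\<lambda>i. x i - y i) I"
      using L2_set_right_distrib[of s "\<lambda>i. x i - y i" I] s(1) by (simp add: right_diff_distrib)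
    then show "\<bar>?p x - ?p y\<bar> \<le> L * L2_set (\<lambda>i. x i - y i) I"
      using lipschitz_inD[OF p(2), of "\<lambda>i. s * x i" "\<lambda>i. s * y i"] s(1) by simp
  qed
  moreover have "\<bar>?p x - f x\<bar> \<le> e" if x: "\<forall>i\<in>I. \<bar>x i\<bar> \<le> R" for x
  proof -
    have "\<bar>sin (s * x i) / s - x i\<bar> \<le> s * R\<^sup>2" if "i \<in> I" for i
    proof -
      have "\<bar>sin (s * x i) - s * x i\<bar> \<le> (s * x i)\<^sup>2" by (rule sin_linear_error)
      also have "\<dots> \<le> s\<^sup>2 * R\<^sup>2"
      proof -
        have "\<bar>x i\<bar> \<le> \<bar>R\<bar>" using x that by force
        then show ?thesis by (simp add: power_mult_distrib mult_left_mono abs_le_square_iff)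
      qed
      finally have "\<bar>sin (s * x i) - s * x i\<bar> / s \<le> s\<^sup>2 * R\<^sup>2 / s" using s(1) by (simp add: divide_right_mono)
      moreover have "sin (s * x i) / s - x i = (sin (s * x i) - s * x i) / s"
        using s(1) by (simp add: field_simps)
      then have "\<bar>sin (s * x i) / s - x i\<bar> = \<bar>sin (s * x i) - s * x i\<bar> / s"
        using s(1) by (simp only: abs_divide abs_of_pos)
      ultimately show ?thesis using s(1) by (simp add: power2_eq_square)
    qed
    then have "L2_set (\<lambda>i. sin (s * x i) / s - x i) I \<le> real (card I) * (s * R\<^sup>2)"
      by (intro order_trans[OF L2_set_le_sum_abs] order_trans[OF sum_bounded_above]) auto
    then have "L * L2_set (\<lambda>i. sin (s * x i) / s - x i) I \<le> L * (real (card I) * (s * R\<^sup>2))"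
      using f(2) by (rule mult_left_mono)
    then have "L * L2_set (\<lambda>i. sin (s * x i) / s - x i) I \<le> e / 2" using s(2) by (simp add: mult_ac)
    then have "\<bar>h (\<lambda>i. s * x i) - f x\<bar> \<le> e/2"
      using lipschitz_inD[OF f(1), of "\<lambda>i. sin (s * x i) / s" x] unfolding h_def by linarith
    then show ?thesis using p(4)[of "\<lambda>i. s * x i"] by linarith
  qed
  ultimately show ?thesis using p(3) by blast
qed

section \<open>Density of ridgelet strategies\<close>

definition path_units :: "(real \<Rightarrow> real) \<Rightarrow> nat \<Rightarrow> (('a::finite) path \<Rightarrow> real) set" where
  "path_units \<psi> i = {\<lambda>x. \<psi> (path_inner i u x - b) | u b. True}"

text \<open>Identifies paths with functions on a single index set, the setting of the trigonometric
  approximation.\<close>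

definition coords :: "('a::finite) path \<Rightarrow> nat \<times> 'a \<Rightarrow> real" where
  "coords x = (\<lambda>(s, j). x s $ j)"

abbreviation coord_index :: "nat \<Rightarrow> (nat \<times> 'a::finite) set" where
  "coord_index i \<equiv> {1..i} \<times> UNIV"

lemma path_dist_coords:
  "path_dist i x y = L2_set (\<lambda>k. coords x k - coords y k) (coord_index i)"
proof -
  have "path_dist i x y = sqrt (\<Sum>s\<in>{1..i}. \<Sum>j\<in>UNIV. (x s $ j - y s $ j)\<^sup>2)"
    unfolding path_dist_def dist_vec_def L2_set_def
    by (simp add: sum_nonneg dist_real_def)
  also have "\<dots> = sqrt (\<Sum>(s, j)\<in>coord_index i. (x s $ j - y s $ j)\<^sup>2)"
    by (simp add: sum.cartesian_product)
  finally show ?thesis by (simp add: L2_set_def coords_def case_prod_unfold)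
qed

lemma path_dist_nonneg: "0 \<le> path_dist i x y"
  by (simp add: path_dist_def)

lemma path_inner_coords:
  "path_inner i (\<lambda>s. \<chi> j. u (s, j)) x = (\<Sum>k\<in>coord_index i. u k * coords x k)"
  unfolding path_inner_def inner_vec_def coords_def
  by (simp add: sum.cartesian_product case_prod_unfold)

lemma path_inner_diff:
  "\<bar>(\<Sum>k\<in>coord_index i. u k * coords x k) - (\<Sum>k\<in>coord_index i. u k * coords y k)\<bar>
     \<le> L2_set u (coord_index i) * path_dist i x y"
proof -
  have "(\<Sum>k\<in>coord_index i. u k * coords x k) - (\<Sum>k\<in>coord_index i. u k * coords y k)
      = (\<Sum>k\<in>coord_index i. u k * (coords x k - coords y k))"
    by (simp add: sum_subtractf right_diff_distrib)
  also have "\<bar>\<dots>\<bar> \<le> (\<Sum>k\<in>coord_index i. \<bar>u k\<bar> * \<bar>coords x k - coords y k\<bar>)"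
    unfolding abs_mult[symmetric] by (rule sum_abs)
  also have "\<dots> \<le> L2_set u (coord_index i) * path_dist i x y"
    unfolding path_dist_coords by (rule L2_set_mult_ineq)
  finally show ?thesis .
qed

text \<open>Closeness in the supremum and in the Lipschitz seminorm together, so that both constants
  of the network can be compared with those of its target.\<close>

definition ridge_close :: "(real \<Rightarrow> real) \<Rightarrow> nat \<Rightarrow> ('a::finite) path set \<Rightarrow> ('a path \<Rightarrow> real) \<Rightarrow> bool" where
  "ridge_close \<psi> i D f \<longleftrightarrow> (\<forall>e>0. \<exists>g\<in>fspan (path_units \<psi> i).
     path_lipschitz i e D (\<lambda>x. f x - g x) \<and> (\<forall>x\<in>D. \<bar>f x - g x\<bar> \<le> e))"

lemma ridge_close_add_scaled:
  assumes "ridge_close \<psi> i D f" "ridge_close \<psi> i D h"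
  shows "ridge_close \<psi> i D (\<lambda>x. f x + c * h x)"
  unfolding ridge_close_def
proof (intro allI impI)
  fix e :: real assume "e > 0"
  define d where "d = e / (1 + \<bar>c\<bar>)"
  have c: "1 + \<bar>c\<bar> > 0" by linarith
  then have "d * (1 + \<bar>c\<bar>) = e" by (simp add: d_def)
  then have "d + \<bar>c\<bar> * d = e" by (simp add: distrib_left mult.commute)
  moreover have "d > 0" using \<open>e > 0\<close> c by (simp add: d_def)
  ultimately have d: "d > 0" "d + \<bar>c\<bar> * d = e" by blast+
  obtain f' where f': "f' \<in> fspan (path_units \<psi> i)" "path_lipschitz i d D (\<lambda>x. f x - f' x)"
    "\<And>x. x \<in> D \<Longrightarrow> \<bar>f x - f' x\<bar> \<le> d"
    using assms(1) d(1) unfolding ridge_close_def by blast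
  obtain h' where h': "h' \<in> fspan (path_units \<psi> i)" "path_lipschitz i d D (\<lambda>x. h x - h' x)"
    "\<And>x. x \<in> D \<Longrightarrow> \<bar>h x - h' x\<bar> \<le> d"
    using assms(2) d(1) unfolding ridge_close_def by blast
  let ?g = "\<lambda>x. f' x + c * h' x"
  have tri: "\<bar>A + c * H\<bar> \<le> e * r" if "\<bar>A\<bar> \<le> d * r" "\<bar>H\<bar> \<le> d * r" for A H r :: real
  proof -
    have "\<bar>A + c * H\<bar> \<le> \<bar>A\<bar> + \<bar>c\<bar> * \<bar>H\<bar>" by (metis abs_mult abs_triangle_ineq)
    also have "\<dots> \<le> d * r + \<bar>c\<bar> * (d * r)" using that by (intro add_mono mult_left_mono) auto
    also have "\<dots> = e * r" unfolding d(2)[symmetric] by (simp add: distrib_right)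
    finally show ?thesis .
  qed
  have "path_lipschitz i e D (\<lambda>x. f x + c * h x - ?g x)"
    unfolding path_lipschitz_def
  proof (intro ballI)
    fix x y assume "x \<in> D" "y \<in> D"
    then have "\<bar>(f x - f' x - (f y - f' y)) + c * (h x - h' x - (h y - h' y))\<bar> \<le> e * path_dist i x y"
      using f'(2) h'(2) unfolding path_lipschitz_def by (intro tri) auto
    then show "\<bar>f x + c * h x - ?g x - (f y + c * h y - ?g y)\<bar> \<le> e * path_dist i x y"
      by (simp add: algebra_simps)
  qed
  moreover have "\<bar>f x + c * h x - ?g x\<bar> \<le> e" if "x \<in> D" for x
    using tri[of "f x - f' x" 1 "h x - h' x"] f'(3)[OF that] h'(3)[OF that] by (simp add: algebra_simps)
  moreover have "?g \<in> fspan (path_units \<psi> i)"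
    by (intro fspan_add fspan_scale f' h')
  ultimately show "\<exists>g\<in>fspan (path_units \<psi> i). path_lipschitz i e D (\<lambda>x. f x + c * h x - g x) \<and>
      (\<forall>x\<in>D. \<bar>f x + c * h x - g x\<bar> \<le> e)"
    by (intro bexI[of _ ?g]) auto
qed

lemma ridge_close_zero: "ridge_close \<psi> i D (\<lambda>_. 0)"
  unfolding ridge_close_def path_lipschitz_def
  using fspan_zero by (auto intro!: bexI[of _ "\<lambda>_. 0"] simp: path_dist_nonneg)

lemma ridge_close_cosine:
  fixes D :: "('a::finite) path set"
  assumes \<psi>: "admissible_activation \<psi>"
    and D: "\<And>x k. x \<in> D \<Longrightarrow> k \<in> coord_index i \<Longrightarrow> \<bar>coords x k\<bar> \<le> R" and "R \<ge> 0"
    and t: "t \<in> cosines (coord_index i) (coord_index i)"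
  shows "ridge_close \<psi> i D (\<lambda>x. t (coords x))"
  unfolding ridge_close_def
proof (intro allI impI)
  fix e :: real assume "e > 0"
  let ?I = "coord_index i :: (nat \<times> 'a) set"
  obtain u b where t: "t = (\<lambda>x. cos ((\<Sum>k\<in>?I. u k * x k) - b))" using t by (auto simp: cosines_def)
  let ?l = "\<lambda>x. (\<Sum>k\<in>?I. u k * coords x k) - b"
  \<comment> \<open>\<open>Q\<close> bounds the affine form on \<open>D\<close>, which reduces the
    task to approximating the cosine on one interval.\<close>
  define Q where "Q = (\<Sum>k\<in>?I. \<bar>u k\<bar> * R) + \<bar>b\<bar> + 1"
  have "(\<Sum>k\<in>?I. \<bar>u k\<bar> * R) \<ge> 0" using \<open>R \<ge> 0\<close> by (intro sum_nonneg) simp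
  then have "Q > 0" by (simp add: Q_def)
  have l: "?l x \<in> {-Q..Q}" if "x \<in> D" for x
  proof -
    have "\<bar>\<Sum>k\<in>?I. u k * coords x k\<bar> \<le> (\<Sum>k\<in>?I. \<bar>u k\<bar> * R)"
      using D[OF that] by (intro order_trans[OF sum_abs] sum_mono) (auto simp: abs_mult mult_left_mono)
    then have "\<bar>?l x\<bar> \<le> Q" unfolding Q_def by linarith
    then show ?thesis by (simp add: abs_le_iff)
  qed
  \<comment> \<open>By Cauchy-Schwarz the norm of the frequency vector is a Lipschitz constant of
    the affine form; the tolerance \<open>d\<close> below compensates for it.\<close>
  define N where "N = L2_set u ?I"
  have "N \<ge> 0" by (simp add: N_def)
  define d where "d = e / (1 + N)"
  have d: "d > 0" "d \<le> e" "d * N \<le> e" using \<open>e > 0\<close> \<open>N \<ge> 0\<close> by (auto simp: d_def field_simps)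
  obtain g where g: "g \<in> fspan (ridge_units \<psi>)" "increment_bounded d {-Q..Q} (\<lambda>t. cos t - g t)"
     "\<And>t. t \<in> {-Q..Q} \<Longrightarrow> \<bar>cos t - g t\<bar> \<le> d"
    using cos_ridge_approx[OF \<psi> \<open>Q > 0\<close> d(1)] by blast
  have "(\<lambda>x. g (?l x)) \<in> fspan (path_units \<psi> i)"
  proof (rule fspan_comp[OF g(1)])
    fix s assume "s \<in> ridge_units \<psi>"
    then obtain w c where s: "s = (\<lambda>t. \<psi> (w * t - c))" by (auto simp: ridge_units_def)
    have "s (?l x) = \<psi> (path_inner i (\<lambda>s. \<chi> j. w * u (s, j)) x - (w * b + c))" for x
      using path_inner_coords[of i "\<lambda>k. w * u k" x]
      by (simp add: s right_diff_distrib sum_distrib_left mult.assoc diff_diff_eq)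
    then have "(\<lambda>x. s (?l x)) \<in> path_units \<psi> i" unfolding path_units_def by blast
    then show "(\<lambda>x. s (?l x)) \<in> fspan (path_units \<psi> i)" by (rule fspan_base)
  qed
  moreover have "path_lipschitz i e D (\<lambda>x. t (coords x) - g (?l x))"
    unfolding path_lipschitz_def t
  proof (intro ballI)
    fix x y assume xy: "x \<in> D" "y \<in> D"
    have "\<bar>cos (?l x) - g (?l x) - (cos (?l y) - g (?l y))\<bar> \<le> d * \<bar>?l x - ?l y\<bar>"
      by (rule increment_boundedD[OF g(2) l[OF xy(1)] l[OF xy(2)]])
    also have "\<dots> \<le> d * (N * path_dist i x y)"
      using path_inner_diff[where i = i and u = u and x = x and y = y] d(1) unfolding N_def by (intro mult_left_mono) auto
    also have "\<dots> \<le> e * path_dist i x y"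
      unfolding mult.assoc[symmetric] by (rule mult_right_mono[OF d(3) path_dist_nonneg])
    finally show "\<bar>cos (?l x) - g (?l x) - (cos (?l y) - g (?l y))\<bar> \<le> e * path_dist i x y" .
  qed
  moreover have "\<bar>t (coords x) - g (?l x)\<bar> \<le> e" if "x \<in> D" for x
    using g(3)[OF l[OF that]] d(2) unfolding t by linarith
  ultimately show "\<exists>g\<in>fspan (path_units \<psi> i). path_lipschitz i e D (\<lambda>x. t (coords x) - g x) \<and>
      (\<forall>x\<in>D. \<bar>t (coords x) - g x\<bar> \<le> e)"
    by (intro bexI[of _ "\<lambda>x. g (?l x)"]) auto
qed

lemma ridge_close_trig:
  assumes \<psi>: "admissible_activation \<psi>"
    and D: "\<And>x k. x \<in> D \<Longrightarrow> k \<in> coord_index i \<Longrightarrow> \<bar>coords x k\<bar> \<le> R" and "R \<ge> 0"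
    and p: "p \<in> fspan (cosines (coord_index i) (coord_index i))"
  shows "ridge_close \<psi> i D (\<lambda>x. p (coords x))"
  using p
proof induction
  case fspan_zero
  show ?case by (rule ridge_close_zero)
next
  case (fspan_step f s c)
  show ?case
    by (rule ridge_close_add_scaled[OF fspan_step.IH ridge_close_cosine[OF \<psi> D \<open>R \<ge> 0\<close> fspan_step.hyps(2)]])
qed

section \<open>Networks with vector output\<close>

lemma ridge_add_unit:
  assumes "f \<in> ridge \<psi> i"
  shows "(\<lambda>x. f x + \<psi> (path_inner i v x - c) *\<^sub>R a) \<in> ridge \<psi> i"
proof -
  obtain N \<alpha> u b where f: "f = (\<lambda>x. \<Sum>l<(N::nat). \<psi> (path_inner i (u l) x - b l) *\<^sub>R \<alpha> l)"
    using assms by (auto simp: ridge_def)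
  have "(\<lambda>x. f x + \<psi> (path_inner i v x - c) *\<^sub>R a)
     = (\<lambda>x. \<Sum>l<Suc N. \<psi> (path_inner i ((u(N := v)) l) x - (b(N := c)) l) *\<^sub>R (\<alpha>(N := a)) l)"
    by (simp add: f)
  then show ?thesis unfolding ridge_def by blast
qed

lemma ridge_add_fspan:
  assumes "g \<in> fspan (path_units \<psi> i)" "f \<in> ridge \<psi> i"
  shows "(\<lambda>x. f x + g x *\<^sub>R a) \<in> ridge \<psi> i"
  using assms
proof induction
  case fspan_zero
  then show ?case by simp
next
  case (fspan_step g s c)
  then obtain u b where s: "s = (\<lambda>x. \<psi> (path_inner i u x - b))" by (auto simp: path_units_def)
  from ridge_add_unit[OF fspan_step.IH[OF fspan_step.prems], of u b "c *\<^sub>R a"]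
  show ?case by (simp add: s scaleR_add_left add.assoc mult.commute)
qed

text \<open>The component networks are placed side by side, the units of component \<open>j\<close>
  getting output weights along the j-th axis.\<close>

lemma ridge_vec:
  fixes g :: "'a::finite \<Rightarrow> 'a path \<Rightarrow> real"
  assumes "\<And>j. g j \<in> fspan (path_units \<psi> i)"
  shows "(\<lambda>x. \<chi> j. g j x) \<in> ridge \<psi> i"
proof -
  have "(\<lambda>x. \<Sum>j\<in>A. g j x *\<^sub>R axis j 1) \<in> ridge \<psi> i" if "finite A" for A
    using that
  proof induction
    case empty
    then show ?case unfolding ridge_def by (auto intro!: exI[of _ "0::nat"])
  next
    case (insert j A)
    then show ?case using ridge_add_fspan[OF assms insert.IH, of j "axis j 1"] by (simp add: add.commute)
  qed
  from this[OF finite[of UNIV]] have "(\<lambda>x. \<Sum>j\<in>UNIV. g j x *\<^sub>R axis j 1) \<in> ridge \<psi> i" .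
  moreover have "(\<lambda>x. \<Sum>j\<in>UNIV. g j x *\<^sub>R axis j 1) = (\<lambda>x. \<chi> j. g j x)"
    by (simp add: fun_eq_iff vec_eq_iff axis_def if_distrib[of "\<lambda>r. _ * r"] cong: if_cong)
  ultimately show ?thesis by (simp only:)
qed


section \<open>Approximation within the constraints and extension off the price box\<close>

definition clamp_path :: "('a::finite) market \<Rightarrow> nat \<Rightarrow> 'a path \<Rightarrow> 'a path" where
  "clamp_path M i x = (\<lambda>s\<in>{1..i}. clamp (lower M) (upper M) (x s))"

lemma clamp_state_space: "valid_market M \<Longrightarrow> clamp (lower M) (upper M) v \<in> state_space M"
  unfolding state_space_def
  by (rule clamp_in_interval) (auto simp: valid_market_def Basis_vec_def inner_axis less_imp_le)

lemma clamp_path_in: "valid_market M \<Longrightarrow> clamp_path M i x \<in> path_space M i"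
  by (auto simp: clamp_path_def path_space_def clamp_state_space)

lemma clamp_path_id: "x \<in> path_space M i \<Longrightarrow> clamp_path M i x = x"
  by (auto simp: clamp_path_def path_space_def state_space_def fun_eq_iff PiE_def Pi_def extensional_def restrict_def)

lemma path_dist_clamp: "path_dist i (clamp_path M i x) (clamp_path M i y) \<le> path_dist i x y"
  unfolding path_dist_def clamp_path_def
  by (intro L2_set_mono) (auto simp: dist_clamps_le_dist_args)

lemma state_space_bounded:
  fixes M :: "('a::finite) market"
  obtains R where "R \<ge> 0" "\<And>v j. v \<in> state_space M \<Longrightarrow> \<bar>v $ j\<bar> \<le> R"
proof -
  have "bounded (state_space M)" by (simp add: state_space_def)
  then obtain R where R: "\<And>v. v \<in> state_space M \<Longrightarrow> norm v \<le> R" by (auto simp: bounded_iff)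
  have "\<bar>v $ j\<bar> \<le> max R 0" if "v \<in> state_space M" for v :: "real ^ 'a" and j
    using R[OF that] component_le_norm_cart[of v j] by linarith
  then show ?thesis by (intro that[of "max R 0"]) auto
qed

lemma path_space_subset: "path_space M i \<subseteq> space (path_borel i)"
  by (auto simp: path_space_def path_borel_def space_PiM)

text \<open>Approximating (1 - \<delta>) F leaves room \<delta> * L in the slope and \<delta> * B in
  the size, and the network error \<open>d\<close> is chosen below both. One third of
  \<open>e\<close> each goes to shrinking, to the trigonometric approximation and to the
  network.\<close>

lemma ridge_component_approx:
  fixes M :: "('a::finite) market" and F :: "'a path \<Rightarrow> real"
  assumes M: "valid_market M" and \<psi>: "admissible_activation \<psi>" and B: "0 < B" and L: "0 < L"
    and lip: "path_lipschitz i L (path_space M i) F"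
    and bd: "\<And>x. x \<in> path_space M i \<Longrightarrow> \<bar>F x\<bar> \<le> B" and "e > 0"
  shows "\<exists>g\<in>fspan (path_units \<psi> i). path_lipschitz i L (path_space M i) g \<and>
    (\<forall>x\<in>path_space M i. \<bar>g x\<bar> \<le> B \<and> \<bar>g x - F x\<bar> \<le> e)"
proof -
  let ?I = "coord_index i :: (nat \<times> 'a) set" and ?D = "path_space M i"
  obtain R where R: "R \<ge> 0" "\<And>v j. v \<in> state_space M \<Longrightarrow> \<bar>v $ j\<bar> \<le> R"
    using state_space_bounded by blast
  have D: "\<bar>coords x k\<bar> \<le> R" if "x \<in> ?D" "k \<in> ?I" for x k
    using that R(2) by (auto simp: coords_def path_space_def PiE_def Pi_def)
  \<comment> \<open>Shrinking moves \<open>F\<close> by at most \<delta> * B, hence by at most e /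
    3; the cap 1/2 keeps 1 - \<delta> positive.\<close>
  define \<delta> where "\<delta> = min (1/2) (e / (3 * (B + 1)))"
  have "0 < \<delta>" using B \<open>e > 0\<close> by (simp add: \<delta>_def)
  moreover have "\<delta> \<le> 1/2" unfolding \<delta>_def by (rule min.cobounded1)
  ultimately have \<delta>: "0 < \<delta>" "\<delta> \<le> 1/2" .
  have \<delta>B: "\<delta> * B \<le> e / 3"
  proof -
    have "\<delta> * B \<le> \<delta> * (B + 1)" using \<delta> by (intro mult_left_mono) auto
    also have "\<dots> \<le> (e / (3 * (B + 1))) * (B + 1)" using B by (intro mult_right_mono) (auto simp: \<delta>_def)
    also have "\<dots> = e / 3" using B by (simp add: field_simps)
    finally show ?thesis .
  qed
  \<comment> \<open>Composition with the projection extends \<open>F\<close> from the box to all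
    real vectors without raising its Lipschitz constant or its bound.\<close>
  define C where "C y = clamp_path M i (\<lambda>s. \<chi> j. y (s, j))" for y :: "nat \<times> 'a \<Rightarrow> real"
  define f where "f y = (1 - \<delta>) * F (C y)" for y
  have C_in: "C y \<in> ?D" for y unfolding C_def by (rule clamp_path_in[OF M])
  have C_coords: "C (coords x) = x" if "x \<in> ?D" for x
    using clamp_path_id[OF that] by (simp add: C_def coords_def vec_lambda_unique)
  have "lipschitz_in ?I ((1 - \<delta>) * L) f"
    unfolding lipschitz_in_def
  proof (intro allI)
    fix x y :: "nat \<times> 'a \<Rightarrow> real"
    have "\<bar>F (C x) - F (C y)\<bar> \<le> L * path_dist i (C x) (C y)"
      using lip C_in by (simp add: path_lipschitz_def)
    also have "\<dots> \<le> L * path_dist i (\<lambda>s. \<chi> j. x (s, j)) (\<lambda>s. \<chi> j. y (s, j))"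
      unfolding C_def using L by (intro mult_left_mono path_dist_clamp) auto
    also have "\<dots> = L * L2_set (\<lambda>k. x k - y k) ?I"
      unfolding path_dist_coords by (intro arg_cong2[where f = "(*)"] L2_set_cong) (auto simp: coords_def)
    finally have "(1 - \<delta>) * \<bar>F (C x) - F (C y)\<bar> \<le> (1 - \<delta>) * (L * L2_set (\<lambda>k. x k - y k) ?I)"
      using \<delta> by (intro mult_left_mono) auto
    moreover have "\<bar>f x - f y\<bar> = (1 - \<delta>) * \<bar>F (C x) - F (C y)\<bar>"
      using \<delta> by (simp add: f_def abs_mult flip: right_diff_distrib)
    ultimately show "\<bar>f x - f y\<bar> \<le> (1 - \<delta>) * L * L2_set (\<lambda>k. x k - y k) ?I" by (simp add: mult.assoc)
  qed
  moreover have "\<bar>f y\<bar> \<le> (1 - \<delta>) * B" for y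
    using bd[OF C_in[of y]] \<delta> by (simp add: f_def abs_mult mult_left_mono)
  moreover have "0 \<le> (1 - \<delta>) * L" using \<delta> L by simp
  moreover have "0 < e / 3" using \<open>e > 0\<close> by simp
  moreover have "finite ?I" by simp
  ultimately obtain p where p: "p \<in> fspan (cosines ?I ?I)" "lipschitz_in ?I ((1 - \<delta>) * L) p"
    "\<And>x. \<bar>p x\<bar> \<le> (1 - \<delta>) * B" "\<And>x. (\<forall>k\<in>?I. \<bar>x k\<bar> \<le> R) \<Longrightarrow> \<bar>p x - f x\<bar> \<le> e / 3"
    using lipschitz_trig_approx[of ?I "(1 - \<delta>) * L" f "(1 - \<delta>) * B" "e / 3" R] by blast
  define d where "d = min (\<delta> * L) (min (\<delta> * B) (e / 3))"
  have d: "d > 0" "d \<le> \<delta> * L" "d \<le> \<delta> * B" "d \<le> e / 3" using \<delta> L B \<open>e > 0\<close> by (auto simp: d_def)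
  obtain g where g: "g \<in> fspan (path_units \<psi> i)" "path_lipschitz i d ?D (\<lambda>x. p (coords x) - g x)"
    "\<And>x. x \<in> ?D \<Longrightarrow> \<bar>p (coords x) - g x\<bar> \<le> d"
  proof -
    have "ridge_close \<psi> i ?D (\<lambda>x. p (coords x))" by (rule ridge_close_trig[OF \<psi> D R(1) p(1)])
    from this[unfolded ridge_close_def, rule_format, OF d(1)] show ?thesis using that by blast
  qed
  have "path_lipschitz i L ?D g"
    unfolding path_lipschitz_def
  proof (intro ballI)
    fix x y assume xy: "x \<in> ?D" "y \<in> ?D"
    have "\<bar>p (coords x) - g x - (p (coords y) - g y)\<bar> \<le> d * path_dist i x y"
      using g(2) xy by (simp add: path_lipschitz_def)
    moreover have "d * path_dist i x y \<le> \<delta> * L * path_dist i x y"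
      by (rule mult_right_mono[OF d(2) path_dist_nonneg])
    moreover have "\<bar>p (coords x) - p (coords y)\<bar> \<le> (1 - \<delta>) * L * path_dist i x y"
      using lipschitz_inD[OF p(2)] by (simp add: path_dist_coords)
    moreover have "\<delta> * L * path_dist i x y + (1 - \<delta>) * L * path_dist i x y = L * path_dist i x y"
      by (simp add: algebra_simps)
    ultimately show "\<bar>g x - g y\<bar> \<le> L * path_dist i x y" by linarith
  qed
  moreover have "\<bar>g x\<bar> \<le> B" "\<bar>g x - F x\<bar> \<le> e" if x: "x \<in> ?D" for x
  proof -
    have "(1 - \<delta>) * B + \<delta> * B = B" by (simp add: algebra_simps)
    then show "\<bar>g x\<bar> \<le> B" using p(3)[of "coords x"] g(3)[OF x] d(3) by linarith
    have "\<bar>\<delta> * F x\<bar> \<le> \<delta> * B" using bd[OF x] \<delta> by (simp add: abs_mult)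
    moreover have "f (coords x) - F x = - (\<delta> * F x)" by (simp add: f_def C_coords[OF x] algebra_simps)
    moreover have "\<bar>p (coords x) - f (coords x)\<bar> \<le> e / 3" using p(4) D[OF x] by blast
    ultimately show "\<bar>g x - F x\<bar> \<le> e" using \<delta>B g(3)[OF x] d(4) by linarith
  qed
  ultimately show ?thesis using g(1) by blast
qed

lemma path_lipschitz_subset: "path_lipschitz i L D f \<Longrightarrow> D' \<subseteq> D \<Longrightarrow> path_lipschitz i L D' f"
  by (auto simp: path_lipschitz_def)

lemma bounded_ridge_approx:
  fixes M :: "('a::finite) market"
  assumes M: "valid_market M" and \<psi>: "admissible_activation \<psi>" and B: "0 < B" and L: "0 < L"
    and adm: "(c, \<Delta>) \<in> admissible M B L" and i: "i \<in> {1..<horizon M}" and "e > 0"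
  shows "\<exists>f\<in>bounded_ridge M \<psi> B L i. \<forall>x\<in>path_space M i. \<forall>j. \<bar>f x $ j - \<Delta> i x $ j\<bar> \<le> e"
proof -
  have "\<exists>g\<in>fspan (path_units \<psi> i). path_lipschitz i L (path_space M i) g \<and>
    (\<forall>x\<in>path_space M i. \<bar>g x\<bar> \<le> B \<and> \<bar>g x - \<Delta> i x $ j\<bar> \<le> e)" for j
  proof (rule ridge_component_approx[OF M \<psi> B L _ _ \<open>e > 0\<close>])
    have "path_lipschitz i L (space (path_borel i)) (\<lambda>x. \<Delta> i x $ j)"
      using adm i by (simp add: admissible_def)
    then show "path_lipschitz i L (path_space M i) (\<lambda>x. \<Delta> i x $ j)"
      by (rule path_lipschitz_subset[OF _ path_space_subset])
    show "\<bar>\<Delta> i x $ j\<bar> \<le> B" if "x \<in> path_space M i" for x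
      using adm i that by (simp add: admissible_def)
  qed
  then obtain g where g: "\<And>j. g j \<in> fspan (path_units \<psi> i)"
    "\<And>j. path_lipschitz i L (path_space M i) (g j)"
    "\<And>j x. x \<in> path_space M i \<Longrightarrow> \<bar>g j x\<bar> \<le> B" "\<And>j x. x \<in> path_space M i \<Longrightarrow> \<bar>g j x - \<Delta> i x $ j\<bar> \<le> e"
    by metis
  have "(\<lambda>x. \<chi> j. g j x) \<in> bounded_ridge M \<psi> B L i"
    unfolding bounded_ridge_def using ridge_vec[OF g(1)] g(2,3) by simp
  then show ?thesis using g(4) by (intro bexI[of _ "\<lambda>x. \<chi> j. g j x"]) auto
qed

lemma continuous_activation: "admissible_activation \<psi> \<Longrightarrow> continuous_on UNIV \<psi>"
  unfolding admissible_activation_def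
proof (elim disjE conjE)
  assume "\<psi> = relu"
  moreover have "continuous_on UNIV (\<lambda>t::real. max t 0)" by (intro continuous_intros)
  ultimately show ?thesis by (simp add: relu_def[abs_def])
qed (rule C1_differentiable_imp_continuous_on)

lemma ridge_measurable:
  assumes \<psi>: "admissible_activation \<psi>" and f: "f \<in> ridge \<psi> i"
  shows "(\<lambda>x. f x $ j) \<in> borel_measurable (path_borel i)"
proof -
  obtain N \<alpha> u b where f: "f = (\<lambda>x. \<Sum>l<(N::nat). \<psi> (path_inner i (u l) x - b l) *\<^sub>R \<alpha> l)"
    using f by (auto simp: ridge_def)
  have [measurable]: "\<psi> \<in> borel_measurable borel"
    by (rule borel_measurable_continuous_onI[OF continuous_activation[OF \<psi>]])
  have [measurable]: "(\<lambda>x. path_inner i v x) \<in> borel_measurable (path_borel i)" for v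
    unfolding path_inner_def path_borel_def by measurable
  show ?thesis unfolding f by simp
qed

lemma clamp_path_measurable: "clamp_path M i \<in> path_borel i \<rightarrow>\<^sub>M path_borel i"
proof -
  have [measurable]: "clamp (lower M) (upper M) \<in> borel_measurable borel"
    by (rule borel_measurable_continuous_onI) (rule clamp_continuous_on[OF continuous_on_id])
  show ?thesis unfolding clamp_path_def[abs_def] path_borel_def by measurable
qed

lemma ridge_admissible_dense:
  fixes M :: "('a::finite) market"
  assumes M: "valid_market M" and \<psi>: "admissible_activation \<psi>" and B: "0 < B" and L: "0 < L"
    and adm: "(c, \<Delta>) \<in> admissible M B L"
  shows "\<exists>X. (\<forall>m. (c, X m) \<in> ridge_admissible M \<psi> B L) \<and>
     (\<forall>i<horizon M. \<forall>x\<in>path_space M i. (\<lambda>m. X m i x) \<longlonglongrightarrow> \<Delta> i x)"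
proof -
  have "\<forall>m i. \<exists>f. i \<in> {1..<horizon M} \<longrightarrow> f \<in> bounded_ridge M \<psi> B L i \<and>
      (\<forall>x\<in>path_space M i. \<forall>j. \<bar>f x $ j - \<Delta> i x $ j\<bar> \<le> inverse (real (Suc m)))"
    using bounded_ridge_approx[OF M \<psi> B L adm] by (metis inverse_positive_iff_positive of_nat_0_less_iff zero_less_Suc)
  then obtain f where f: "\<And>m i. i \<in> {1..<horizon M} \<Longrightarrow> f m i \<in> bounded_ridge M \<psi> B L i"
    "\<And>m i x j. i \<in> {1..<horizon M} \<Longrightarrow> x \<in> path_space M i \<Longrightarrow>
       \<bar>f m i x $ j - \<Delta> i x $ j\<bar> \<le> inverse (real (Suc m))"
    by metis
  \<comment> \<open>The projection in front of the network changes nothing on the box and makes the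
    strategy Lipschitz everywhere. Time 0 carries no network constraint and keeps its
    holding.\<close>
  define X where "X m i x = (if i \<in> {1..<horizon M} then f m i (clamp_path M i x) else \<Delta> i x)" for m i x
  have X: "X m i x = f m i x" if "i \<in> {1..<horizon M}" "x \<in> path_space M i" for m i x
    using that by (simp add: X_def clamp_path_id)
  have "(c, X m) \<in> admissible M B L" for m
    unfolding admissible_def
  proof (clarify, intro conjI ballI allI)
    show "\<bar>c\<bar> \<le> B" using adm by (simp add: admissible_def)
    show "trading_strategy M (X m)"
      unfolding trading_strategy_def
    proof (intro ballI allI)
      fix i j assume i: "i \<in> {1..<horizon M}"
      have "(\<lambda>x. f m i x $ j) \<in> borel_measurable (path_borel i)"
        using f(1)[OF i] by (intro ridge_measurable[OF \<psi>]) (simp add: bounded_ridge_def)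
      from measurable_compose[OF clamp_path_measurable this]
      show "(\<lambda>x. X m i x $ j) \<in> borel_measurable (path_borel i)" using i by (simp add: X_def)
    qed
    show "\<bar>X m 0 x $ j\<bar> \<le> B" if "x \<in> path_space M 0" for x j
      using that adm by (simp add: X_def admissible_def)
    fix i j assume i: "i \<in> {1..<horizon M}"
    have lip: "path_lipschitz i L (path_space M i) (\<lambda>x. f m i x $ j)"
      using f(1)[OF i] by (simp add: bounded_ridge_def)
    show "path_lipschitz i L (space (path_borel i)) (\<lambda>x. X m i x $ j)"
      unfolding path_lipschitz_def
    proof (intro ballI)
      fix x y :: "'a path"
      have "\<bar>f m i (clamp_path M i x) $ j - f m i (clamp_path M i y) $ j\<bar>
          \<le> L * path_dist i (clamp_path M i x) (clamp_path M i y)"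
        using lip clamp_path_in[OF M] by (simp add: path_lipschitz_def)
      also have "\<dots> \<le> L * path_dist i x y" using L by (simp add: path_dist_clamp)
      finally show "\<bar>X m i x $ j - X m i y $ j\<bar> \<le> L * path_dist i x y" using i by (simp add: X_def)
    qed
    show "\<bar>X m i x $ j\<bar> \<le> B" if "x \<in> path_space M i" for x
      using f(1)[OF i] that X[OF i that] by (simp add: bounded_ridge_def)
  qed
  then have "(c, X m) \<in> ridge_admissible M \<psi> B L" for m
    unfolding ridge_admissible_def using f(1) X by blast
  moreover have "(\<lambda>m. X m i x) \<longlonglongrightarrow> \<Delta> i x" if i: "i < horizon M" and x: "x \<in> path_space M i" for i x
  proof (cases "i \<in> {1..<horizon M}")
    case True
    have "(\<lambda>m. X m i x $ j) \<longlonglongrightarrow> \<Delta> i x $ j" for j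
    proof (rule LIM_zero_cancel, rule Lim_null_comparison)
      show "\<forall>\<^sub>F m in sequentially. norm (X m i x $ j - \<Delta> i x $ j) \<le> inverse (real (Suc m))"
        using f(2)[OF True x] X[OF True x] by simp
    qed (rule LIMSEQ_inverse_real_of_nat)
    then show ?thesis by (intro vec_tendstoI)
  next
    case False
    then have "X m i x = \<Delta> i x" for m by (simp only: X_def if_False)
    then show ?thesis by simp
  qed
  ultimately show ?thesis by blast
qed

section \<open>Compactness of the admissible strategies\<close>

text \<open>Convergence is asked on the price box only, which is all that wealth on \<Omega>
  evaluates.\<close>

definition strategy_limit :: "('a::finite) market \<Rightarrow> (nat \<Rightarrow> 'a strategy) \<Rightarrow> 'a strategy \<Rightarrow> bool" where
  "strategy_limit M X \<Delta> \<longleftrightarrow>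
     (\<forall>i<horizon M. \<forall>x\<in>path_space M i. (\<lambda>m. X m i x) \<longlonglongrightarrow> \<Delta> i x)"

lemma path_space_nonempty:
  assumes "valid_market M" shows "path_space M i \<noteq> {}"
proof -
  have "state_space M \<noteq> {}" using assms by (auto simp: valid_market_def)
  then show ?thesis by (simp add: path_space_def PiE_eq_empty_iff)
qed

lemma path_space_0: "path_space M 0 = space (path_borel 0)"
  by (simp add: path_space_def path_borel_def space_PiM)

lemma space_path_borel_0: "x \<in> space (path_borel 0) \<Longrightarrow> y \<in> space (path_borel 0) \<Longrightarrow> x = y"
  by (simp add: path_borel_def space_PiM)

lemma countable_dense_paths:
  "\<exists>D :: ('a::finite) path set. countable D \<and> D \<subseteq> space (path_borel i) \<and>
    (\<forall>x\<in>space (path_borel i). \<forall>e>0. \<exists>y\<in>D. path_dist i x y < e)"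
proof -
  obtain Q :: "(real ^ 'a) set" where Q: "countable Q" "\<And>X. open X \<Longrightarrow> X \<noteq> {} \<Longrightarrow> \<exists>d\<in>Q. d \<in> X"
    using countable_dense_exists by metis
  let ?D = "PiE {1..i} (\<lambda>_. Q)"
  show ?thesis
  proof (intro exI[of _ ?D] conjI ballI allI impI)
    show "countable ?D" using Q(1) by (intro countable_PiE) auto
    show "?D \<subseteq> space (path_borel i)" by (auto simp: path_borel_def space_PiM)
    fix x :: "'a path" and e :: real assume x: "x \<in> space (path_borel i)" and "e > 0"
    define d where "d = e / real (Suc i)"
    have "d > 0" using \<open>e > 0\<close> by (simp add: d_def)
    then have "\<exists>q\<in>Q. q \<in> ball (x s) d" for s by (intro Q(2)) auto
    then obtain q where q: "\<And>s. q s \<in> Q" "\<And>s. dist (x s) (q s) < d" by (metis mem_ball)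
    have "path_dist i x (restrict q {1..i}) \<le> (\<Sum>s\<in>{1..i}. dist (x s) (restrict q {1..i} s))"
      unfolding path_dist_def by (rule L2_set_le_sum) simp
    also have "\<dots> \<le> (\<Sum>s\<in>{1..i}. d)" using q(2) by (intro sum_mono) (auto intro: less_imp_le)
    also have "\<dots> < e" using \<open>e > 0\<close> by (simp add: d_def field_simps)
    finally show "\<exists>y\<in>?D. path_dist i x y < e" using q(1) by (intro bexI[of _ "restrict q {1..i}"]) auto
  qed
qed

lemma admissible_dist:
  fixes M :: "('a::finite) market"
  assumes adm: "(c, \<Delta>) \<in> admissible M B L" and i: "i < horizon M" and "0 \<le> L"
    and x: "x \<in> space (path_borel i)" and y: "y \<in> space (path_borel i)"
  shows "dist (\<Delta> i x) (\<Delta> i y) \<le> real CARD('a) * (L * path_dist i x y)"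
proof (cases "i = 0")
  case True
  then have "x = y" using space_path_borel_0 x y by blast
  then show ?thesis using \<open>0 \<le> L\<close> by (simp add: path_dist_def)
next
  case False
  have "dist (\<Delta> i x) (\<Delta> i y) \<le> (\<Sum>j\<in>UNIV. \<bar>(\<Delta> i x - \<Delta> i y) $ j\<bar>)"
    unfolding dist_norm by (rule norm_le_l1_cart)
  also have "\<dots> \<le> (\<Sum>j\<in>(UNIV :: 'a set). L * path_dist i x y)"
    using adm i x y False by (intro sum_mono) (auto simp: admissible_def path_lipschitz_def)
  finally show ?thesis by simp
qed

lemma admissible_norm:
  fixes M :: "('a::finite) market"
  assumes adm: "(c, \<Delta>) \<in> admissible M B L" and i: "i < horizon M" and x: "x \<in> path_space M i"
  shows "norm (\<Delta> i x) \<le> real CARD('a) * B"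
proof -
  have "norm (\<Delta> i x) \<le> (\<Sum>j\<in>UNIV. \<bar>\<Delta> i x $ j\<bar>)" by (rule norm_le_l1_cart)
  also have "\<dots> \<le> (\<Sum>j\<in>(UNIV :: 'a set). B)"
  proof (rule sum_mono)
    show "\<bar>\<Delta> i x $ j\<bar> \<le> B" for j
      using adm i x by (cases "i = 0") (auto simp: admissible_def)
  qed
  finally show ?thesis by simp
qed

lemma admissible_closed:
  fixes M :: "('a::finite) market"
  assumes hor: "0 < horizon M" and adm: "\<And>m. (c m, X m) \<in> admissible M B L" and c: "c \<longlonglongrightarrow> c'"
    and X: "\<And>i x. i < horizon M \<Longrightarrow> x \<in> space (path_borel i) \<Longrightarrow> (\<lambda>m. X m i x) \<longlonglongrightarrow> \<Delta> i x"
  shows "(c', \<Delta>) \<in> admissible M B L"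
proof -
  have X': "(\<lambda>m. X m i x $ j) \<longlonglongrightarrow> \<Delta> i x $ j" if "i < horizon M" "x \<in> space (path_borel i)" for i x j
    using X[OF that] by (rule tendsto_vec_nth)
  have le: "\<bar>l\<bar> \<le> K" if "a \<longlonglongrightarrow> l" "\<And>m. \<bar>a m\<bar> \<le> K" for a :: "nat \<Rightarrow> real" and l K
    using LIMSEQ_le_const2[OF tendsto_rabs[OF that(1)]] that(2) by blast
  show ?thesis
    unfolding admissible_def
  proof (clarify, intro conjI ballI allI)
    show "\<bar>c'\<bar> \<le> B" using adm by (intro le[OF c]) (simp add: admissible_def)
    show "trading_strategy M \<Delta>"
      unfolding trading_strategy_def
    proof (intro ballI allI)
      fix i j assume i: "i \<in> {1..<horizon M}"
      show "(\<lambda>x. \<Delta> i x $ j) \<in> borel_measurable (path_borel i)"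
      proof (rule borel_measurable_LIMSEQ_real)
        show "(\<lambda>x. X m i x $ j) \<in> borel_measurable (path_borel i)" for m
          using adm[of m] i by (auto simp: admissible_def trading_strategy_def)
      qed (use X' i in auto)
    qed
    show "\<bar>\<Delta> 0 x $ j\<bar> \<le> B" if "x \<in> path_space M 0" for x j
    proof (rule le)
      show "(\<lambda>m. X m 0 x $ j) \<longlonglongrightarrow> \<Delta> 0 x $ j"
        using hor that by (intro X') (auto simp: path_space_0)
      show "\<bar>X m 0 x $ j\<bar> \<le> B" for m using adm[of m] that by (auto simp: admissible_def)
    qed
    fix i j assume i: "i \<in> {1..<horizon M}"
    show "path_lipschitz i L (space (path_borel i)) (\<lambda>x. \<Delta> i x $ j)"
      unfolding path_lipschitz_def
    proof (intro ballI)
      fix x y :: "'a path" assume xy: "x \<in> space (path_borel i)" "y \<in> space (path_borel i)"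
      show "\<bar>\<Delta> i x $ j - \<Delta> i y $ j\<bar> \<le> L * path_dist i x y"
      proof (rule le)
        show "(\<lambda>m. X m i x $ j - X m i y $ j) \<longlonglongrightarrow> \<Delta> i x $ j - \<Delta> i y $ j"
          using i xy by (intro tendsto_diff X') auto
        show "\<bar>X m i x $ j - X m i y $ j\<bar> \<le> L * path_dist i x y" for m
          using adm[of m] i xy by (auto simp: admissible_def path_lipschitz_def)
      qed
    qed
    show "\<bar>\<Delta> i x $ j\<bar> \<le> B" if x: "x \<in> path_space M i" for x
    proof (rule le)
      show "(\<lambda>m. X m i x $ j) \<longlonglongrightarrow> \<Delta> i x $ j"
        using i x path_space_subset by (intro X') auto
      show "\<bar>X m i x $ j\<bar> \<le> B" for m using adm[of m] i x by (auto simp: admissible_def)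
    qed
  qed
qed

text \<open>Arzela-Ascoli in pointwise form: a subsequence converging on a countable dense set
  converges everywhere thanks to the common Lipschitz constant. The limit is built on the full path
  space because \<open>admissible\<close> imposes its Lipschitz condition there.\<close>

lemma admissible_compact:
  fixes M :: "('a::finite) market" and X :: "nat \<Rightarrow> real \<times> 'a strategy"
  assumes M: "valid_market M" and L: "0 \<le> L" and adm: "\<And>m. X m \<in> admissible M B L"
  shows "\<exists>r c \<Delta>. strict_mono r \<and> (c, \<Delta>) \<in> admissible M B L \<and>
     (\<lambda>m. fst (X (r m))) \<longlonglongrightarrow> c \<and> strategy_limit M (\<lambda>m. snd (X (r m))) \<Delta>"
proof -
  have "fst (X m) \<in> {-B..B}" for m
    using adm[of m] by (cases "X m") (auto simp: admissible_def abs_le_iff)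
  then obtain c r1 where r1: "strict_mono r1" "(\<lambda>m. fst (X (r1 m))) \<longlonglongrightarrow> c"
    using seq_compactE[OF compact_imp_seq_compact[OF compact_Icc], of "\<lambda>m. fst (X m)" "-B" B]
    unfolding comp_def by metis
  obtain D :: "nat \<Rightarrow> 'a path set" where D: "\<And>i. countable (D i)" "\<And>i. D i \<subseteq> space (path_borel i)"
    "\<And>i x e. x \<in> space (path_borel i) \<Longrightarrow> e > 0 \<Longrightarrow> \<exists>y\<in>D i. path_dist i x y < e"
    using countable_dense_paths[where 'a = 'a] by metis
  have "\<forall>i. \<exists>z. z \<in> path_space M i" using path_space_nonempty[OF M] by blast
  then obtain z where z: "\<And>i. z i \<in> path_space M i" by metis
  \<comment> \<open>Pairs of a time and a path, so that a single subsequence serves all trading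
    times.\<close>
  define S where "S = (SIGMA i:{..<horizon M}. D i)"
  \<comment> \<open>Holdings are bounded by \<open>B\<close> on the box only; elsewhere the bound
    grows with the distance to the reference path \<open>z i\<close>. The summand 1 makes the
    estimate strict.\<close>
  define C where "C i x = real CARD('a) * B + real CARD('a) * (L * path_dist i x (z i)) + 1" for i x
  have bound: "norm (snd (X m) i x) < C i x" if "i < horizon M" "x \<in> space (path_borel i)" for m i x
  proof -
    have X: "(fst (X m), snd (X m)) \<in> admissible M B L" using adm by simp
    have "norm (snd (X m) i x) \<le> norm (snd (X m) i (z i)) + dist (snd (X m) i x) (snd (X m) i (z i))"
      by (metis add.commute dist_0_norm dist_commute dist_triangle)
    then show ?thesis
      using admissible_norm[OF X that(1) z] admissible_dist[OF X that(1) L that(2)] z[of i] path_space_subset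
      unfolding C_def by fastforce
  qed
  \<comment> \<open>Rescaling by \<open>C i x\<close> provides the common bound 1 under which the
    diagonal argument is applied.\<close>
  let ?f = "\<lambda>m (i, x). snd (X (r1 m)) i x /\<^sub>R C i x"
  have cS: "countable S" unfolding S_def by (intro countable_SIGMA D) auto
  have f1: "norm (?f m p) \<le> 1" if pS: "p \<in> S" for m p
  proof -
    obtain i x where p: "p = (i, x)" "i < horizon M" "x \<in> space (path_borel i)"
      using pS D(2) unfolding S_def by blast
    then have "norm (snd (X (r1 m)) i x) < C i x" using bound by blast
    moreover from this have "C i x > 0" using norm_ge_zero order_le_less_trans by blast
    ultimately show ?thesis by (simp add: p divide_simps)
  qed
  obtain r2 where r2: "strict_mono r2" "\<And>p. p \<in> S \<Longrightarrow> \<exists>l. (\<lambda>m. ?f (r2 m) p) \<longlonglongrightarrow> l"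
    by (rule function_convergent_subsequence[where f = ?f and M = 1, OF cS f1]) (assumption, rule that)
  let ?r = "r1 \<circ> r2"
  have conv_dense: "convergent (\<lambda>m. snd (X (?r m)) i x)" if "i < horizon M" "x \<in> D i" for i x
  proof -
    have "(i, x) \<in> S" using that by (simp add: S_def)
    then obtain l where "(\<lambda>m. snd (X (?r m)) i x /\<^sub>R C i x) \<longlonglongrightarrow> l" using r2(2) by fastforce
    from tendsto_scaleR[OF tendsto_const[of "C i x"] this]
    have "(\<lambda>m. C i x *\<^sub>R (snd (X (?r m)) i x /\<^sub>R C i x)) \<longlonglongrightarrow> C i x *\<^sub>R l" .
    moreover have "C i x \<noteq> 0"
      using bound[OF that(1), of x undefined] that(2) D(2)[of i] by (metis norm_not_less_zero subsetD)
    ultimately show ?thesis by (auto simp: convergent_def)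
  qed
  have conv: "convergent (\<lambda>m. snd (X (?r m)) i x)" if i: "i < horizon M" and x: "x \<in> space (path_borel i)" for i x
  proof -
    have "Cauchy (\<lambda>m. snd (X (?r m)) i x)"
      unfolding Cauchy_def
    proof (intro allI impI)
      fix e :: real assume "e > 0"
      define N where "N = real CARD('a) * L + 1"
      have "N > 0" using L by (simp add: N_def add_nonneg_pos)
      obtain y where y: "y \<in> D i" "path_dist i x y < e / 3 / N"
        using D(3)[OF x, of "e / 3 / N"] \<open>e > 0\<close> \<open>N > 0\<close> by auto
      have near: "dist (snd (X m) i x) (snd (X m) i y) < e / 3" for m
      proof -
        have "(fst (X m), snd (X m)) \<in> admissible M B L" using adm by simp
        from admissible_dist[OF this i L x, of y]
        have "dist (snd (X m) i x) (snd (X m) i y) \<le> real CARD('a) * (L * path_dist i x y)"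
          using y(1) D(2) by blast
        also have "\<dots> \<le> N * path_dist i x y"
          by (simp add: N_def algebra_simps path_dist_def)
        also have "\<dots> < N * (e / 3 / N)" by (rule mult_strict_left_mono[OF y(2) \<open>N > 0\<close>])
        also have "\<dots> = e / 3" using \<open>N > 0\<close> by simp
        finally show ?thesis .
      qed
      obtain k where k: "\<And>m n. m \<ge> k \<Longrightarrow> n \<ge> k \<Longrightarrow> dist (snd (X (?r m)) i y) (snd (X (?r n)) i y) < e / 3"
        using convergent_Cauchy[OF conv_dense[OF i y(1)]] \<open>e > 0\<close> unfolding Cauchy_def
        by (metis divide_pos_pos zero_less_numeral)
      have "dist (snd (X (?r m)) i x) (snd (X (?r n)) i x) < e" if "m \<ge> k" "n \<ge> k" for m n
        using dist_triangle_third[OF near[of "?r m"] k[OF that] near[of "?r n", unfolded dist_commute[of _ "snd _ i y"]]] .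
      then show "\<exists>k. \<forall>m\<ge>k. \<forall>n\<ge>k. dist (snd (X (?r m)) i x) (snd (X (?r n)) i x) < e" by blast
    qed
    then show ?thesis by (rule Cauchy_convergent)
  qed
  define \<Delta> where "\<Delta> i x = lim (\<lambda>m. snd (X (?r m)) i x)" for i x
  have lim: "(\<lambda>m. snd (X (?r m)) i x) \<longlonglongrightarrow> \<Delta> i x" if "i < horizon M" "x \<in> space (path_borel i)" for i x
    using conv[OF that] by (simp add: \<Delta>_def convergent_LIMSEQ_iff)
  have c: "(\<lambda>m. fst (X (?r m))) \<longlonglongrightarrow> c"
    using LIMSEQ_subseq_LIMSEQ[OF r1(2) r2(1)] by (simp add: comp_def)
  have "(c, \<Delta>) \<in> admissible M B L"
    by (rule admissible_closed[where X = "\<lambda>m. snd (X (?r m))", OF _ _ c lim])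
       (use adm M in \<open>auto simp: valid_market_def\<close>)
  moreover have "strategy_limit M (\<lambda>m. snd (X (?r m))) \<Delta>"
    unfolding strategy_limit_def using lim path_space_subset by blast
  ultimately show ?thesis using c strict_mono_o[OF r1(1) r2(1)] by (intro exI[of _ ?r]) blast
qed

section \<open>Wealth: bounds, continuity and measurability\<close>

lemma price_in_state_space:
  assumes M: "valid_market M" and x: "x \<in> Omega M" and i: "i \<le> horizon M"
  shows "price M i x \<in> state_space M"
  using assms by (auto simp: price_def valid_market_def path_space_def PiE_def Pi_def)

lemma restrict_path_space:
  assumes "x \<in> Omega M" "i \<le> horizon M" shows "restrict x {1..i} \<in> path_space M i"
  using assms by (auto simp: path_space_def PiE_def Pi_def)

lemma holding_bound:
  assumes "(c, \<Delta>) \<in> admissible M B L" "0 \<le> B" "x \<in> Omega M"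
  shows "\<bar>holding M \<Delta> i x $ j\<bar> \<le> B"
proof (cases "i < horizon M")
  case True
  then have "restrict x {1..i} \<in> path_space M i" using restrict_path_space[OF assms(3), of i] by simp
  then have "\<bar>\<Delta> i (restrict x {1..i}) $ j\<bar> \<le> B"
    using assms(1) True by (cases "i = 0") (auto simp: admissible_def)
  then show ?thesis using True by (simp add: holding_def)
qed (use assms in \<open>simp add: holding_def\<close>)

lemma trade_bound:
  assumes "(c, \<Delta>) \<in> admissible M B L" "0 \<le> B" "x \<in> Omega M"
  shows "\<bar>trade M \<Delta> i x $ j\<bar> \<le> 2 * B"
  using holding_bound[OF assms, of i j] holding_bound[OF assms, of "i - 1" j] assms(2)
  by (auto simp: trade_def)

lemma continuous_cost_bound:
  fixes M :: "('a::finite) market"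
  assumes K: "continuous_cost M K"
  shows "\<exists>C. \<forall>i\<le>horizon M. \<forall>j v d. v \<in> state_space M \<longrightarrow> \<bar>d\<bar> \<le> D \<longrightarrow> \<bar>K i j (v $ j) d\<bar> \<le> C"
proof -
  have "\<exists>C\<ge>0. \<forall>v d. v \<in> state_space M \<longrightarrow> \<bar>d\<bar> \<le> D \<longrightarrow> \<bar>K i j (v $ j) d\<bar> \<le> C" if "i \<le> horizon M" for i j
  proof -
    let ?S = "{lower M $ j..upper M $ j} \<times> {-D..D}"
    have "compact ?S" by (intro compact_Times compact_Icc)
    moreover have "continuous_on ?S (\<lambda>(s, d). K i j s d)"
      using K that continuous_on_subset unfolding continuous_cost_def by blast
    ultimately have "bounded ((\<lambda>(s, d). K i j s d) ` ?S)"
      using compact_continuous_image compact_imp_bounded by blast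
    then obtain C where C: "\<forall>p\<in>(\<lambda>(s, d). K i j s d) ` ?S. norm p \<le> C" by (auto simp: bounded_iff)
    have "\<bar>K i j (v $ j) d\<bar> \<le> max C 0" if "v \<in> state_space M" "\<bar>d\<bar> \<le> D" for v d
    proof -
      have "(v $ j, d) \<in> ?S" using that by (auto simp: state_space_def mem_box_cart)
      then show ?thesis using C by force
    qed
    then show ?thesis by (intro exI[of _ "max C 0"]) auto
  qed
  then obtain C where C: "\<And>i j. i \<le> horizon M \<Longrightarrow> C i j \<ge> 0"
    "\<And>i j v d. i \<le> horizon M \<Longrightarrow> v \<in> state_space M \<Longrightarrow> \<bar>d\<bar> \<le> D \<Longrightarrow> \<bar>K i j (v $ j) d\<bar> \<le> C i j"
    by metis
  \<comment> \<open>The double sum stands in for a maximum over times and assets, which is why the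
    constants were made nonnegative.\<close>
  have le: "C i j \<le> (\<Sum>i\<le>horizon M. \<Sum>j\<in>UNIV. C i j)" if "i \<le> horizon M" for i j
  proof -
    have "C i j \<le> (\<Sum>j\<in>UNIV. C i j)" using C(1)[OF that] by (intro member_le_sum) auto
    also have "\<dots> \<le> (\<Sum>i\<le>horizon M. \<Sum>j\<in>UNIV. C i j)"
      using C(1) that by (intro member_le_sum[of i _ "\<lambda>i. \<Sum>j\<in>UNIV. C i j"] sum_nonneg) auto
    finally show ?thesis .
  qed
  then show ?thesis using C(2) order_trans by blast
qed

text \<open>Holdings are at most \<open>B\<close> and trades at most 2 B in size, so all arguments
  of the cost functions stay in a compact set that does not depend on the strategy.\<close>

lemma wealth_bounded:
  fixes M :: "('a::finite) market"
  assumes M: "valid_market M" and B: "0 \<le> B"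
    and costs: "continuous_cost M (trans_cost M)" "continuous_cost M (liq_cost M)"
      "continuous_cost M (borrow_cost M)"
  shows "\<exists>K\<ge>0. \<forall>c \<Delta> x. (c, \<Delta>) \<in> admissible M B L \<longrightarrow> x \<in> Omega M \<longrightarrow> \<bar>wealth M c \<Delta> x\<bar> \<le> K"
proof -
  obtain CT where CT: "\<forall>i\<le>horizon M. \<forall>j v d. v \<in> state_space M \<longrightarrow> \<bar>d\<bar> \<le> 2 * B \<longrightarrow> \<bar>trans_cost M i j (v $ j) d\<bar> \<le> CT"
    using continuous_cost_bound[OF costs(1)] ..
  note CT = CT[rule_format]
  obtain CL where CL: "\<forall>i\<le>horizon M. \<forall>j v d. v \<in> state_space M \<longrightarrow> \<bar>d\<bar> \<le> 2 * B \<longrightarrow> \<bar>liq_cost M i j (v $ j) d\<bar> \<le> CL"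
    using continuous_cost_bound[OF costs(2)] ..
  note CL = CL[rule_format]
  obtain CB where CB: "\<forall>i\<le>horizon M. \<forall>j v d. v \<in> state_space M \<longrightarrow> \<bar>d\<bar> \<le> 2 * B \<longrightarrow> \<bar>borrow_cost M i j (v $ j) d\<bar> \<le> CB"
    using continuous_cost_bound[OF costs(3)] ..
  note CB = CB[rule_format]
  obtain R where R': "\<And>v j. v \<in> state_space M \<Longrightarrow> \<bar>v $ j\<bar> \<le> R"
    using state_space_bounded by metis
  define K where "K = B + (\<Sum>j\<in>(UNIV :: 'a set). \<Sum>i<horizon M. B * (2 * R))
    + (\<Sum>j\<in>(UNIV :: 'a set). \<Sum>i\<le>horizon M. CT + CL + CB)"
  have "\<bar>wealth M c \<Delta> x\<bar> \<le> K" if adm: "(c, \<Delta>) \<in> admissible M B L" and x: "x \<in> Omega M" for c \<Delta> x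
  proof -
    note h = holding_bound[OF adm B x] and t = trade_bound[OF adm B x] and p = price_in_state_space[OF M x]
    have "\<bar>gross_profit M \<Delta> x\<bar> \<le> (\<Sum>j\<in>(UNIV :: 'a set). \<Sum>i<horizon M. B * (2 * R))"
      unfolding gross_profit_def
    proof (intro order_trans[OF sum_abs] sum_mono)
      fix j i assume "i \<in> {..<horizon M}"
      then have "\<bar>price M (Suc i) x $ j - price M i x $ j\<bar> \<le> 2 * R"
        using R'[OF p[of "Suc i"], of j] R'[OF p[of i], of j] by auto
      then show "\<bar>holding M \<Delta> i x $ j * (price M (Suc i) x $ j - price M i x $ j)\<bar> \<le> B * (2 * R)"
        unfolding abs_mult by (intro mult_mono h) (use B in auto)
    qed
    moreover have "\<bar>total_cost M \<Delta> x\<bar> \<le> (\<Sum>j\<in>(UNIV :: 'a set). \<Sum>i\<le>horizon M. CT + CL + CB)"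
      unfolding total_cost_def
    proof (intro order_trans[OF sum_abs] sum_mono)
      fix j i assume i: "i \<in> {..horizon M}"
      have "\<bar>holding M \<Delta> i x $ j\<bar> \<le> 2 * B" using h[of i j] B by linarith
      then show "\<bar>trans_cost M i j (price M i x $ j) (trade M \<Delta> i x $ j)
          + liq_cost M i j (price M i x $ j) (trade M \<Delta> i x $ j)
          + borrow_cost M i j (price M i x $ j) (holding M \<Delta> i x $ j)\<bar> \<le> CT + CL + CB"
        using CT[OF _ p t, of i i j i j] CL[OF _ p t, of i i j i j] CB[OF _ p, of i i "holding M \<Delta> i x $ j" j] i
        by auto
    qed
    moreover have "\<bar>c\<bar> \<le> B" using adm by (simp add: admissible_def)
    ultimately show ?thesis unfolding wealth_def K_def by linarith
  qed
  then show ?thesis by (intro exI[of _ "max K 0"]) (auto simp: le_max_iff_disj)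
qed

lemma holding_tendsto:
  assumes "strategy_limit M X \<Delta>" "x \<in> Omega M"
  shows "(\<lambda>m. holding M (X m) i x) \<longlonglongrightarrow> holding M \<Delta> i x"
  using assms restrict_path_space[OF assms(2), of i] by (auto simp: holding_def strategy_limit_def)

lemma cost_tendsto:
  assumes "continuous_cost M K" "i \<le> horizon M" "d \<longlonglongrightarrow> d'"
  shows "(\<lambda>m. K i j s (d m)) \<longlonglongrightarrow> K i j s d'"
proof -
  have "isCont (\<lambda>(s, d). K i j s d) (s, d')"
    using assms by (simp add: continuous_cost_def continuous_on_eq_continuous_at)
  from isCont_tendsto_compose[OF this tendsto_Pair[OF tendsto_const assms(3)]] show ?thesis by simp
qed

lemma wealth_tendsto:
  assumes "continuous_cost M (trans_cost M)" "continuous_cost M (liq_cost M)"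
    "continuous_cost M (borrow_cost M)"
    and "c \<longlonglongrightarrow> c'" and X: "strategy_limit M X \<Delta>" and x: "x \<in> Omega M"
  shows "(\<lambda>m. wealth M (c m) (X m) x) \<longlonglongrightarrow> wealth M c' \<Delta> x"
proof -
  note h = holding_tendsto[OF X x]
  have h': "(\<lambda>m. holding M (X m) i x $ j) \<longlonglongrightarrow> holding M \<Delta> i x $ j" for i j
    by (rule tendsto_vec_nth[OF h])
  have t': "(\<lambda>m. trade M (X m) i x $ j) \<longlonglongrightarrow> trade M \<Delta> i x $ j" for i j
    unfolding trade_def by (cases "i = 0") (auto intro!: tendsto_intros h)
  show ?thesis
    unfolding wealth_def gross_profit_def total_cost_def
    by (intro tendsto_diff tendsto_add tendsto_sum tendsto_mult tendsto_const assms(4) h'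
        cost_tendsto[OF assms(1)] cost_tendsto[OF assms(2)] cost_tendsto[OF assms(3)] t') auto
qed

lemma space_Omega_borel: "space (Omega_borel M) = Omega M"
  using path_space_subset[of M "horizon M"] by (auto simp: Omega_borel_def space_restrict_space)

lemma price_measurable [measurable]:
  assumes "i \<le> horizon M" shows "price M i \<in> Omega_borel M \<rightarrow>\<^sub>M borel"
proof (cases "i = 0")
  case False
  then have "(\<lambda>x. x i) \<in> path_borel (horizon M) \<rightarrow>\<^sub>M borel"
    using assms unfolding path_borel_def by (intro measurable_component_singleton) auto
  then show ?thesis unfolding Omega_borel_def price_def[abs_def] using False
    by (auto intro: measurable_restrict_space1)
qed (simp add: price_def[abs_def])

lemma holding_measurable:
  assumes "trading_strategy M \<Delta>"
  shows "(\<lambda>x. holding M \<Delta> i x $ j) \<in> borel_measurable (Omega_borel M)"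
proof (cases "i = 0 \<or> \<not> i < horizon M")
  case True
  \<comment> \<open>At time 0 every path restricts to the same empty path, so the holding is
    constant.\<close>
  have "restrict x {1..0::nat} = (\<lambda>_. undefined)" for x :: "'a path" by auto
  then show ?thesis using True by (auto simp: holding_def cong: if_cong)
next
  case False
  then have i: "i \<in> {1..<horizon M}" by auto
  have "(\<lambda>x. restrict x {1..i}) \<in> path_borel (horizon M) \<rightarrow>\<^sub>M path_borel i"
    unfolding path_borel_def using i by (intro measurable_restrict_subset) auto
  moreover have "(\<lambda>x. \<Delta> i x $ j) \<in> borel_measurable (path_borel i)"
    using assms i by (simp add: trading_strategy_def)
  ultimately have "(\<lambda>x. \<Delta> i (restrict x {1..i}) $ j) \<in> borel_measurable (path_borel (horizon M))"
    by (rule measurable_compose)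
  then show ?thesis using False
    by (auto simp: holding_def Omega_borel_def intro: measurable_restrict_space1)
qed

lemma cost_measurable:
  assumes "valid_cost M K" "i \<le> horizon M"
    and [measurable]: "f \<in> borel_measurable N" "g \<in> borel_measurable N"
  shows "(\<lambda>x. K i j (f x) (g x)) \<in> borel_measurable N"
proof -
  have "(\<lambda>(s, d). K i j s d) \<in> borel_measurable (borel \<Otimes>\<^sub>M borel)"
    using assms(1,2) by (simp add: valid_cost_def borel_prod)
  from measurable_compose[OF _ this, of "\<lambda>x. (f x, g x)" N] show ?thesis by simp
qed

lemma wealth_measurable:
  fixes M :: "('a::finite) market"
  assumes M: "valid_market M" and adm: "(c, \<Delta>) \<in> admissible M B L"
  shows "wealth M c \<Delta> \<in> borel_measurable (Omega_borel M)"
proof -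
  have ts: "trading_strategy M \<Delta>" using adm by (simp add: admissible_def)
  note h = holding_measurable[OF ts]
  have p: "(\<lambda>x. price M i x $ j) \<in> borel_measurable (Omega_borel M)" if "i \<le> horizon M" for i j
    using measurable_compose[OF price_measurable[OF that], of "\<lambda>v. v $ j" borel] by simp
  have t: "(\<lambda>x. trade M \<Delta> i x $ j) \<in> borel_measurable (Omega_borel M)" for i j
    unfolding trade_def by (cases "i = 0") (auto intro!: borel_measurable_diff h)
  have costs: "valid_cost M (trans_cost M)" "valid_cost M (liq_cost M)" "valid_cost M (borrow_cost M)"
    using M by (auto simp: valid_market_def)
  show ?thesis
    unfolding wealth_def[abs_def] gross_profit_def total_cost_def
    by (intro borel_measurable_diff borel_measurable_add borel_measurable_sum borel_measurable_times
        borel_measurable_const cost_measurable[OF costs(1)] cost_measurable[OF costs(2)]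
        cost_measurable[OF costs(3)] p h t) auto
qed

section \<open>Convergence of conditional expectations\<close>

lemma sigma_finite_subalgebraI:
  assumes "prob_space P" "subalgebra P F"
  shows "sigma_finite_subalgebra P F"
proof -
  interpret prob_space P by fact
  have "finite_measure_subalgebra P F" by unfold_locales (rule assms(2))
  then show ?thesis by (rule finite_measure_subalgebra_is_sigma_finite)
qed

definition L1_dist :: "'b measure \<Rightarrow> ('b \<Rightarrow> real) \<Rightarrow> ('b \<Rightarrow> real) \<Rightarrow> real" where
  "L1_dist P f g = (\<integral>x. \<bar>f x - g x\<bar> \<partial>P)"

lemma L1_dist_nonneg: "0 \<le> L1_dist P f g"
  by (simp add: L1_dist_def)

lemma L1_dist_commute: "L1_dist P f g = L1_dist P g f"
  by (simp add: L1_dist_def abs_minus_commute)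

lemma L1_dist_triangle:
  assumes "integrable P f" "integrable P g" "integrable P h"
  shows "L1_dist P f h \<le> L1_dist P f g + L1_dist P g h"
proof -
  have "L1_dist P f h \<le> (\<integral>x. \<bar>f x - g x\<bar> + \<bar>g x - h x\<bar> \<partial>P)"
    unfolding L1_dist_def using assms by (intro integral_mono) auto
  also have "\<dots> = L1_dist P f g + L1_dist P g h"
    unfolding L1_dist_def using assms by (intro Bochner_Integration.integral_add) auto
  finally show ?thesis .
qed

text \<open>Monotonicity, applied to f - g and to its negative against the absolute value, gives the
  conditional triangle inequality, which is then integrated.\<close>

lemma L1_dist_cond_exp:
  assumes "prob_space P" "subalgebra P F" and f: "integrable P f" and g: "integrable P g"
  shows "L1_dist P (real_cond_exp P F f) (real_cond_exp P F g) \<le> L1_dist P f g"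
proof -
  interpret sigma_finite_subalgebra P F by (rule sigma_finite_subalgebraI[OF assms(1,2)])
  let ?d = "\<lambda>x. f x - g x" and ?E = "real_cond_exp P F"
  have d: "integrable P ?d" "integrable P (\<lambda>x. \<bar>?d x\<bar>)" using f g by auto
  have d': "integrable P (\<lambda>x. - 1 * ?d x)" using d(1) by (rule integrable_mult_right)
  have "AE x in P. ?E (\<lambda>x. f x - g x) x = ?E f x - ?E g x" by (rule real_cond_exp_diff[OF f g])
  moreover have "AE x in P. ?E ?d x \<le> ?E (\<lambda>x. \<bar>?d x\<bar>) x"
    by (rule real_cond_exp_mono) (use d in auto)
  moreover have "AE x in P. ?E (\<lambda>x. - 1 * ?d x) x \<le> ?E (\<lambda>x. \<bar>?d x\<bar>) x"
    by (rule real_cond_exp_mono[OF _ d' d(2)]) (intro AE_I2, use abs_ge_minus_self in \<open>simp del: minus_diff_eq\<close>)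
  moreover have "AE x in P. ?E (\<lambda>x. - 1 * ?d x) x = - 1 * ?E ?d x"
    by (rule real_cond_exp_cmult[OF d(1)])
  ultimately have "AE x in P. \<bar>?E f x - ?E g x\<bar> \<le> ?E (\<lambda>x. \<bar>?d x\<bar>) x" by eventually_elim auto
  then have "L1_dist P (?E f) (?E g) \<le> (\<integral>x. ?E (\<lambda>x. \<bar>?d x\<bar>) x \<partial>P)"
    unfolding L1_dist_def using f g d by (intro integral_mono_AE) (auto intro!: real_cond_exp_int(1))
  also have "\<dots> = L1_dist P f g" unfolding L1_dist_def by (rule real_cond_exp_int(2)[OF d(2)])
  finally show ?thesis .
qed

section \<open>Levy's upward theorem in L1\<close>

context
  fixes P :: "'b measure" and F :: "nat \<Rightarrow> 'b measure" and G :: "'b measure"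
  assumes P: "prob_space P"
    and F: "\<And>n. subalgebra P (F n)" and mono: "\<And>n. sets (F n) \<subseteq> sets (F (Suc n))"
    and G: "subalgebra P G" and generated: "sets G = sigma_sets (space P) (\<Union>n. sets (F n))"
begin

text \<open>Conditional expectations contract the L1 distance with a constant independent of
  \<open>n\<close>, so the functions they recover in the limit form an L1-closed set.\<close>

lemma cond_exp_closure:
  assumes h: "integrable P h" and hs: "\<And>r. integrable P (s r)"
    and s: "\<And>r. (\<lambda>n. L1_dist P (real_cond_exp P (F n) (s r)) (s r)) \<longlonglongrightarrow> 0"
    and lim: "(\<lambda>r. L1_dist P (s r) h) \<longlonglongrightarrow> 0"
  shows "(\<lambda>n. L1_dist P (real_cond_exp P (F n) h) h) \<longlonglongrightarrow> 0"
proof (rule LIMSEQ_I)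
  fix e :: real assume "e > 0"
  then have "e / 3 > 0" by simp
  obtain r where r: "L1_dist P (s r) h < e / 3"
    using LIMSEQ_D[OF lim \<open>e / 3 > 0\<close>] by (auto simp: L1_dist_nonneg)
  obtain n0 where n0: "\<And>n. n \<ge> n0 \<Longrightarrow> L1_dist P (real_cond_exp P (F n) (s r)) (s r) < e / 3"
    using LIMSEQ_D[OF s[of r] \<open>e / 3 > 0\<close>] by (auto simp: L1_dist_nonneg)
  have "norm (L1_dist P (real_cond_exp P (F n) h) h - 0) < e" if "n \<ge> n0" for n
  proof -
    interpret sigma_finite_subalgebra P "F n" by (rule sigma_finite_subalgebraI[OF P F])
    let ?E = "real_cond_exp P (F n)"
    have int: "integrable P (?E h)" "integrable P (?E (s r))"
      using h hs[of r] by (auto intro!: real_cond_exp_int(1))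
    have "L1_dist P (?E h) h \<le> L1_dist P (?E h) (?E (s r)) + L1_dist P (?E (s r)) h"
      by (rule L1_dist_triangle[OF int h])
    moreover have "L1_dist P (?E (s r)) h \<le> L1_dist P (?E (s r)) (s r) + L1_dist P (s r) h"
      by (rule L1_dist_triangle[OF int(2) hs h])
    moreover have "L1_dist P (?E h) (?E (s r)) \<le> L1_dist P (s r) h"
      using L1_dist_cond_exp[OF P F h hs] by (simp add: L1_dist_commute[of P h])
    ultimately show ?thesis using r n0[OF that] by (simp add: L1_dist_nonneg)
  qed
  then show "\<exists>n0. \<forall>n\<ge>n0. norm (L1_dist P (real_cond_exp P (F n) h) h - 0) < e" by blast
qed

lemma cond_exp_add_closure:
  assumes int: "integrable P f" "integrable P g"
    and lim: "(\<lambda>n. L1_dist P (real_cond_exp P (F n) f) f) \<longlonglongrightarrow> 0"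
      "(\<lambda>n. L1_dist P (real_cond_exp P (F n) g) g) \<longlonglongrightarrow> 0"
  shows "(\<lambda>n. L1_dist P (real_cond_exp P (F n) (\<lambda>x. f x + g x)) (\<lambda>x. f x + g x)) \<longlonglongrightarrow> 0"
proof (rule tendsto_sandwich[OF always_eventually always_eventually tendsto_const])
  show "(\<lambda>n. L1_dist P (real_cond_exp P (F n) f) f + L1_dist P (real_cond_exp P (F n) g) g) \<longlonglongrightarrow> 0"
    using tendsto_add[OF lim] by simp
  show "\<forall>n. 0 \<le> L1_dist P (real_cond_exp P (F n) (\<lambda>x. f x + g x)) (\<lambda>x. f x + g x)"
    by (simp add: L1_dist_nonneg)
  show "\<forall>n. L1_dist P (real_cond_exp P (F n) (\<lambda>x. f x + g x)) (\<lambda>x. f x + g x)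
      \<le> L1_dist P (real_cond_exp P (F n) f) f + L1_dist P (real_cond_exp P (F n) g) g"
  proof
    fix n
    interpret sigma_finite_subalgebra P "F n" by (rule sigma_finite_subalgebraI[OF P F])
    let ?E = "real_cond_exp P (F n)"
    have "AE x in P. ?E (\<lambda>x. f x + g x) x = ?E f x + ?E g x" by (rule real_cond_exp_add[OF int])
    then have "AE x in P. \<bar>?E (\<lambda>x. f x + g x) x - (f x + g x)\<bar> \<le> \<bar>?E f x - f x\<bar> + \<bar>?E g x - g x\<bar>"
      by eventually_elim auto
    then have "L1_dist P (?E (\<lambda>x. f x + g x)) (\<lambda>x. f x + g x) \<le> (\<integral>x. \<bar>?E f x - f x\<bar> + \<bar>?E g x - g x\<bar> \<partial>P)"
      unfolding L1_dist_def
      by (intro integral_mono_AE integrable_abs Bochner_Integration.integrable_add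
          Bochner_Integration.integrable_diff real_cond_exp_int(1) int)
    also have "\<dots> = L1_dist P (?E f) f + L1_dist P (?E g) g"
      unfolding L1_dist_def
      by (intro Bochner_Integration.integral_add integrable_abs
          Bochner_Integration.integrable_diff real_cond_exp_int(1) int)
    finally show "L1_dist P (?E (\<lambda>x. f x + g x)) (\<lambda>x. f x + g x) \<le> \<dots>" .
  qed
qed

lemma sets_F_mono: "m \<le> n \<Longrightarrow> sets (F m) \<subseteq> sets (F n)"
  by (rule lift_Suc_mono_le[of "\<lambda>n. sets (F n)", OF mono])

lemma sets_F_G: "sets (F n) \<subseteq> sets G"
  unfolding generated by auto

lemma sets_G_P: "sets G \<subseteq> sets P"
  using G by (simp add: subalgebra_def)

text \<open>Dynkin's argument. A set of some \<open>F m\<close> has error zero from \<open>m\<close>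
  on, and such sets are stable under intersection; complements keep the error, and a disjoint union
  is the L1 limit of its finite partial unions.\<close>

lemma cond_exp_indicator:
  assumes "A \<in> sets G"
  shows "(\<lambda>n. L1_dist P (real_cond_exp P (F n) (indicator A)) (indicator A)) \<longlonglongrightarrow> 0"
proof -
  interpret prob_space P by (rule P)
  have int: "integrable P (indicator A :: 'b \<Rightarrow> real)" if "A \<in> sets G" for A
    using that sets_G_P by (auto simp: less_top[symmetric])
  have space_F: "space (F n) = space P" for n using F[of n] by (simp add: subalgebra_def)
  have Int: "Int_stable (\<Union>n. sets (F n))"
  proof (rule Int_stableI)
    fix a b assume "a \<in> (\<Union>n. sets (F n))" "b \<in> (\<Union>n. sets (F n))"
    then obtain m n where "a \<in> sets (F m)" "b \<in> sets (F n)" by blast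
    then have "a \<in> sets (F (max m n))" "b \<in> sets (F (max m n))"
      using sets_F_mono[of m "max m n"] sets_F_mono[of n "max m n"] by auto
    then show "a \<inter> b \<in> (\<Union>n. sets (F n))" by blast
  qed
  have Pow: "(\<Union>n. sets (F n)) \<subseteq> Pow (space P)"
    using sets.sets_into_space space_F by fastforce
  have base: "(\<lambda>n. L1_dist P (real_cond_exp P (F n) (indicator A)) (indicator A)) \<longlonglongrightarrow> 0"
    if m: "A \<in> sets (F m)" for A m
  proof -
    have "L1_dist P (real_cond_exp P (F n) (indicator A)) (indicator A) = 0" if "m \<le> n" for n
    proof -
      interpret sigma_finite_subalgebra P "F n" by (rule sigma_finite_subalgebraI[OF P F])
      have A: "A \<in> sets (F n)" using m sets_F_mono[OF that] by blast
      then have "AE x in P. real_cond_exp P (F n) (indicator A) x = indicator A x"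
        using int sets_F_G by (intro real_cond_exp_F_meas) auto
      then have "L1_dist P (real_cond_exp P (F n) (indicator A)) (indicator A) = (\<integral>x. 0 \<partial>P)"
        unfolding L1_dist_def using A F[of n] by (intro integral_cong_AE) (auto simp: subalgebra_def)
      then show ?thesis by simp
    qed
    then show ?thesis by (intro tendsto_eventually eventually_sequentiallyI)
  qed
  from Int Pow assms[unfolded generated] show ?thesis
  proof (induction rule: sigma_sets_induct_disjoint)
    case (basic A)
    then obtain m where "A \<in> sets (F m)" by blast
    then show ?case by (rule base)
  next
    case empty
    show ?case by (rule base[of _ 0]) simp
  next
    case (compl A)
    then have A: "A \<in> sets G" by (simp add: generated)
    have "L1_dist P (real_cond_exp P (F n) (indicator (space P - A))) (indicator (space P - A))
        = L1_dist P (real_cond_exp P (F n) (indicator A)) (indicator A)" for n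
    proof -
      interpret sigma_finite_subalgebra P "F n" by (rule sigma_finite_subalgebraI[OF P F])
      let ?E = "real_cond_exp P (F n)"
      have [measurable]: "A \<in> sets P" using A sets_G_P by blast
      have "AE x in P. ?E (indicator (space P - A)) x = ?E (\<lambda>x. 1 - indicator A x) x"
        by (intro real_cond_exp_cong) (auto simp: indicator_def)
      moreover have "AE x in P. ?E (\<lambda>x. 1 - indicator A x) x = ?E (\<lambda>x. 1) x - ?E (indicator A) x"
        by (intro real_cond_exp_diff int[OF A]) auto
      moreover have "AE x in P. ?E (\<lambda>x. 1) x = 1" by (intro real_cond_exp_F_meas) auto
      ultimately have "AE x in P. \<bar>?E (indicator (space P - A)) x - indicator (space P - A) x\<bar>
          = \<bar>?E (indicator A) x - indicator A x\<bar>"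
        using AE_space by eventually_elim (auto simp: indicator_def)
      then show ?thesis unfolding L1_dist_def by (intro integral_cong_AE) auto
    qed
    then show ?case using compl by simp
  next
    case (union A)
    then have A: "A i \<in> sets G" for i by (auto simp: generated)
    let ?U = "\<lambda>r. \<Union>i<r. A i"
    have U: "?U r \<in> sets G" "(\<Union>i. A i) \<in> sets G" for r using A by auto
    show ?case
    proof (rule cond_exp_closure[where s = "\<lambda>r. indicator (?U r)"])
      show "(\<lambda>n. L1_dist P (real_cond_exp P (F n) (indicator (?U r))) (indicator (?U r))) \<longlonglongrightarrow> 0" for r
      proof (induction r)
        case 0
        have "?U 0 = {}" by simp
        then show ?case by (simp only:) (rule base[of _ 0], simp)
      next
        case (Suc r)
        have disj: "A i \<inter> A r = {}" if "i < r" for i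
          using union(1) that by (intro disjoint_family_onD[of A UNIV]) auto
        have "indicator (?U (Suc r)) x = (indicator (?U r) x + indicator (A r) x :: real)" for x
          using disj unfolding lessThan_Suc by (cases "x \<in> A r") (auto simp: indicator_def)
        then have "indicator (?U (Suc r)) = (\<lambda>x. indicator (?U r) x + indicator (A r) x :: real)"
          by (rule ext)
        then show ?case
          using cond_exp_add_closure[OF int[OF U(1)] int[OF A] Suc union(3)] by (simp only:)
      qed
      have "(\<lambda>r. L1_dist P (indicator (?U r)) (indicator (\<Union>i. A i))) \<longlonglongrightarrow> (\<integral>x. 0 \<partial>P)"
        unfolding L1_dist_def
      proof (rule integral_dominated_convergence[where w = "\<lambda>_. 1"])
        have "(\<lambda>r. indicator (?U r) x :: real) \<longlonglongrightarrow> indicator (\<Union>i. A i) x" for x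
          by (rule LIMSEQ_indicator_UN)
        then have "(\<lambda>r. \<bar>indicator (?U r) x - indicator (\<Union>i. A i) x\<bar> :: real) \<longlonglongrightarrow> 0" for x
          using tendsto_rabs_zero LIM_zero by fastforce
        then show "AE x in P. (\<lambda>r. \<bar>indicator (?U r) x - indicator (\<Union>i. A i) x\<bar> :: real) \<longlonglongrightarrow> 0" by simp
        show "AE x in P. norm \<bar>indicator (?U r) x - indicator (\<Union>i. A i) x :: real\<bar> \<le> 1" for r
          by (auto simp: indicator_def)
        show "(\<lambda>x. \<bar>indicator (?U r) x - indicator (\<Union>i. A i) x :: real\<bar>) \<in> borel_measurable P" for r
          using U sets_G_P by (intro borel_measurable_abs borel_measurable_diff borel_measurable_indicator) auto
      qed auto
      then show "(\<lambda>r. L1_dist P (indicator (?U r)) (indicator (\<Union>i. A i))) \<longlonglongrightarrow> 0" by simp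
    qed (use int U in auto)
  qed
qed

lemma cond_exp_converges_measurable:
  assumes "integrable (restr_to_subalg P G) h"
  shows "(\<lambda>n. L1_dist P (real_cond_exp P (F n) h) h) \<longlonglongrightarrow> 0"
  using assms
proof (induction rule: integrable_induct)
  case (base A c)
  interpret prob_space P by (rule P)
  have A: "A \<in> sets G" using base(1) by (simp add: sets_restr_to_subalg[OF G])
  then have int: "integrable P (indicator A :: 'b \<Rightarrow> real)" using sets_G_P by (auto simp: less_top[symmetric])
  have "L1_dist P (real_cond_exp P (F n) (\<lambda>x. indicator A x *\<^sub>R c)) (\<lambda>x. indicator A x *\<^sub>R c)
      = \<bar>c\<bar> * L1_dist P (real_cond_exp P (F n) (indicator A)) (indicator A)" for n
  proof -
    interpret sigma_finite_subalgebra P "F n" by (rule sigma_finite_subalgebraI[OF P F])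
    let ?E = "real_cond_exp P (F n)"
    have "AE x in P. ?E (\<lambda>x. c * indicator A x) x = c * ?E (indicator A) x"
      by (rule real_cond_exp_cmult[OF int])
    then have "AE x in P. \<bar>?E (\<lambda>x. c * indicator A x) x - c * indicator A x\<bar> = \<bar>c\<bar> * \<bar>?E (indicator A) x - indicator A x\<bar>"
      by eventually_elim (simp flip: abs_mult right_diff_distrib)
    then have "L1_dist P (?E (\<lambda>x. c * indicator A x)) (\<lambda>x. c * indicator A x)
        = (\<integral>x. \<bar>c\<bar> * \<bar>?E (indicator A) x - indicator A x\<bar> \<partial>P)"
      unfolding L1_dist_def using A sets_G_P by (intro integral_cong_AE) auto
    then show ?thesis by (simp add: L1_dist_def mult.commute)
  qed
  then show ?case using tendsto_mult_right_zero[OF cond_exp_indicator[OF A], of "\<bar>c\<bar>"] by simp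
next
  case (add f g)
  show ?case
    using add(1,2) by (intro cond_exp_add_closure add(3,4)) (auto intro: integrable_from_subalg[OF G])
next
  case (lim f s)
  have int: "integrable P f" "\<And>r. integrable P (s r)"
    using lim by (auto intro: integrable_from_subalg[OF G])
  show ?case
  proof (rule cond_exp_closure[OF int lim(5)])
    have "(\<lambda>r. L1_dist P (s r) f) \<longlonglongrightarrow> (\<integral>x. 0 \<partial>P)"
      unfolding L1_dist_def
    proof (rule integral_dominated_convergence[where w = "\<lambda>x. 3 * norm (f x)"])
      have sp: "space (restr_to_subalg P G) = space P" by (rule space_restr_to_subalg)
      have "(\<lambda>r. \<bar>s r x - f x\<bar>) \<longlonglongrightarrow> 0" if "x \<in> space P" for x
        using lim(2)[of x] that by (intro tendsto_rabs_zero LIM_zero) (simp add: sp)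
      then show "AE x in P. (\<lambda>r. \<bar>s r x - f x\<bar>) \<longlonglongrightarrow> 0" by (rule AE_I2)
      have "norm \<bar>s r x - f x\<bar> \<le> 3 * norm (f x)" if "x \<in> space P" for r x
        using lim(3)[of x r] that by (simp add: sp)
      then show "AE x in P. norm \<bar>s r x - f x\<bar> \<le> 3 * norm (f x)" for r by (intro AE_I2)
    qed (use int in auto)
    then show "(\<lambda>r. L1_dist P (s r) f) \<longlonglongrightarrow> 0" by simp
  qed
qed

text \<open>By the tower property \<open>f\<close> may be replaced by its conditional expectation
  given \<open>G\<close>, and that function is \<open>G\<close>-measurable.\<close>

theorem levy_upward_L1:
  assumes f: "integrable P f"
  shows "(\<lambda>n. L1_dist P (real_cond_exp P (F n) f) (real_cond_exp P G f)) \<longlonglongrightarrow> 0"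
proof -
  interpret G: sigma_finite_subalgebra P G by (rule sigma_finite_subalgebraI[OF P G])
  let ?g = "real_cond_exp P G f"
  have "integrable (restr_to_subalg P G) ?g"
    using f by (intro integrable_in_subalg[OF G] G.real_cond_exp_int(1)) auto
  then have "(\<lambda>n. L1_dist P (real_cond_exp P (F n) ?g) ?g) \<longlonglongrightarrow> 0"
    by (rule cond_exp_converges_measurable)
  moreover have "L1_dist P (real_cond_exp P (F n) ?g) ?g = L1_dist P (real_cond_exp P (F n) f) ?g" for n
  proof -
    interpret sigma_finite_subalgebra P "F n" by (rule sigma_finite_subalgebraI[OF P F])
    have "subalgebra G (F n)" using F[of n] G sets_F_G by (simp add: subalgebra_def)
    then have "AE x in P. real_cond_exp P (F n) ?g x = real_cond_exp P (F n) f x"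
      by (intro real_cond_exp_nested_subalg[OF G _ f])
    then show ?thesis unfolding L1_dist_def by (intro integral_cong_AE) auto
  qed
  ultimately show ?thesis by simp
qed

end

section \<open>Continuity and zeros of the penalty\<close>

lemma interval_modulus:
  fixes \<beta> :: "real \<Rightarrow> real"
  assumes \<beta>: "continuous_on UNIV \<beta>" and "e > 0"
  shows "\<exists>C\<ge>0. \<forall>x\<in>{-K..K}. \<forall>y\<in>{-K..K}. \<bar>\<beta> x - \<beta> y\<bar> \<le> e + C * \<bar>x - y\<bar>"
proof -
  have cont: "continuous_on {-K..K} \<beta>" using \<beta> continuous_on_subset by blast
  then have "uniformly_continuous_on {-K..K} \<beta>" by (intro compact_uniformly_continuous) auto
  then obtain d where d: "d > 0" "\<forall>x\<in>{-K..K}. \<forall>y\<in>{-K..K}. dist y x < d \<longrightarrow> dist (\<beta> y) (\<beta> x) < e"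
    using \<open>e > 0\<close> unfolding uniformly_continuous_on_def by blast
  have "bounded (\<beta> ` {-K..K})"
    using compact_continuous_image[OF cont compact_Icc] compact_imp_bounded by blast
  then obtain A where A: "\<And>x. x \<in> {-K..K} \<Longrightarrow> \<bar>\<beta> x\<bar> \<le> A"
    unfolding bounded_iff by (metis imageI real_norm_def)
  \<comment> \<open>Arguments at least \<open>d\<close> apart are covered by the linear term, since
    \<beta> varies by at most twice its bound \<open>A\<close>.\<close>
  let ?C = "2 * max A 0 / d"
  have "\<bar>\<beta> x - \<beta> y\<bar> \<le> e + ?C * \<bar>x - y\<bar>" if "x \<in> {-K..K}" "y \<in> {-K..K}" for x y
  proof (cases "\<bar>x - y\<bar> < d")
    case True
    then have "\<bar>\<beta> x - \<beta> y\<bar> < e" using d(2) that by (auto simp: dist_real_def)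
    moreover have "0 \<le> ?C * \<bar>x - y\<bar>" using d(1) by simp
    ultimately show ?thesis by linarith
  next
    case False
    then have "?C * d \<le> ?C * \<bar>x - y\<bar>" using d(1) by (intro mult_left_mono) auto
    moreover have "?C * d = 2 * max A 0" using d(1) by simp
    ultimately show ?thesis using A[OF that(1)] A[OF that(2)] \<open>e > 0\<close> by linarith
  qed
  then show ?thesis using d(1) by (intro exI[of _ ?C]) auto
qed

lemma cond_exp_bounded:
  assumes "prob_space P" "subalgebra P F" and f: "f \<in> borel_measurable P"
    and K: "\<And>x. x \<in> space P \<Longrightarrow> \<bar>f x\<bar> \<le> K"
  shows "AE x in P. real_cond_exp P F f x \<in> {-K..K}" "integrable P f"
proof -
  interpret sigma_finite_subalgebra P F by (rule sigma_finite_subalgebraI[OF assms(1,2)])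
  interpret prob_space P by fact
  show f': "integrable P f" using f K by (intro integrable_const_bound[where B = K]) auto
  have "AE x in P. real_cond_exp P F f x \<le> K" using K by (intro real_cond_exp_le_c f') (auto simp: abs_le_iff)
  moreover have "AE x in P. real_cond_exp P F f x \<ge> - K"
    using K by (intro real_cond_exp_ge_c f') (force simp: abs_le_iff)
  ultimately show "AE x in P. real_cond_exp P F f x \<in> {-K..K}" by eventually_elim auto
qed

lemma penalty_integrable:
  fixes \<beta> :: "real \<Rightarrow> real"
  assumes "prob_space P" "subalgebra P F" "f \<in> borel_measurable P"
    "\<And>x. x \<in> space P \<Longrightarrow> \<bar>f x\<bar> \<le> K" and \<beta>: "continuous_on UNIV \<beta>"
  shows "integrable P (\<lambda>x. \<beta> (real_cond_exp P F f x))"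
proof -
  interpret prob_space P by fact
  have [measurable]: "\<beta> \<in> borel_measurable borel" by (rule borel_measurable_continuous_onI[OF \<beta>])
  have "bounded (\<beta> ` {-K..K})"
    using compact_continuous_image[OF continuous_on_subset[OF \<beta>] compact_Icc] compact_imp_bounded by blast
  then obtain A where A: "\<And>x. x \<in> {-K..K} \<Longrightarrow> norm (\<beta> x) \<le> A"
    unfolding bounded_iff by (metis imageI)
  show ?thesis
    using cond_exp_bounded(1)[OF assms(1-4)] A by (intro integrable_const_bound[where B = A]) auto
qed

text \<open>Functions and algebras move together: contraction replaces \<open>f n\<close> by
  \<open>g\<close> under \<open>F n\<close>, and \<open>levy\<close> treats the fixed function
  \<open>g\<close>. The estimate e / 2 + C * |x - y| of \<open>interval_modulus\<close> then carries
  L1 convergence through the merely continuous \<beta>.\<close>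

lemma penalty_tendsto:
  fixes \<beta> :: "real \<Rightarrow> real"
  assumes P: "prob_space P" and F: "\<And>n. subalgebra P (F n)" and G: "subalgebra P G"
    and levy: "\<And>f. integrable P f \<Longrightarrow> (\<lambda>n. L1_dist P (real_cond_exp P (F n) f) (real_cond_exp P G f)) \<longlonglongrightarrow> 0"
    and f: "\<And>n. f n \<in> borel_measurable P" and K: "\<And>n x. x \<in> space P \<Longrightarrow> \<bar>f n x\<bar> \<le> K"
    and lim: "\<And>x. x \<in> space P \<Longrightarrow> (\<lambda>n. f n x) \<longlonglongrightarrow> g x"
    and \<beta>: "continuous_on UNIV \<beta>"
  shows "(\<lambda>n. \<integral>x. \<beta> (real_cond_exp P (F n) (f n) x) \<partial>P) \<longlonglongrightarrow> (\<integral>x. \<beta> (real_cond_exp P G g x) \<partial>P)"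
proof -
  interpret prob_space P by (rule P)
  have g: "g \<in> borel_measurable P" using f lim by (rule borel_measurable_LIMSEQ_real[rotated])
  have gK: "\<bar>g x\<bar> \<le> K" if "x \<in> space P" for x
    using LIMSEQ_le_const2[OF tendsto_rabs[OF lim[OF that]]] K[OF that] by blast
  have fi: "AE x in P. real_cond_exp P (F n) (f n) x \<in> {-K..K}" "integrable P (f n)" for n
    by (rule cond_exp_bounded[OF P F f K], assumption)+
  have gi: "AE x in P. real_cond_exp P G g x \<in> {-K..K}" "integrable P g"
    by (rule cond_exp_bounded[OF P G g gK], assumption)+
  let ?E = "\<lambda>n. real_cond_exp P (F n) (f n)" and ?Eg = "real_cond_exp P G g"
  have E_int: "integrable P (real_cond_exp P (F n) h)" if "integrable P h" for n h
    by (rule sigma_finite_subalgebra.real_cond_exp_int(1)[OF sigma_finite_subalgebraI[OF P F] that])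
  have Eg_int: "integrable P ?Eg"
    by (rule sigma_finite_subalgebra.real_cond_exp_int(1)[OF sigma_finite_subalgebraI[OF P G] gi(2)])
  have "(\<lambda>n. L1_dist P (f n) g) \<longlonglongrightarrow> (\<integral>x. 0 \<partial>P)"
    unfolding L1_dist_def
  proof (rule integral_dominated_convergence[where w = "\<lambda>_. 2 * K"])
    have "(\<lambda>n. \<bar>f n x - g x\<bar>) \<longlonglongrightarrow> 0" if "x \<in> space P" for x
      using lim[OF that] by (intro tendsto_rabs_zero LIM_zero)
    then show "AE x in P. (\<lambda>n. \<bar>f n x - g x\<bar>) \<longlonglongrightarrow> 0" by (rule AE_I2)
    show "AE x in P. norm \<bar>f n x - g x\<bar> \<le> 2 * K" for n
    proof (rule AE_I2)
      fix x assume "x \<in> space P"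
      then show "norm \<bar>f n x - g x\<bar> \<le> 2 * K" using K[of x n] gK[of x] by auto
    qed
  qed (use f g in auto)
  then have f_g: "(\<lambda>n. L1_dist P (f n) g) \<longlonglongrightarrow> 0" by simp
  have D: "(\<lambda>n. L1_dist P (?E n) ?Eg) \<longlonglongrightarrow> 0"
  proof (rule tendsto_sandwich[OF always_eventually always_eventually tendsto_const])
    show "(\<lambda>n. L1_dist P (f n) g + L1_dist P (real_cond_exp P (F n) g) ?Eg) \<longlonglongrightarrow> 0"
      using tendsto_add[OF f_g levy[OF gi(2)]] by simp
    show "\<forall>n. 0 \<le> L1_dist P (?E n) ?Eg" by (simp add: L1_dist_nonneg)
    show "\<forall>n. L1_dist P (?E n) ?Eg \<le> L1_dist P (f n) g + L1_dist P (real_cond_exp P (F n) g) ?Eg"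
      using L1_dist_triangle[OF E_int[OF fi(2)] E_int[OF gi(2)] Eg_int] L1_dist_cond_exp[OF P F fi(2) gi(2)]
      by (meson add_right_mono order_trans)
  qed
  have int: "integrable P (\<lambda>x. \<beta> (?E n x))" for n by (rule penalty_integrable[OF P F f K \<beta>])
  have int_g: "integrable P (\<lambda>x. \<beta> (?Eg x))" by (rule penalty_integrable[OF P G g gK \<beta>])
  show ?thesis
  proof (rule LIMSEQ_I)
    fix e :: real assume "e > 0"
    then have "e / 2 > 0" by simp
    then obtain C where C: "C \<ge> 0" "\<And>x y. x \<in> {-K..K} \<Longrightarrow> y \<in> {-K..K} \<Longrightarrow> \<bar>\<beta> x - \<beta> y\<bar> \<le> e / 2 + C * \<bar>x - y\<bar>"
      using interval_modulus[OF \<beta>] by metis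
    have "e / 2 / (C + 1) > 0" using \<open>e > 0\<close> C(1) by simp
    from LIMSEQ_D[OF D this] obtain n0 where n0: "\<And>n. n \<ge> n0 \<Longrightarrow> L1_dist P (?E n) ?Eg < e / 2 / (C + 1)"
      by (auto simp: L1_dist_nonneg)
    have "norm ((\<integral>x. \<beta> (?E n x) \<partial>P) - (\<integral>x. \<beta> (?Eg x) \<partial>P)) < e" if "n \<ge> n0" for n
    proof -
      have dI: "integrable P (\<lambda>x. \<bar>?E n x - ?Eg x\<bar>)"
        by (intro integrable_abs Bochner_Integration.integrable_diff E_int fi(2) Eg_int)
      have "\<bar>(\<integral>x. \<beta> (?E n x) \<partial>P) - (\<integral>x. \<beta> (?Eg x) \<partial>P)\<bar> = \<bar>\<integral>x. \<beta> (?E n x) - \<beta> (?Eg x) \<partial>P\<bar>"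
        by (simp add: int int_g)
      also have "\<dots> \<le> (\<integral>x. \<bar>\<beta> (?E n x) - \<beta> (?Eg x)\<bar> \<partial>P)" by (rule integral_abs_bound)
      also have "\<dots> \<le> (\<integral>x. e / 2 + C * \<bar>?E n x - ?Eg x\<bar> \<partial>P)"
      proof (rule integral_mono_AE)
        show "AE x in P. \<bar>\<beta> (?E n x) - \<beta> (?Eg x)\<bar> \<le> e / 2 + C * \<bar>?E n x - ?Eg x\<bar>"
          using fi(1)[of n] gi(1) by eventually_elim (rule C(2))
      qed (use int int_g dI in auto)
      also have "\<dots> = e / 2 + C * L1_dist P (?E n) ?Eg"
        using dI by (simp add: L1_dist_def prob_space)
      also have "\<dots> \<le> e / 2 + (C + 1) * L1_dist P (?E n) ?Eg"
        by (simp add: distrib_right L1_dist_nonneg)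
      also have "\<dots> < e / 2 + (C + 1) * (e / 2 / (C + 1))"
        using mult_strict_left_mono[OF n0[OF that], of "C + 1"] C(1) by simp
      also have "\<dots> = e" using C(1) by (simp add: field_simps)
      finally show ?thesis by simp
    qed
    then show "\<exists>n0. \<forall>n\<ge>n0. norm ((\<integral>x. \<beta> (?E n x) \<partial>P) - (\<integral>x. \<beta> (?Eg x) \<partial>P)) < e" by blast
  qed
qed

lemma penalty_zero_iff:
  fixes \<beta> :: "real \<Rightarrow> real"
  assumes "prob_space P" "subalgebra P F" "f \<in> borel_measurable P"
    "\<And>x. x \<in> space P \<Longrightarrow> \<bar>f x\<bar> \<le> K" and \<beta>: "continuous_on UNIV \<beta>"
    and \<beta>0: "\<And>x. x \<le> 0 \<Longrightarrow> \<beta> x = 0" and \<beta>pos: "\<And>x. x > 0 \<Longrightarrow> \<beta> x > 0"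
  shows "(\<integral>x. \<beta> (real_cond_exp P F f x) \<partial>P) = 0 \<longleftrightarrow> (AE x in P. real_cond_exp P F f x \<le> 0)"
proof -
  have nn: "\<beta> x \<ge> 0" for x using \<beta>0[of x] \<beta>pos[of x] by (cases "x \<le> 0") auto
  have "\<beta> x = 0 \<longleftrightarrow> x \<le> 0" for x using \<beta>0[of x] \<beta>pos[of x] by (cases "x \<le> 0") auto
  then show ?thesis
    using integral_nonneg_eq_0_iff_AE[OF penalty_integrable[OF assms(1-5)]] nn by simp
qed

section \<open>Convergence of the penalised problems\<close>

text \<open>The pattern of Gamma-convergence: a near-minimiser of the limit problem bounds the
  infima from above, and near-minimisers along a subsequence accumulate at a competitor for the
  limit problem.\<close>

lemma INF_tendsto:
  fixes F :: "nat \<Rightarrow> 'w \<Rightarrow> real" and G :: "'w \<Rightarrow> real"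
  assumes upper: "\<And>w. w \<in> W \<Longrightarrow> (\<lambda>n. F n w) \<longlonglongrightarrow> G w"
    and lower: "\<And>(r :: nat \<Rightarrow> nat) X. strict_mono r \<Longrightarrow> (\<And>n. X n \<in> W) \<Longrightarrow>
      \<exists>(s :: nat \<Rightarrow> nat) w. strict_mono s \<and> w \<in> W \<and> (\<lambda>n. F (r (s n)) (X (s n))) \<longlonglongrightarrow> G w"
  shows "(\<lambda>n. INF w\<in>W. ereal (F n w)) \<longlonglongrightarrow> (INF w\<in>W. ereal (G w))"
proof (rule order_tendstoI)
  fix a assume "a > (INF w\<in>W. ereal (G w))"
  then obtain w where w: "w \<in> W" "ereal (G w) < a" by (auto simp: INF_less_iff)
  have "(\<lambda>n. ereal (F n w)) \<longlonglongrightarrow> ereal (G w)" using upper[OF w(1)] by simp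
  from order_tendstoD(2)[OF this w(2)]
  show "\<forall>\<^sub>F n in sequentially. (INF w\<in>W. ereal (F n w)) < a"
    by eventually_elim (use w(1) in \<open>auto simp: INF_less_iff\<close>)
next
  fix a assume a: "a < (INF w\<in>W. ereal (G w))"
  show "\<forall>\<^sub>F n in sequentially. a < (INF w\<in>W. ereal (F n w))"
  proof (rule ccontr)
    assume "\<not> ?thesis"
    then have "infinite {n. (INF w\<in>W. ereal (F n w)) \<le> a}"
      by (simp add: not_eventually frequently_cofinite[symmetric] cofinite_eq_sequentially not_less)
    then obtain r :: "nat \<Rightarrow> nat" where r: "strict_mono r" "\<And>n. (INF w\<in>W. ereal (F (r n) w)) \<le> a"
      using infinite_enumerate by blast
    obtain b where b: "a < b" "b < (INF w\<in>W. ereal (G w))" using dense[OF a] by blast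
    have "\<exists>w\<in>W. ereal (F (r n) w) < b" for n
      using order_le_less_trans[OF r(2)[of n] b(1)] by (simp add: INF_less_iff)
    then obtain X where X: "\<And>n. X n \<in> W" "\<And>n. ereal (F (r n) (X n)) < b" by metis
    obtain s w where s: "w \<in> W" "(\<lambda>n. F (r (s n)) (X (s n))) \<longlonglongrightarrow> G w"
      using lower[of r X, OF r(1) X(1)] by blast
    have "ereal (G w) \<le> b"
    proof (rule LIMSEQ_le_const2)
      show "(\<lambda>n. ereal (F (r (s n)) (X (s n)))) \<longlonglongrightarrow> ereal (G w)" using s(2) by simp
    qed (use X(2) in \<open>auto intro: less_imp_le\<close>)
    then have "(INF w\<in>W. ereal (G w)) \<le> b" by (rule INF_lower2[OF s(1)])
    then show False using b(2) by simp
  qed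
qed

text \<open>Both sides may be \<open>\<infinity>\<close>, in case no strategy has penalty zero.\<close>

lemma penalty_method_tendsto:
  fixes c pen :: "'w \<Rightarrow> real"
  assumes pen: "\<And>w. w \<in> W \<Longrightarrow> pen w \<ge> 0" and c: "\<And>w. w \<in> W \<Longrightarrow> \<bar>c w\<bar> \<le> B"
    and compact: "\<And>X. (\<And>n. X n \<in> W) \<Longrightarrow> \<exists>(s :: nat \<Rightarrow> nat) w. strict_mono s \<and> w \<in> W \<and>
      (\<lambda>n. c (X (s n))) \<longlonglongrightarrow> c w \<and> (\<lambda>n. pen (X (s n))) \<longlonglongrightarrow> pen w"
  shows "(\<lambda>k. INF w\<in>W. ereal (c w + real k * pen w)) \<longlonglongrightarrow> (INF w\<in>{w\<in>W. pen w = 0}. ereal (c w))"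
    (is "?v \<longlonglongrightarrow> ?x")
proof (rule order_tendstoI)
  have "?v k \<le> ?x" for k
    by (rule INF_greatest) (auto intro!: INF_lower2)
  then show "\<forall>\<^sub>F k in sequentially. ?v k < a" if "a > ?x" for a
    using that order_le_less_trans by (intro always_eventually) blast
next
  fix a assume a: "a < ?x"
  show "\<forall>\<^sub>F k in sequentially. a < ?v k"
  proof (rule ccontr)
    assume "\<not> ?thesis"
    then have "infinite {n. ?v n \<le> a}"
      by (simp add: not_eventually frequently_cofinite[symmetric] cofinite_eq_sequentially not_less)
    then obtain r :: "nat \<Rightarrow> nat" where r: "strict_mono r" "\<And>n. ?v (r n) \<le> a"
      using infinite_enumerate by blast
    obtain b' where b': "a < b'" "b' < ?x" using dense[OF a] by blast
    then obtain b where b: "b' = ereal b" by (cases b') auto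
    have "\<exists>w\<in>W. ereal (c w + real (r n) * pen w) < ereal b" for n
      using order_le_less_trans[OF r(2)[of n] b'(1)] by (simp add: INF_less_iff b)
    then obtain X where X: "\<And>n. X n \<in> W" "\<And>n. c (X n) + real (r n) * pen (X n) < b"
      by (metis less_ereal.simps(1))
    obtain s :: "nat \<Rightarrow> nat" and w where s: "strict_mono s" "w \<in> W" "(\<lambda>n. c (X (s n))) \<longlonglongrightarrow> c w"
      "(\<lambda>n. pen (X (s n))) \<longlonglongrightarrow> pen w"
      using compact[of X, OF X(1)] by blast
    have "c (X n) \<le> b" for n
    proof -
      have "0 \<le> real (r n) * pen (X n)" using pen[OF X(1)] by simp
      then show ?thesis using X(2)[of n] by linarith
    qed
    then have "c w \<le> b" using LIMSEQ_le_const2[OF s(3)] by blast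
    \<comment> \<open>Otherwise the penalty stays above half its limit along the subsequence; once
      its weight is large enough, the penalty term exceeds b + B, which contradicts the lower bound
      -B on \<open>c\<close>.\<close>
    moreover have "pen w = 0"
    proof (rule ccontr)
      assume "pen w \<noteq> 0"
      then have "pen w > 0" using pen[OF s(2)] by simp
      then have "\<forall>\<^sub>F n in sequentially. pen w / 2 < pen (X (s n))"
        by (intro order_tendstoD(1)[OF s(4)]) simp
      then obtain n0 where n0: "\<And>n. n \<ge> n0 \<Longrightarrow> pen w / 2 < pen (X (s n))"
        by (auto simp: eventually_sequentially)
      obtain m where m: "2 * (b + B) / pen w < real m" using reals_Archimedean2 by blast
      define n where "n = max n0 m"
      have "m \<le> r (s n)"
        using seq_suble[OF s(1), of n] seq_suble[OF r(1), of "s n"] unfolding n_def by linarith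
      then have "real m * (pen w / 2) \<le> real (r (s n)) * pen (X (s n))"
        using n0[of n] \<open>pen w > 0\<close> by (intro mult_mono) (auto simp: n_def)
      moreover have "b + B < real m * (pen w / 2)" using m \<open>pen w > 0\<close> by (simp add: field_simps)
      ultimately show False using X(2)[of "s n"] c[OF X(1), of "s n"] by linarith
    qed
    ultimately have "?x \<le> ereal b" using s(2) by (intro INF_lower2[of w]) auto
    then show False using b'(2) b by simp
  qed
qed

text \<open>Isolates what the limits need from the partitions. A constant sequence qualifies as
  well, so one continuity result also serves the limit in the penalty and the density of
  networks.\<close>

definition algebra_limit :: "'b measure set \<Rightarrow> (nat \<Rightarrow> 'b measure) \<Rightarrow> 'b measure \<Rightarrow> bool" where
  "algebra_limit \<P> F G \<longleftrightarrow> (\<forall>P\<in>\<P>. (\<forall>n. subalgebra P (F n)) \<and> subalgebra P G \<and>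
     (\<forall>f. integrable P f \<longrightarrow> (\<lambda>n. L1_dist P (real_cond_exp P (F n) f) (real_cond_exp P G f)) \<longlonglongrightarrow> 0))"

lemma algebra_limit_const: "(\<And>P. P \<in> \<P> \<Longrightarrow> subalgebra P G) \<Longrightarrow> algebra_limit \<P> (\<lambda>_. G) G"
  by (simp add: algebra_limit_def L1_dist_def)

lemma algebra_limit_subseq: "algebra_limit \<P> F G \<Longrightarrow> strict_mono r \<Longrightarrow> algebra_limit \<P> (\<lambda>n. F (r n)) G"
  unfolding algebra_limit_def
proof (intro ballI conjI allI impI)
  assume F: "\<forall>P\<in>\<P>. (\<forall>n. subalgebra P (F n)) \<and> subalgebra P G \<and>
     (\<forall>f. integrable P f \<longrightarrow> (\<lambda>n. L1_dist P (real_cond_exp P (F n) f) (real_cond_exp P G f)) \<longlonglongrightarrow> 0)"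
    and r: "strict_mono r"
  fix P assume P: "P \<in> \<P>"
  show "subalgebra P (F (r n))" "subalgebra P G" for n using F P by auto
  fix f :: "_ \<Rightarrow> real" assume "integrable P f"
  then have "(\<lambda>n. L1_dist P (real_cond_exp P (F n) f) (real_cond_exp P G f)) \<longlonglongrightarrow> 0" using F P by blast
  from LIMSEQ_subseq_LIMSEQ[OF this r]
  show "(\<lambda>n. L1_dist P (real_cond_exp P (F (r n)) f) (real_cond_exp P G f)) \<longlonglongrightarrow> 0"
    by (simp add: comp_def)
qed

section \<open>The algebras of terminal prices and of nested partitions\<close>

lemma space_prob_measure: "P \<in> prob_measures M \<Longrightarrow> space P = Omega M"
  using sets_eq_imp_space_eq[of P "Omega_borel M"] by (simp add: prob_measures_def space_Omega_borel)

lemma measurable_prob_measure: "P \<in> prob_measures M \<Longrightarrow> measurable P N = measurable (Omega_borel M) N"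
  by (intro measurable_cong_sets) (auto simp: prob_measures_def)

lemma subalgebra_terminal:
  assumes P: "P \<in> prob_measures M"
  shows "subalgebra P (terminal_algebra M)"
proof -
  have "price M (horizon M) \<in> P \<rightarrow>\<^sub>M borel"
    unfolding measurable_prob_measure[OF P] by (rule price_measurable) simp
  from sets_image_in_sets[OF space_prob_measure[OF P] this]
  show ?thesis by (simp add: subalgebra_def terminal_algebra_def space_prob_measure[OF P])
qed

lemma price_measurable_sigma:
  assumes M: "valid_market M" and N: "space N = Omega M"
    and H: "H \<subseteq> Pow (state_space M)"
    and vimage: "\<And>A. A \<in> H \<Longrightarrow> price M (horizon M) -` A \<inter> Omega M \<in> sets N"
  shows "price M (horizon M) \<in> N \<rightarrow>\<^sub>M sigma (state_space M) H"
  by (rule measurable_measure_of[OF H]) (use price_in_state_space[OF M] N vimage in auto)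

lemma partition_sets:
  assumes "A \<in> H" "H \<subseteq> Pow (state_space M)" "valid_market M"
  shows "price M (horizon M) -` A \<inter> Omega M \<in> sets (partition_algebra M H)"
proof -
  have "price M (horizon M) \<in> Omega M \<rightarrow> space (sigma (state_space M) H)"
    using price_in_state_space[OF assms(3)] by (auto simp: assms(2) space_measure_of)
  then show ?thesis
    unfolding partition_algebra_def using assms by (intro in_vimage_algebra) auto
qed

lemma subalgebra_partition:
  assumes M: "valid_market M" and P: "P \<in> prob_measures M"
    and H: "partition_on (state_space M) H" "H \<subseteq> sets borel"
  shows "subalgebra P (partition_algebra M H)"
proof -
  have "H \<subseteq> Pow (state_space M)" using H(1) by (auto simp: partition_on_def)
  moreover have "price M (horizon M) -` A \<inter> Omega M \<in> sets P" if "A \<in> H" for A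
  proof -
    have "price M (horizon M) \<in> P \<rightarrow>\<^sub>M borel"
      unfolding measurable_prob_measure[OF P] by (rule price_measurable) simp
    from measurable_sets[OF this, of A] show ?thesis using that H(2) space_prob_measure[OF P] by auto
  qed
  ultimately have "price M (horizon M) \<in> P \<rightarrow>\<^sub>M sigma (state_space M) H"
    by (intro price_measurable_sigma[OF M space_prob_measure[OF P]])
  then show ?thesis
    unfolding subalgebra_def partition_algebra_def
    using sets_image_in_sets[of P "Omega M" "price M (horizon M)"] space_prob_measure[OF P] by simp
qed

lemma partition_algebra_mono:
  assumes M: "valid_market M" and fin: "finite H'" and ref: "refines (state_space M) H' H"
  shows "sets (partition_algebra M H) \<subseteq> sets (partition_algebra M H')"
proof -
  have part: "partition_on (state_space M) H'" "partition_on (state_space M) H"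
    and sub: "\<And>X. X \<in> H' \<Longrightarrow> \<exists>Y\<in>H. X \<subseteq> Y"
    using ref by (auto simp: refines_def)
  have Pow: "H \<subseteq> Pow (state_space M)" "H' \<subseteq> Pow (state_space M)"
    using part by (auto simp: partition_on_def)
  have sp: "space (partition_algebra M H') = Omega M" by (simp add: partition_algebra_def)
  have "price M (horizon M) -` A \<inter> Omega M \<in> sets (partition_algebra M H')" if A: "A \<in> H" for A
  proof -
    \<comment> \<open>A fine block meeting \<open>A\<close> lies inside some coarse block, which
      must be \<open>A\<close> by disjointness.\<close>
    have "A = \<Union>{X \<in> H'. X \<subseteq> A}"
    proof (intro equalityI subsetI)
      fix v assume v: "v \<in> A"
      then have "v \<in> \<Union>H'" using A Pow(1) part(1) by (auto simp: partition_on_def)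
      then obtain X where X: "X \<in> H'" "v \<in> X" by blast
      then obtain Y where Y: "Y \<in> H" "X \<subseteq> Y" using sub by blast
      then have "Y = A" using part(2) A v X(2) unfolding partition_on_def disjoint_def by blast
      then show "v \<in> \<Union>{X \<in> H'. X \<subseteq> A}" using X Y by blast
    qed blast
    then have "price M (horizon M) -` A \<inter> Omega M = (\<Union>X\<in>{X \<in> H'. X \<subseteq> A}. price M (horizon M) -` X \<inter> Omega M)"
      by blast
    moreover have "(\<Union>X\<in>{X \<in> H'. X \<subseteq> A}. price M (horizon M) -` X \<inter> Omega M) \<in> sets (partition_algebra M H')"
      using fin partition_sets[OF _ Pow(2) M] by (intro sets.finite_UN) auto
    ultimately show ?thesis by simp
  qed
  from price_measurable_sigma[OF M sp Pow(1) this]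
  show ?thesis
    unfolding partition_algebra_def[of M H] by (rule sets_image_in_sets[OF sp])
qed

lemma algebra_limit_partitions:
  assumes M: "valid_market M" and \<P>: "\<P> \<subseteq> prob_measures M" and H: "nested_partitions M H"
    and gen: "sets (terminal_algebra M) = sigma_sets (Omega M) (\<Union>i. sets (partition_algebra M (H i)))"
  shows "algebra_limit \<P> (\<lambda>i. partition_algebra M (H i)) (terminal_algebra M)"
  unfolding algebra_limit_def
proof (intro ballI conjI allI impI)
  fix P assume "P \<in> \<P>"
  then have P: "P \<in> prob_measures M" using \<P> by blast
  show sub: "subalgebra P (partition_algebra M (H n))" for n
    using H by (intro subalgebra_partition[OF M P]) (auto simp: nested_partitions_def)
  show terminal: "subalgebra P (terminal_algebra M)" by (rule subalgebra_terminal[OF P])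
  fix f :: "'a path \<Rightarrow> real" assume f: "integrable P f"
  show "(\<lambda>n. L1_dist P (real_cond_exp P (partition_algebra M (H n)) f)
      (real_cond_exp P (terminal_algebra M) f)) \<longlonglongrightarrow> 0"
  proof (rule levy_upward_L1[OF _ sub _ terminal _ f])
    show "prob_space P" using P by (simp add: prob_measures_def)
    show "sets (partition_algebra M (H n)) \<subseteq> sets (partition_algebra M (H (Suc n)))" for n
      using H by (intro partition_algebra_mono[OF M]) (auto simp: nested_partitions_def)
    show "sets (terminal_algebra M) = sigma_sets (space P) (\<Union>n. sets (partition_algebra M (H n)))"
      using gen by (simp add: space_prob_measure[OF P])
  qed
qed

section \<open>The penalised problems of the market\<close>

definition total_penalty :: "('a::finite) market \<Rightarrow> 'a path measure set \<Rightarrow> (real \<Rightarrow> real) \<Rightarrow>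
    ('a path \<Rightarrow> real) \<Rightarrow> 'a path measure \<Rightarrow> real \<times> 'a strategy \<Rightarrow> real" where
  "total_penalty M \<P> \<beta> \<Phi> G w =
     (\<Sum>P\<in>\<P>. \<integral>x. \<beta> (real_cond_exp P G (\<lambda>y. \<Phi> y - wealth M (fst w) (snd w) y) x) \<partial>P)"

lemma penalised_value_alt:
  "penalised_value M \<P> \<beta> W k \<Phi> G = (INF w\<in>W. ereal (fst w + real k * total_penalty M \<P> \<beta> \<Phi> G w))"
  unfolding penalised_value_def total_penalty_def by (simp add: case_prod_unfold)

context
  fixes M :: "('a::finite) market" and \<P> :: "'a path measure set" and \<beta> :: "real \<Rightarrow> real"
    and B L :: real and \<Phi> :: "'a path \<Rightarrow> real"
  assumes M: "valid_market M" and B: "0 < B" and L: "0 < L"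
    and costs: "continuous_cost M (trans_cost M)" "continuous_cost M (liq_cost M)"
      "continuous_cost M (borrow_cost M)"
    and \<P>: "finite \<P>" "\<P> \<subseteq> prob_measures M"
    and \<beta>: "continuous_on UNIV \<beta>"
    and \<beta>_zero: "\<And>x. x \<le> 0 \<Longrightarrow> \<beta> x = 0" and \<beta>_pos: "\<And>x. x > 0 \<Longrightarrow> \<beta> x > 0"
    and \<Phi>: "\<Phi> \<in> borel_measurable (Omega_borel M)" and \<Phi>_bound: "\<And>x. x \<in> Omega M \<Longrightarrow> \<bar>\<Phi> x\<bar> \<le> B"
begin

lemma shortfall:
  obtains K where "\<And>c \<Delta> x. (c, \<Delta>) \<in> admissible M B L \<Longrightarrow> x \<in> Omega M \<Longrightarrow> \<bar>\<Phi> x - wealth M c \<Delta> x\<bar> \<le> K"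
proof -
  obtain K where K: "\<And>c \<Delta> x. (c, \<Delta>) \<in> admissible M B L \<Longrightarrow> x \<in> Omega M \<Longrightarrow> \<bar>wealth M c \<Delta> x\<bar> \<le> K"
    using wealth_bounded[OF M less_imp_le[OF B] costs] by metis
  show ?thesis
  proof (rule that[of "B + K"])
    fix c \<Delta> x assume "(c, \<Delta>) \<in> admissible M B L" "x \<in> Omega M"
    then show "\<bar>\<Phi> x - wealth M c \<Delta> x\<bar> \<le> B + K" using K[of c \<Delta> x] \<Phi>_bound[of x] by linarith
  qed
qed

lemma shortfall_measurable:
  "(c, \<Delta>) \<in> admissible M B L \<Longrightarrow> P \<in> \<P> \<Longrightarrow> (\<lambda>x. \<Phi> x - wealth M c \<Delta> x) \<in> borel_measurable P"
proof (rule borel_measurable_diff)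
  assume adm: "(c, \<Delta>) \<in> admissible M B L" and "P \<in> \<P>"
  then have "P \<in> prob_measures M" using \<P> by blast
  note ms = measurable_prob_measure[OF this]
  show "\<Phi> \<in> borel_measurable P" unfolding ms by (rule \<Phi>)
  show "wealth M c \<Delta> \<in> borel_measurable P" unfolding ms by (rule wealth_measurable[OF M adm])
qed

lemma total_penalty_tendsto:
  assumes F: "algebra_limit \<P> F G" and adm: "\<And>n. (c n, X n) \<in> admissible M B L"
    and c: "c \<longlonglongrightarrow> c'" and X: "strategy_limit M X \<Delta>"
  shows "(\<lambda>n. total_penalty M \<P> \<beta> \<Phi> (F n) (c n, X n)) \<longlonglongrightarrow> total_penalty M \<P> \<beta> \<Phi> G (c', \<Delta>)"
proof -
  obtain K where K: "\<And>c \<Delta> x. (c, \<Delta>) \<in> admissible M B L \<Longrightarrow> x \<in> Omega M \<Longrightarrow> \<bar>\<Phi> x - wealth M c \<Delta> x\<bar> \<le> K"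
    using shortfall by blast
  show ?thesis
    unfolding total_penalty_def fst_conv snd_conv
  proof (rule tendsto_sum)
    fix P assume P: "P \<in> \<P>"
    then have P': "P \<in> prob_measures M" using \<P> by blast
    note sp = space_prob_measure[OF P']
    show "(\<lambda>n. \<integral>x. \<beta> (real_cond_exp P (F n) (\<lambda>y. \<Phi> y - wealth M (c n) (X n) y) x) \<partial>P)
      \<longlonglongrightarrow> (\<integral>x. \<beta> (real_cond_exp P G (\<lambda>y. \<Phi> y - wealth M c' \<Delta> y) x) \<partial>P)"
    proof (rule penalty_tendsto[where K = K, OF _ _ _ _ _ _ _ \<beta>])
      show "prob_space P" using P' by (simp add: prob_measures_def)
      show "subalgebra P (F n)" "subalgebra P G" for n using F P by (auto simp: algebra_limit_def)
      show "(\<lambda>n. L1_dist P (real_cond_exp P (F n) f) (real_cond_exp P G f)) \<longlonglongrightarrow> 0"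
        if "integrable P f" for f using F P that by (auto simp: algebra_limit_def)
      show "(\<lambda>x. \<Phi> x - wealth M (c n) (X n) x) \<in> borel_measurable P" for n
        by (rule shortfall_measurable[OF adm P])
      show "\<bar>\<Phi> x - wealth M (c n) (X n) x\<bar> \<le> K" if "x \<in> space P" for n x
        using K[OF adm] that sp by simp
      show "(\<lambda>n. \<Phi> x - wealth M (c n) (X n) x) \<longlonglongrightarrow> \<Phi> x - wealth M c' \<Delta> x" if "x \<in> space P" for x
        using that sp by (intro tendsto_diff tendsto_const wealth_tendsto costs c X) simp
    qed
  qed
qed

text \<open>Compactness of the strategies supplies the accumulation points that
  \<open>INF_tendsto\<close> asks for, and joint continuity of the penalty identifies the
  limits.\<close>

lemma penalised_price_tendsto:
  assumes F: "algebra_limit \<P> F G"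
  shows "(\<lambda>n. penalised_price M \<P> \<beta> B L k \<Phi> (F n)) \<longlonglongrightarrow> penalised_price M \<P> \<beta> B L k \<Phi> G"
  unfolding penalised_price_def penalised_value_alt
proof (rule INF_tendsto)
  fix w assume "w \<in> admissible M B L"
  then show "(\<lambda>n. fst w + real k * total_penalty M \<P> \<beta> \<Phi> (F n) w) \<longlonglongrightarrow>
      fst w + real k * total_penalty M \<P> \<beta> \<Phi> G w"
    using total_penalty_tendsto[OF F, of "\<lambda>_. fst w" "\<lambda>_. snd w" "fst w" "snd w"]
    by (intro tendsto_intros) (simp_all add: strategy_limit_def)
next
  fix r :: "nat \<Rightarrow> nat" and X :: "nat \<Rightarrow> real \<times> 'a strategy" assume r: "strict_mono r" and X: "\<And>n. X n \<in> admissible M B L"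
  obtain s c \<Delta> where s: "strict_mono s" "(c, \<Delta>) \<in> admissible M B L"
    "(\<lambda>m. fst (X (s m))) \<longlonglongrightarrow> c" "strategy_limit M (\<lambda>m. snd (X (s m))) \<Delta>"
    using admissible_compact[of M L X, OF M less_imp_le[OF L] X] by blast
  have "(\<lambda>n. total_penalty M \<P> \<beta> \<Phi> (F (r (s n))) (fst (X (s n)), snd (X (s n)))) \<longlonglongrightarrow>
      total_penalty M \<P> \<beta> \<Phi> G (c, \<Delta>)"
    using total_penalty_tendsto[OF algebra_limit_subseq[OF F strict_mono_o[OF r s(1)]] _ s(3,4)] X by simp
  then have "(\<lambda>n. fst (X (s n)) + real k * total_penalty M \<P> \<beta> \<Phi> (F (r (s n))) (X (s n))) \<longlonglongrightarrow>
      c + real k * total_penalty M \<P> \<beta> \<Phi> G (c, \<Delta>)"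
    by (intro tendsto_intros s(3)) simp
  then show "\<exists>s w. strict_mono s \<and> w \<in> admissible M B L \<and>
      (\<lambda>n. fst (X (s n)) + real k * total_penalty M \<P> \<beta> \<Phi> (F (r (s n))) (X (s n))) \<longlonglongrightarrow>
      fst w + real k * total_penalty M \<P> \<beta> \<Phi> G w"
    using s by (intro exI[of _ s] exI[of _ "(c, \<Delta>)"]) simp
qed

text \<open>Every admissible strategy is the limit of ridge strategies with the same initial
  capital, along which the penalty converges for the fixed algebra.\<close>

lemma ridge_penalised_price_eq:
  assumes \<psi>: "admissible_activation \<psi>" and G: "\<And>P. P \<in> \<P> \<Longrightarrow> subalgebra P G"
  shows "ridge_penalised_price M \<P> \<beta> \<psi> B L k \<Phi> G = penalised_price M \<P> \<beta> B L k \<Phi> G"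
  unfolding ridge_penalised_price_def penalised_price_def penalised_value_alt
proof (rule antisym)
  show "(INF w\<in>admissible M B L. ereal (fst w + real k * total_penalty M \<P> \<beta> \<Phi> G w))
      \<le> (INF w\<in>ridge_admissible M \<psi> B L. ereal (fst w + real k * total_penalty M \<P> \<beta> \<Phi> G w))"
    by (rule INF_superset_mono) (auto simp: ridge_admissible_def)
  show "(INF w\<in>ridge_admissible M \<psi> B L. ereal (fst w + real k * total_penalty M \<P> \<beta> \<Phi> G w))
      \<le> (INF w\<in>admissible M B L. ereal (fst w + real k * total_penalty M \<P> \<beta> \<Phi> G w))" (is "?r \<le> _")
  proof (rule INF_greatest)
    fix w assume w: "w \<in> admissible M B L"
    obtain c \<Delta> where cd: "w = (c, \<Delta>)" by (cases w)
    obtain X where X: "\<And>m. (c, X m) \<in> ridge_admissible M \<psi> B L" "strategy_limit M X \<Delta>"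
      using ridge_admissible_dense[OF M \<psi> B L w[unfolded cd]] unfolding strategy_limit_def by blast
    have "(\<lambda>m. total_penalty M \<P> \<beta> \<Phi> G (c, X m)) \<longlonglongrightarrow> total_penalty M \<P> \<beta> \<Phi> G w"
      unfolding cd using X(1)
      by (intro total_penalty_tendsto[OF algebra_limit_const[OF G] _ tendsto_const X(2)])
         (auto simp: ridge_admissible_def)
    then have "(\<lambda>m. ereal (c + real k * total_penalty M \<P> \<beta> \<Phi> G (c, X m))) \<longlonglongrightarrow>
        ereal (fst w + real k * total_penalty M \<P> \<beta> \<Phi> G w)"
      by (intro tendsto_intros) (simp_all add: cd)
    then show "?r \<le> ereal (fst w + real k * total_penalty M \<P> \<beta> \<Phi> G w)"
    proof (rule LIMSEQ_le_const)
      have "?r \<le> ereal (c + real k * total_penalty M \<P> \<beta> \<Phi> G (c, X m))" for m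
        by (rule INF_lower2[OF X(1)[of m]]) simp
      then show "\<exists>N. \<forall>n\<ge>N. ?r \<le> ereal (c + real k * total_penalty M \<P> \<beta> \<Phi> G (c, X n))" by blast
    qed
  qed
qed

lemma penalty_nonneg: "0 \<le> total_penalty M \<P> \<beta> \<Phi> G w"
proof -
  have "\<beta> x \<ge> 0" for x using \<beta>_zero[of x] \<beta>_pos[of x] by (cases "x \<le> 0") auto
  then show ?thesis unfolding total_penalty_def by (intro sum_nonneg integral_nonneg_AE) auto
qed

text \<open>Since \<beta> is positive precisely on positive arguments, each nonnegative summand
  vanishes iff the conditional shortfall is almost surely nonpositive; linearity then separates
  payoff and wealth.\<close>

lemma total_penalty_zero_iff:
  assumes G: "\<And>P. P \<in> \<P> \<Longrightarrow> subalgebra P G" and adm: "(c, \<Delta>) \<in> admissible M B L"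
  shows "total_penalty M \<P> \<beta> \<Phi> G (c, \<Delta>) = 0 \<longleftrightarrow>
    (\<forall>P\<in>\<P>. AE x in P. real_cond_exp P G (wealth M c \<Delta>) x \<ge> real_cond_exp P G \<Phi> x)"
proof -
  have nn: "\<beta> x \<ge> 0" for x using \<beta>_zero[of x] \<beta>_pos[of x] by (cases "x \<le> 0") auto
  obtain K where K: "\<And>c \<Delta> x. (c, \<Delta>) \<in> admissible M B L \<Longrightarrow> x \<in> Omega M \<Longrightarrow> \<bar>\<Phi> x - wealth M c \<Delta> x\<bar> \<le> K"
    using shortfall by blast
  obtain K' where K': "\<And>c \<Delta> x. (c, \<Delta>) \<in> admissible M B L \<Longrightarrow> x \<in> Omega M \<Longrightarrow> \<bar>wealth M c \<Delta> x\<bar> \<le> K'"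
    using wealth_bounded[OF M less_imp_le[OF B] costs] by metis
  have "(\<integral>x. \<beta> (real_cond_exp P G (\<lambda>y. \<Phi> y - wealth M c \<Delta> y) x) \<partial>P) = 0 \<longleftrightarrow>
      (AE x in P. real_cond_exp P G (wealth M c \<Delta>) x \<ge> real_cond_exp P G \<Phi> x)" if P: "P \<in> \<P>" for P
  proof -
    have P': "P \<in> prob_measures M" using P \<P> by blast
    then have prob: "prob_space P" by (simp add: prob_measures_def)
    interpret sigma_finite_subalgebra P G by (rule sigma_finite_subalgebraI[OF prob G[OF P]])
    note sp = space_prob_measure[OF P'] and ms = measurable_prob_measure[OF P']
    have "integrable P \<Phi>"
      using \<Phi> \<Phi>_bound sp ms by (intro cond_exp_bounded(2)[OF prob G[OF P], of \<Phi> B]) auto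
    moreover have "integrable P (wealth M c \<Delta>)"
      using wealth_measurable[OF M adm] K'[OF adm] sp ms
      by (intro cond_exp_bounded(2)[OF prob G[OF P], of _ K']) auto
    ultimately have "AE x in P. real_cond_exp P G (\<lambda>y. \<Phi> y - wealth M c \<Delta> y) x
        = real_cond_exp P G \<Phi> x - real_cond_exp P G (wealth M c \<Delta>) x"
      by (rule real_cond_exp_diff)
    then have "AE x in P. real_cond_exp P G (\<lambda>y. \<Phi> y - wealth M c \<Delta> y) x \<le> 0 \<longleftrightarrow>
        real_cond_exp P G (wealth M c \<Delta>) x \<ge> real_cond_exp P G \<Phi> x"
      by eventually_elim simp
    then have "(AE x in P. real_cond_exp P G (\<lambda>y. \<Phi> y - wealth M c \<Delta> y) x \<le> 0) \<longleftrightarrow>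
        (AE x in P. real_cond_exp P G (wealth M c \<Delta>) x \<ge> real_cond_exp P G \<Phi> x)"
      by (rule eventually_subst)
    moreover have "(\<integral>x. \<beta> (real_cond_exp P G (\<lambda>y. \<Phi> y - wealth M c \<Delta> y) x) \<partial>P) = 0 \<longleftrightarrow>
        (AE x in P. real_cond_exp P G (\<lambda>y. \<Phi> y - wealth M c \<Delta> y) x \<le> 0)"
      using K[OF adm] sp
      by (intro penalty_zero_iff[OF prob G[OF P] shortfall_measurable[OF adm P], of K] \<beta> \<beta>_zero \<beta>_pos) auto
    ultimately show ?thesis by simp
  qed
  then show ?thesis
    unfolding total_penalty_def fst_conv snd_conv using nn \<P>(1)
    by (subst sum_nonneg_eq_0_iff) (auto intro!: integral_nonneg_AE)
qed

text \<open>The superhedging constraint is the zero set of the penalty, so this is the penalty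
  method over a sequentially compact class.\<close>

lemma penalised_price_tendsto_superhedging:
  assumes G: "\<And>P. P \<in> \<P> \<Longrightarrow> subalgebra P G"
  shows "(\<lambda>k. penalised_price M \<P> \<beta> B L k \<Phi> G) \<longlonglongrightarrow> superhedging_price M \<P> B L \<Phi> G"
proof -
  have "(\<lambda>k. INF w\<in>admissible M B L. ereal (fst w + real k * total_penalty M \<P> \<beta> \<Phi> G w)) \<longlonglongrightarrow>
      (INF w\<in>{w \<in> admissible M B L. total_penalty M \<P> \<beta> \<Phi> G w = 0}. ereal (fst w))"
  proof (rule penalty_method_tendsto)
    show "\<bar>fst w\<bar> \<le> B" if "w \<in> admissible M B L" for w using that by (auto simp: admissible_def)
    fix X :: "nat \<Rightarrow> real \<times> 'a strategy" assume X: "\<And>n. X n \<in> admissible M B L"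
    obtain s c \<Delta> where s: "strict_mono s" "(c, \<Delta>) \<in> admissible M B L"
      "(\<lambda>m. fst (X (s m))) \<longlonglongrightarrow> c" "strategy_limit M (\<lambda>m. snd (X (s m))) \<Delta>"
      using admissible_compact[of M L X, OF M less_imp_le[OF L] X] by blast
    have "(\<lambda>n. total_penalty M \<P> \<beta> \<Phi> G (fst (X (s n)), snd (X (s n)))) \<longlonglongrightarrow> total_penalty M \<P> \<beta> \<Phi> G (c, \<Delta>)"
      using X by (intro total_penalty_tendsto[OF algebra_limit_const[OF G] _ s(3,4)]) simp_all
    then show "\<exists>s w. strict_mono s \<and> w \<in> admissible M B L \<and> (\<lambda>n. fst (X (s n))) \<longlonglongrightarrow> fst w \<and>
        (\<lambda>n. total_penalty M \<P> \<beta> \<Phi> G (X (s n))) \<longlonglongrightarrow> total_penalty M \<P> \<beta> \<Phi> G w"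
      using s by (intro exI[of _ s] exI[of _ "(c, \<Delta>)"]) simp
  qed (rule penalty_nonneg)
  moreover have "{w \<in> admissible M B L. total_penalty M \<P> \<beta> \<Phi> G w = 0} =
     {(c, \<Delta>) \<in> admissible M B L. \<forall>P\<in>\<P>. AE x in P. real_cond_exp P G (wealth M c \<Delta>) x \<ge> real_cond_exp P G \<Phi> x}"
    using total_penalty_zero_iff[OF G] by auto
  ultimately show ?thesis
    unfolding penalised_price_def penalised_value_alt superhedging_price_def
    by (simp add: case_prod_unfold)
qed

end

theorem mainTheorem1:
  fixes M :: "('a::finite) market"
    and \<P> :: "'a path measure set"
    and \<beta> \<psi> :: "real \<Rightarrow> real"
    and B L :: real
    and \<Phi> :: "'a path \<Rightarrow> real"
    and H :: "nat \<Rightarrow> (real ^ 'a) set set"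
  assumes "valid_market M"
    and "0 < B" and "0 < L"
    and "continuous_cost M (trans_cost M)"
    and "continuous_cost M (liq_cost M)"
    and "continuous_cost M (borrow_cost M)"
    and "finite \<P>" and "\<P> \<noteq> {}" and "\<P> \<subseteq> prob_measures M"
    and "continuous_on UNIV \<beta>"
    and "\<And>x. x \<le> 0 \<Longrightarrow> \<beta> x = 0" and "\<And>x. x > 0 \<Longrightarrow> \<beta> x > 0"
    and "\<psi> = relu \<or> (\<psi> C1_differentiable_on UNIV \<and> (\<nexists>p :: real poly. \<psi> = poly p))"
    and "\<Phi> \<in> borel_measurable (Omega_borel M)"
    and "\<And>x. x \<in> Omega M \<Longrightarrow> \<bar>\<Phi> x\<bar> \<le> B"
    and "nested_partitions M H"
    and "sets (terminal_algebra M) =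
           sigma_sets (Omega M) (\<Union>i. sets (partition_algebra M (H i)))"
  shows "\<exists>r x :: nat \<Rightarrow> ereal.
     (\<forall>k. (\<lambda>i. ridge_penalised_price M \<P> \<beta> \<psi> B L k \<Phi> (partition_algebra M (H i))) \<longlonglongrightarrow> r k) \<and>
     (\<forall>k. (\<lambda>i. penalised_price M \<P> \<beta> B L k \<Phi> (partition_algebra M (H i))) \<longlonglongrightarrow> x k) \<and>
     r \<longlonglongrightarrow> superhedging_price M \<P> B L \<Phi> (terminal_algebra M) \<and>
     x \<longlonglongrightarrow> superhedging_price M \<P> B L \<Phi> (terminal_algebra M) \<and>
     (\<lambda>k. penalised_price M \<P> \<beta> B L k \<Phi> (terminal_algebra M))
       \<longlonglongrightarrow> superhedging_price M \<P> B L \<Phi> (terminal_algebra M)"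
proof -
  have \<psi>: "admissible_activation \<psi>" using assms(13) by (simp add: admissible_activation_def)
  note market = assms(1-6) and beta = assms(10-12) and payoff = assms(14,15)
  let ?F = "\<lambda>i. partition_algebra M (H i)" and ?G = "terminal_algebra M"
  let ?v = "\<lambda>k. penalised_price M \<P> \<beta> B L k \<Phi> ?G"
  have lim: "algebra_limit \<P> ?F ?G"
    by (rule algebra_limit_partitions[OF assms(1,9,16,17)])
  have x: "(\<lambda>i. penalised_price M \<P> \<beta> B L k \<Phi> (?F i)) \<longlonglongrightarrow> ?v k" for k
    using penalised_price_tendsto[OF market assms(7,9) beta payoff lim] .
  have r: "(\<lambda>i. ridge_penalised_price M \<P> \<beta> \<psi> B L k \<Phi> (?F i)) \<longlonglongrightarrow> ?v k" for k
  proof -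
    have "ridge_penalised_price M \<P> \<beta> \<psi> B L k \<Phi> (?F i) = penalised_price M \<P> \<beta> B L k \<Phi> (?F i)" for i
      by (rule ridge_penalised_price_eq[OF market assms(7,9) beta payoff \<psi>])
         (use lim in \<open>simp_all add: algebra_limit_def\<close>)
    then show ?thesis using x by simp
  qed
  have "?v \<longlonglongrightarrow> superhedging_price M \<P> B L \<Phi> ?G"
    by (rule penalised_price_tendsto_superhedging[OF market assms(7,9) beta payoff])
       (use lim in \<open>simp_all add: algebra_limit_def\<close>)
  \<comment> \<open>One sequence serves as both \<open>r\<close> and \<open>x\<close>: for each
    partition algebra the two prices agree, so their limits in the partition index do as
    well.\<close>
  then show ?thesis using x r by (intro exI[of _ ?v]) blast
qed

end
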